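(* Let $(B_0,B_1)$ be an interpolation couple of complex Banach spaces, let $\theta\in(0,1)$ and let $p\in(1,+\infty)$. Assume that the dual norm on $B_0^*$ is weakly locally uniformly rotund. Then the dual $B_{\theta,p}^*$ of the real interpolation space $B_{\theta,p}=(B_0,B_1)_{\theta,p}$ admits an equivalent locally uniformly rotund dual norm.
   Context: An interpolation couple $(B_0,B_1)$ is a pair of complex Banach spaces continuously embedded in a common Hausdorff topological vector space. Real interpolation space: for $a\in B_0+B_1$ and $t>0$ let $K(t,a)=\inf\{\|a_0\|_{B_0}+t\|a_1\|_{B_1}: a=a_0+a_1,\ a_j\in B_j\}$. Then $B_{\theta,p}=\{a\in B_0+B_1: \|a\|_{B_{\theta,p}}=\left[\int_0^\infty (t^{-\theta}K(t,a))^p\frac{dt}{t}\right]^{1/p}<+\infty\}$, a Banach space with this norm. A norm $\|\cdot\|$ on a Banach space $X$ is locally uniformly rotund (LUR), respectively weakly locally uniformly rotund (weakly LUR), if $\|x_n-x\|\to 0$, respectively $x_n-x\to 0$ in the weak topology $\sigma(X,X^* )$ of $X$, whenever $x\in X$ and $(x_n)$ is a sequence in $X$ with $\lim_n\|x_n\|=\|x\|$ and $\lim_n\|x_n+x\|=2\|x\|$; equivalently, whenever $2\|x_n\|^2+2\|x\|^2-\|x_n+x\|^2\to 0$. For a dual space $X^*$, the weak topology is $\sigma(X^*,X^{**})$. An equivalent dual norm on $X^*$ is a norm on $X^*$ that is the dual norm of some equivalent norm on $X$. *)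

theory Defs
  imports "HOL-Analysis.Analysis" "HOL-Library.Function_Algebras"
begin

class complex_vector = ab_group_add +
  fixes scaleC :: "complex \<Rightarrow> 'a \<Rightarrow> 'a"  (infixr "*\<^sub>C" 75)
  assumes scaleC_add_right: "c *\<^sub>C (x + y) = c *\<^sub>C x + c *\<^sub>C y"
    and scaleC_add_left: "(c + d) *\<^sub>C x = c *\<^sub>C x + d *\<^sub>C x"
    and scaleC_scaleC: "c *\<^sub>C d *\<^sub>C x = (c * d) *\<^sub>C x"
    and scaleC_one: "1 *\<^sub>C x = x"

class complex_banach = complex_vector + banach +
  assumes scaleR_scaleC: "r *\<^sub>R x = complex_of_real r *\<^sub>C x"
    and norm_scaleC: "norm (c *\<^sub>C x) = cmod c * norm x"

class complex_tvs = complex_vector + topological_ab_group_add +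
  assumes tendsto_scaleC_Pair:
    "LIM q (nhds c \<times>\<^sub>F nhds x). fst q *\<^sub>C snd q :> nhds (c *\<^sub>C x)"

instantiation complex :: complex_vector
begin

definition scaleC_complex :: "complex \<Rightarrow> complex \<Rightarrow> complex"
  where "scaleC_complex c x = c * x"

instance
  by standard (simp_all add: scaleC_complex_def algebra_simps)

end

instantiation "fun" :: (type, complex_vector) complex_vector
begin

definition scaleC_fun :: "complex \<Rightarrow> ('a \<Rightarrow> 'b) \<Rightarrow> 'a \<Rightarrow> 'b"
  where "scaleC_fun c f = (\<lambda>x. c *\<^sub>C f x)"

instance
  by standard (simp_all add: scaleC_fun_def fun_eq_iff scaleC_add_right scaleC_add_left
      scaleC_scaleC scaleC_one)

end

text \<open>A normed space is given below by a complex linear subspace \<open>V\<close> of a complex vector space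
  together with a function \<open>N\<close>, of which only the values on \<open>V\<close> matter.\<close>

definition cnorm_on :: "'v::complex_vector set \<Rightarrow> ('v \<Rightarrow> real) \<Rightarrow> bool" where
  "cnorm_on V N \<longleftrightarrow>
     (\<forall>x\<in>V. 0 \<le> N x \<and> (N x = 0 \<longleftrightarrow> x = 0)) \<and>
     (\<forall>x\<in>V. \<forall>y\<in>V. N (x + y) \<le> N x + N y) \<and>
     (\<forall>c. \<forall>x\<in>V. N (c *\<^sub>C x) = cmod c * N x)"

definition equivalent_norm_on ::
    "'v::complex_vector set \<Rightarrow> ('v \<Rightarrow> real) \<Rightarrow> ('v \<Rightarrow> real) \<Rightarrow> bool" where
  "equivalent_norm_on V N M \<longleftrightarrow>
     cnorm_on V M \<and> (\<exists>c>0. \<exists>C>0. \<forall>x\<in>V. c * N x \<le> M x \<and> M x \<le> C * N x)"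

text \<open>Functionals on \<open>V\<close> are extended by \<open>0\<close> outside \<open>V\<close>, so that equal functionals on \<open>V\<close> are
  equal functions and the dual is a linear subspace of the function space.\<close>

definition cdual :: "'v::complex_vector set \<Rightarrow> ('v \<Rightarrow> real) \<Rightarrow> ('v \<Rightarrow> complex) set" where
  "cdual V N = {f.
     (\<forall>x\<in>V. \<forall>y\<in>V. f (x + y) = f x + f y) \<and>
     (\<forall>c. \<forall>x\<in>V. f (c *\<^sub>C x) = c * f x) \<and>
     (\<exists>C. \<forall>x\<in>V. cmod (f x) \<le> C * N x) \<and>
     (\<forall>x. x \<notin> V \<longrightarrow> f x = 0)}"

definition dual_norm :: "'v::complex_vector set \<Rightarrow> ('v \<Rightarrow> real) \<Rightarrow> ('v \<Rightarrow> complex) \<Rightarrow> real" where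
  "dual_norm V N f = Sup {cmod (f x) | x. x \<in> V \<and> N x \<le> 1}"

definition equivalent_dual_norm_on ::
    "'v::complex_vector set \<Rightarrow> ('v \<Rightarrow> real) \<Rightarrow> (('v \<Rightarrow> complex) \<Rightarrow> real) \<Rightarrow> bool" where
  "equivalent_dual_norm_on V N D \<longleftrightarrow>
     (\<exists>M. equivalent_norm_on V N M \<and> (\<forall>f\<in>cdual V N. D f = dual_norm V M f))"

definition weak_topology :: "'v::complex_vector set \<Rightarrow> ('v \<Rightarrow> real) \<Rightarrow> 'v topology" where
  "weak_topology V N =
     topology_generated_by {{x\<in>V. f x \<in> U} | f U. f \<in> cdual V N \<and> open U}"

definition LUR_on :: "'v::complex_vector set \<Rightarrow> ('v \<Rightarrow> real) \<Rightarrow> bool" where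
  "LUR_on V N \<longleftrightarrow>
     (\<forall>x\<in>V. \<forall>s::nat \<Rightarrow> 'v. range s \<subseteq> V \<longrightarrow>
        (\<lambda>n. N (s n)) \<longlonglongrightarrow> N x \<longrightarrow> (\<lambda>n. N (s n + x)) \<longlonglongrightarrow> 2 * N x \<longrightarrow>
        (\<lambda>n. N (s n - x)) \<longlonglongrightarrow> 0)"

definition weakly_LUR_on :: "'v::complex_vector set \<Rightarrow> ('v \<Rightarrow> real) \<Rightarrow> bool" where
  "weakly_LUR_on V N \<longleftrightarrow>
     (\<forall>x\<in>V. \<forall>s::nat \<Rightarrow> 'v. range s \<subseteq> V \<longrightarrow>
        (\<lambda>n. N (s n)) \<longlonglongrightarrow> N x \<longrightarrow> (\<lambda>n. N (s n + x)) \<longlonglongrightarrow> 2 * N x \<longrightarrow>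
        limitin (weak_topology V N) (\<lambda>n. s n - x) 0 sequentially)"

text \<open>The spaces \<open>B\<^sub>0\<close> and \<open>B\<^sub>1\<close> are the types \<open>'a\<close> and \<open>'b\<close>; \<open>j0\<close> and \<open>j1\<close> are their continuous
  embeddings in the common Hausdorff topological vector space \<open>'e\<close>. The sum and the
  interpolation spaces are subspaces of \<open>'e\<close>.\<close>

definition interpolation_couple ::
    "('a::complex_banach \<Rightarrow> 'e::{complex_tvs,t2_space}) \<Rightarrow> ('b::complex_banach \<Rightarrow> 'e) \<Rightarrow> bool" where
  "interpolation_couple j0 j1 \<longleftrightarrow>
     Vector_Spaces.linear (*\<^sub>C) (*\<^sub>C) j0 \<and> inj j0 \<and> continuous_on UNIV j0 \<and>
     Vector_Spaces.linear (*\<^sub>C) (*\<^sub>C) j1 \<and> inj j1 \<and> continuous_on UNIV j1"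

definition K_functional ::
    "('a::complex_banach \<Rightarrow> 'e::complex_vector) \<Rightarrow> ('b::complex_banach \<Rightarrow> 'e) \<Rightarrow>
     real \<Rightarrow> 'e \<Rightarrow> real" where
  "K_functional j0 j1 t a = Inf {norm a0 + t * norm a1 | a0 a1. a = j0 a0 + j1 a1}"

definition interp_integral ::
    "('a::complex_banach \<Rightarrow> 'e::complex_vector) \<Rightarrow> ('b::complex_banach \<Rightarrow> 'e) \<Rightarrow>
     real \<Rightarrow> real \<Rightarrow> 'e \<Rightarrow> ennreal" where
  "interp_integral j0 j1 \<theta> p a =
     (\<integral>\<^sup>+t\<in>{0<..}. ennreal ((t powr (-\<theta>) * K_functional j0 j1 t a) powr p / t) \<partial>lborel)"

definition interp_space ::
    "('a::complex_banach \<Rightarrow> 'e::complex_vector) \<Rightarrow> ('b::complex_banach \<Rightarrow> 'e) \<Rightarrow>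
     real \<Rightarrow> real \<Rightarrow> 'e set" where
  "interp_space j0 j1 \<theta> p =
     {a. (\<exists>a0 a1. a = j0 a0 + j1 a1) \<and> interp_integral j0 j1 \<theta> p a < \<infinity>}"

definition interp_norm ::
    "('a::complex_banach \<Rightarrow> 'e::complex_vector) \<Rightarrow> ('b::complex_banach \<Rightarrow> 'e) \<Rightarrow>
     real \<Rightarrow> real \<Rightarrow> 'e \<Rightarrow> real" where
  "interp_norm j0 j1 \<theta> p a = enn2real (interp_integral j0 j1 \<theta> p a) powr (1 / p)"

end

theory Submission imports Defs begin

text \<open>All dual norms are suprema of \<open>\<bar>f a\<bar>\<close> over bounded sets of points \<open>a\<close> of the predual, and
  countably many of them are combined in an \<open>\<ell>\<^sup>2\<close>-sum, because the LUR hypothesis for such a sum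
  passes to every summand.

  First, \<open>B\<^sub>0\<^sup>*\<close> has an equivalent LUR dual norm. A Stone type argument for the gauge
  \<open>2 - \<parallel>x + y\<parallel>\<close> on the unit sphere assigns to \<open>x\<close> centres \<open>c m x\<close> that are locally constant on
  countably many pieces covering the sphere, and unimodular multiples of \<open>c m x\<close> converge
  weakly to \<open>x\<close>. By the Hahn-Banach theorem \<open>x\<close> is a norm limit of linear combinations \<open>w x\<close> of
  the centres, with coefficients from a countable dense set. For each of the countably many
  pieces and combinations there is a test set that measures the distance to the line spanned by
  \<open>w x\<close>; together with weak convergence this forces norm convergence.

  Secondly, the LUR norm is transferred to the interpolation space \<open>X\<close>. Let \<open>N\<^sub>\<kappa> v\<close> be the infimum
  of the Euclidean norms of \<open>(\<parallel>v\<parallel>, \<kappa> \<parallel>a\<parallel>, \<kappa> \<parallel>b\<parallel>)\<close> over all \<open>v = a + b\<close>. The dual norm of \<open>N\<^sub>\<kappa>\<close> is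
  attained at a splitting \<open>f = f\<^sub>1 + (h\<^sub>0, h\<^sub>1)\<close>, and the LUR condition makes \<open>h\<^sub>0\<close> converge in norm while
  \<open>h\<^sub>1\<close> stays bounded, which suffices for convergence in \<open>X\<^sup>*\<close> because \<open>\<theta> < 1\<close>. The
  remainder \<open>f\<^sub>1\<close> tends to \<open>0\<close> as \<open>\<kappa> \<rightarrow> \<infinity>\<close>: bounded sequences of \<open>X\<close> that tend to \<open>0\<close> in
  \<open>B\<^sub>0 + B\<^sub>1\<close> are weakly null, since \<open>1 < p\<close>.\<close>

section \<open>Complex normed spaces on a carrier and their duals\<close>

text \<open>The hypothesis enters in two strengths. Tested on point evaluations, that is weak* only,
  it makes the neighbourhoods of the gauge open, because a strict lower bound for a dual norm is
  witnessed at one point of the predual. Tested on the whole bidual, it puts \<open>x\<close> into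
  the norm closed span of its centres; weak* convergence would give only a weak* closed span and no
  approximation in norm. The obstacle is that there are uncountably many centres but only countably
  many test sets. A test set must therefore read the label off the functional itself: a point
  \<open>u\<close> that nearly norms two functionals shows that these are close up to a rotation,
  and close functionals of the same piece share their label. In the transfer nothing forces
  \<open>f1\<close> to converge, only its norm does. Hence an error of twice the norm of
  \<open>f1\<close> remains for each fixed \<kappa>, and a whole sequence of values \<kappa> has to
  be put into the l2 sum.\<close>

interpretation cvec: vector_space "scaleC :: complex \<Rightarrow> 'v \<Rightarrow> 'v::complex_vector"
  by unfold_locales (simp_all add: scaleC_add_right scaleC_add_left scaleC_scaleC scaleC_one)

lemma scaleC_fun_apply [simp]: "(c *\<^sub>C f) x = c *\<^sub>C f x"
  by (simp add: scaleC_fun_def)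

lemma scaleC_complex_eq [simp]: "c *\<^sub>C (z::complex) = c * z"
  by (simp add: scaleC_complex_def)

lemma scaleC_minus_one: "(-1) *\<^sub>C x = - (x::'v::complex_vector)"
  using cvec.scale_minus_left[of 1 x] by simp

lemma fun_eval [simp]:
  "(f + g) x = f x + g x" "(f - g) x = f x - g x" "(- f) x = - f x" "0 x = (0::complex)"
  for f g :: "'v \<Rightarrow> complex"
  by (simp_all add: zero_fun_def)

lemma unimodular_rotation:
  obtains c :: complex where "cmod c = 1" "c * z = complex_of_real (cmod z)"
proof (cases "z = 0")
  case True
  then show ?thesis using that[of 1] by simp
next
  case False
  show ?thesis
  proof (rule that)
    show "cmod (cnj z / cmod z) = 1" using False by (simp add: norm_divide)
    show "cnj z / cmod z * z = complex_of_real (cmod z)"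
      using False by (simp add: complex_norm_square[symmetric] mult.commute power2_eq_square)
  qed
qed

text \<open>Applied to \<open>inverse c\<close> the inequality gives its own converse, so seminorm
  proofs below need only one direction; \<open>0 \<le> q 0\<close> settles
  \<open>c = 0\<close>.\<close>

lemma homogeneous_if_le:
  fixes q :: "'v::complex_vector \<Rightarrow> real"
  assumes "cvec.subspace V" "x \<in> V" "0 \<le> q 0"
    and le: "\<And>c x. x \<in> V \<Longrightarrow> q (c *\<^sub>C x) \<le> cmod c * q x"
  shows "q (c *\<^sub>C x) = cmod c * q x"
proof (cases "c = 0")
  case True
  then show ?thesis using le[OF assms(2), of 0] assms(3) by simp
next
  case False
  have "q (inverse c *\<^sub>C c *\<^sub>C x) \<le> cmod (inverse c) * q (c *\<^sub>C x)"
    using assms(1,2) by (intro le) (rule cvec.subspace_scale)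
  then have "cmod c * q x \<le> q (c *\<^sub>C x)"
    using False by (simp add: norm_divide field_simps)
  then show ?thesis using le[OF assms(2), of c] by simp
qed

locale cnormed =
  fixes V :: "'v::complex_vector set" and N :: "'v \<Rightarrow> real"
  assumes sub: "cvec.subspace V" and nrm: "cnorm_on V N"
begin

lemma mem [simp, intro]:
  "0 \<in> V" "x \<in> V \<Longrightarrow> y \<in> V \<Longrightarrow> x + y \<in> V" "x \<in> V \<Longrightarrow> c *\<^sub>C x \<in> V"
  "x \<in> V \<Longrightarrow> y \<in> V \<Longrightarrow> x - y \<in> V" "x \<in> V \<Longrightarrow> - x \<in> V"
  using sub by (auto intro: cvec.subspace_0 cvec.subspace_add cvec.subspace_scale
      cvec.subspace_diff cvec.subspace_neg)

lemma N_nonneg [simp]: "x \<in> V \<Longrightarrow> 0 \<le> N x"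
  and N_eq_0: "x \<in> V \<Longrightarrow> N x = 0 \<longleftrightarrow> x = 0"
  and N_triangle: "x \<in> V \<Longrightarrow> y \<in> V \<Longrightarrow> N (x + y) \<le> N x + N y"
  and N_scale [simp]: "x \<in> V \<Longrightarrow> N (c *\<^sub>C x) = cmod c * N x"
  using nrm unfolding cnorm_on_def by auto

lemma N_0 [simp]: "N 0 = 0"
  using N_eq_0[of 0] by simp

lemma N_minus [simp]: "x \<in> V \<Longrightarrow> N (- x) = N x"
  using N_scale[of x "-1"] by (simp add: scaleC_minus_one)

lemma N_diff: "x \<in> V \<Longrightarrow> y \<in> V \<Longrightarrow> N (x - y) \<le> N x + N y"
  using N_triangle[of x "- y"] by simp

lemma dualI:
  assumes "\<And>x y. x \<in> V \<Longrightarrow> y \<in> V \<Longrightarrow> f (x + y) = f x + f y"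
    and "\<And>c x. x \<in> V \<Longrightarrow> f (c *\<^sub>C x) = c * f x"
    and "\<And>x. x \<in> V \<Longrightarrow> cmod (f x) \<le> C * N x" and "\<And>x. x \<notin> V \<Longrightarrow> f x = 0"
  shows "f \<in> cdual V N"
  using assms unfolding cdual_def by blast

context
  fixes f assumes f: "f \<in> cdual V N"
begin

lemma dual_add: "x \<in> V \<Longrightarrow> y \<in> V \<Longrightarrow> f (x + y) = f x + f y"
  and dual_scale: "x \<in> V \<Longrightarrow> f (c *\<^sub>C x) = c * f x"
  and dual_outside: "x \<notin> V \<Longrightarrow> f x = 0"
  using f unfolding cdual_def by auto

lemma dual_0: "f 0 = 0"
  using dual_scale[of 0 0] by simp

lemma dual_minus: "x \<in> V \<Longrightarrow> f (- x) = - f x"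
  using dual_scale[of x "-1"] by (simp add: scaleC_minus_one)

lemma dual_diff: "x \<in> V \<Longrightarrow> y \<in> V \<Longrightarrow> f (x - y) = f x - f y"
  using dual_add[of x "- y"] by (simp add: dual_minus)

lemma dual_sum: "(\<And>i. i \<in> I \<Longrightarrow> F i \<in> V) \<Longrightarrow> f (\<Sum>i\<in>I. F i) = (\<Sum>i\<in>I. f (F i))"
proof (induction I rule: infinite_finite_induct)
  case (insert i I)
  then have "(\<Sum>i\<in>I. F i) \<in> V" using sub by (intro cvec.subspace_sum) auto
  then show ?case using insert by (simp add: dual_add)
qed (auto simp: dual_0)

lemma dual_bdd: "bdd_above {cmod (f x) | x. x \<in> V \<and> N x \<le> 1}"
proof -
  obtain C where C: "\<forall>x\<in>V. cmod (f x) \<le> C * N x"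
    using f unfolding cdual_def by auto
  have "cmod (f x) \<le> \<bar>C\<bar>" if "x \<in> V" "N x \<le> 1" for x
  proof -
    have "C * N x \<le> \<bar>C\<bar> * N x" using that by (intro mult_right_mono) auto
    also have "\<dots> \<le> \<bar>C\<bar> * 1" using that by (intro mult_left_mono) auto
    finally show ?thesis using C that by force
  qed
  then show ?thesis by (intro bdd_aboveI[of _ "\<bar>C\<bar>"]) auto
qed

lemma dual_unit_le: "x \<in> V \<Longrightarrow> N x \<le> 1 \<Longrightarrow> cmod (f x) \<le> dual_norm V N f"
  unfolding dual_norm_def by (rule cSup_upper[OF _ dual_bdd]) auto

lemma dual_norm_nonneg [simp]: "0 \<le> dual_norm V N f"
  using dual_unit_le[of 0] by (auto simp: dual_0)

lemma dual_norm_bound: "x \<in> V \<Longrightarrow> cmod (f x) \<le> dual_norm V N f * N x"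
proof (cases "x = 0")
  case False
  assume x: "x \<in> V"
  then have pos: "N x > 0" using False N_eq_0[of x] N_nonneg[of x] by linarith
  have "cmod (f (complex_of_real (inverse (N x)) *\<^sub>C x)) \<le> dual_norm V N f"
    using x pos by (intro dual_unit_le) (auto simp: norm_inverse)
  then show ?thesis using x pos by (simp add: dual_scale norm_mult field_simps norm_divide)
qed (simp add: dual_0)

lemma dual_norm_witness:
  assumes "r < dual_norm V N f"
  obtains x where "x \<in> V" "N x \<le> 1" "r < cmod (f x)"
proof -
  have "{cmod (f x) | x. x \<in> V \<and> N x \<le> 1} \<noteq> {}" using mem(1) N_0 by fastforce
  from less_cSupD[OF this assms[unfolded dual_norm_def]] show ?thesis using that by auto
qed

end

lemma dual_norm_least:
  assumes "\<And>x. x \<in> V \<Longrightarrow> N x \<le> 1 \<Longrightarrow> cmod (f x) \<le> C"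
  shows "dual_norm V N f \<le> C"
  unfolding dual_norm_def
proof (rule cSup_least)
  show "{cmod (f x) | x. x \<in> V \<and> N x \<le> 1} \<noteq> {}" using mem(1) N_0 by fastforce
qed (use assms in auto)

lemma dual_norm_le:
  assumes "0 \<le> C" "\<And>x. x \<in> V \<Longrightarrow> cmod (f x) \<le> C * N x"
  shows "dual_norm V N f \<le> C"
proof (rule dual_norm_least)
  fix x assume x: "x \<in> V" "N x \<le> 1"
  then have "C * N x \<le> C * 1" using assms(1) by (intro mult_left_mono) auto
  then show "cmod (f x) \<le> C" using assms(2)[OF x(1)] by simp
qed

lemma subspace_cdual: "cvec.subspace (cdual V N)"
proof (rule cvec.subspaceI)
  show "0 \<in> cdual V N" by (rule dualI[where C=0]) auto
next
  fix f g assume fg: "f \<in> cdual V N" "g \<in> cdual V N"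
  show "f + g \<in> cdual V N"
  proof (rule dualI[where C="dual_norm V N f + dual_norm V N g"])
    fix x assume x: "x \<in> V"
    show "cmod ((f + g) x) \<le> (dual_norm V N f + dual_norm V N g) * N x"
      using dual_norm_bound[OF fg(1) x] dual_norm_bound[OF fg(2) x]
        norm_triangle_ineq[of "f x" "g x"] by (simp add: distrib_right)
  qed (use fg in \<open>auto simp: dual_add dual_scale dual_outside algebra_simps\<close>)
next
  fix c f assume f: "f \<in> cdual V N"
  show "c *\<^sub>C f \<in> cdual V N"
  proof (rule dualI[where C="cmod c * dual_norm V N f"])
    fix x assume x: "x \<in> V"
    show "cmod ((c *\<^sub>C f) x) \<le> cmod c * dual_norm V N f * N x"
      using dual_norm_bound[OF f x] by (simp add: norm_mult mult_left_mono mult.assoc)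
  qed (use f in \<open>auto simp: dual_add dual_scale dual_outside algebra_simps\<close>)
qed

lemma cnorm_on_dual: "cnorm_on (cdual V N) (dual_norm V N)"
  unfolding cnorm_on_def
proof (intro conjI ballI allI)
  fix f assume f: "f \<in> cdual V N"
  show "0 \<le> dual_norm V N f" using f by simp
  show "(dual_norm V N f = 0) = (f = 0)"
  proof
    assume "dual_norm V N f = 0"
    then have "f x = 0" for x
      using dual_norm_bound[OF f, of x] dual_outside[OF f, of x] by (cases "x \<in> V") auto
    then show "f = 0" by (auto simp: fun_eq_iff)
  next
    assume "f = 0"
    then have "dual_norm V N f \<le> 0" by (intro dual_norm_le) auto
    then show "dual_norm V N f = 0" using dual_norm_nonneg[OF f] by linarith
  qed
next
  fix f g assume fg: "f \<in> cdual V N" "g \<in> cdual V N"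
  show "dual_norm V N (f + g) \<le> dual_norm V N f + dual_norm V N g"
  proof (rule dual_norm_le)
    fix x assume x: "x \<in> V"
    show "cmod ((f + g) x) \<le> (dual_norm V N f + dual_norm V N g) * N x"
      using dual_norm_bound[OF fg(1) x] dual_norm_bound[OF fg(2) x]
        norm_triangle_ineq[of "f x" "g x"] by (simp add: distrib_right)
  qed (use fg in auto)
next
  fix c f assume f: "f \<in> cdual V N"
  have le: "dual_norm V N (c *\<^sub>C f) \<le> cmod c * dual_norm V N f" if f: "f \<in> cdual V N" for c f
  proof (rule dual_norm_le)
    fix x assume x: "x \<in> V"
    show "cmod ((c *\<^sub>C f) x) \<le> cmod c * dual_norm V N f * N x"
      using dual_norm_bound[OF f x] by (simp add: norm_mult mult_left_mono mult.assoc)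
  qed (use f in auto)
  have "0 \<le> dual_norm V N 0" by (rule dual_norm_nonneg[OF cvec.subspace_0[OF subspace_cdual]])
  then show "dual_norm V N (c *\<^sub>C f) = cmod c * dual_norm V N f"
    by (rule homogeneous_if_le[where q="dual_norm V N", OF subspace_cdual f]) (rule le)
qed

lemma cnormed_dual: "cnormed (cdual V N) (dual_norm V N)"
  by (rule cnormed.intro[OF subspace_cdual cnorm_on_dual])

end

lemma cdual_equivalent:
  assumes "cnorm_on V N" "equivalent_norm_on V N M"
  shows "cdual V M = cdual V N"
proof -
  obtain c C where c: "c > 0" "C > 0" "\<forall>x\<in>V. c * N x \<le> M x \<and> M x \<le> C * N x"
    using assms(2) unfolding equivalent_norm_on_def by auto
  \<comment> \<open>A bound \<open>K\<close> taken from \<open>cdual\<close> may be negative, so it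
    is replaced by its absolute value before the norms are compared.\<close>
  have 1: "\<exists>K'. \<forall>x\<in>V. cmod (f x) \<le> K' * N x" if "\<forall>x\<in>V. cmod (f x) \<le> K * M x" for f K
  proof (intro exI ballI)
    fix x assume x: "x \<in> V"
    have "0 \<le> M x" using assms(2) x by (auto simp: equivalent_norm_on_def cnorm_on_def)
    then have "K * M x \<le> \<bar>K\<bar> * M x" by (intro mult_right_mono) auto
    also have "\<dots> \<le> \<bar>K\<bar> * (C * N x)" using c x by (intro mult_left_mono) auto
    finally show "cmod (f x) \<le> (\<bar>K\<bar> * C) * N x" using that x by force
  qed
  have 2: "\<exists>K'. \<forall>x\<in>V. cmod (f x) \<le> K' * M x" if "\<forall>x\<in>V. cmod (f x) \<le> K * N x" for f K
  proof (intro exI ballI)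
    fix x assume x: "x \<in> V"
    have "0 \<le> N x" using assms(1) x by (auto simp: cnorm_on_def)
    then have "K * N x \<le> \<bar>K\<bar> * N x" by (intro mult_right_mono) auto
    also have "\<dots> \<le> \<bar>K\<bar> * (M x / c)" using c x
      by (intro mult_left_mono) (auto simp: field_simps)
    finally show "cmod (f x) \<le> (\<bar>K\<bar> / c) * M x" using that x by force
  qed
  have "(\<exists>K. \<forall>x\<in>V. cmod (f x) \<le> K * M x) \<longleftrightarrow> (\<exists>K. \<forall>x\<in>V. cmod (f x) \<le> K * N x)" for f
    using 1 2 by metis
  then show ?thesis unfolding cdual_def by presburger
qed

lemma cnormed_UNIV: "cnormed (UNIV :: 'a::complex_banach set) norm"
  by unfold_locales (auto simp: cvec.subspace_UNIV cnorm_on_def norm_triangle_ineq norm_scaleC)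

section \<open>The Hahn-Banach theorem\<close>

text \<open>Homogeneity for positive reals only, as in the real Hahn-Banach theorem; it is phrased
  through \<open>complex_of_real\<close> because the carrier has a complex scaling.\<close>

definition sublinear_on :: "'v::complex_vector set \<Rightarrow> ('v \<Rightarrow> real) \<Rightarrow> bool" where
  "sublinear_on U p \<longleftrightarrow> (\<forall>x\<in>U. \<forall>y\<in>U. p (x + y) \<le> p x + p y) \<and>
     (\<forall>x\<in>U. \<forall>t>0. p (complex_of_real t *\<^sub>C x) = t * p x)"

lemma sublinear_onD:
  assumes "sublinear_on U p"
  shows "x \<in> U \<Longrightarrow> y \<in> U \<Longrightarrow> p (x + y) \<le> p x + p y"
    and "x \<in> U \<Longrightarrow> t > 0 \<Longrightarrow> p (complex_of_real t *\<^sub>C x) = t * p x"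
  using assms unfolding sublinear_on_def by auto

lemma sublinear_on_0:
  assumes "sublinear_on U p" "0 \<in> U"
  shows "p 0 = 0"
  using sublinear_onD(2)[OF assms, of 2] by simp

lemma sublinear_onI_le:
  assumes "\<And>x y. x \<in> U \<Longrightarrow> y \<in> U \<Longrightarrow> p (x + y) \<le> p x + p y"
    and "\<And>x t. x \<in> U \<Longrightarrow> t > 0 \<Longrightarrow> p (complex_of_real t *\<^sub>C x) \<le> t * p x"
    and "cvec.subspace U"
  shows "sublinear_on U p"
  unfolding sublinear_on_def
proof (intro conjI ballI allI impI)
  fix x and t :: real assume x: "x \<in> U" and t: "0 < t"
  have "complex_of_real t *\<^sub>C x \<in> U" using x assms(3) by (rule cvec.subspace_scale[rotated])
  from assms(2)[OF this, of "inverse t"] t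
  have "p x \<le> inverse t * p (complex_of_real t *\<^sub>C x)"
    by (simp flip: of_real_mult)
  then show "p (complex_of_real t *\<^sub>C x) = t * p x"
    using assms(2)[OF x t] t by (simp add: field_simps)
qed (use assms in auto)

lemma cInf_add_ge:
  fixes A B :: "real set"
  assumes "A \<noteq> {}" "B \<noteq> {}" "\<And>a b. a \<in> A \<Longrightarrow> b \<in> B \<Longrightarrow> c \<le> a + b"
  shows "c \<le> Inf A + Inf B"
proof -
  have "c - b \<le> Inf A" if "b \<in> B" for b
    using assms that by (intro cInf_greatest) (auto simp: algebra_simps)
  then have "c - Inf A \<le> Inf B"
    using assms(2) by (intro cInf_greatest) (auto simp: algebra_simps)
  then show ?thesis by simp
qed

text \<open>With a ray as \<open>W\<close> this shows that minimal sublinear functionals are linear, with a subspace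
  it is the extension step of the Hahn-Banach theorem.\<close>

lemma sublinear_shift:
  fixes U :: "'v::complex_vector set"
  assumes U: "cvec.subspace U" and m: "sublinear_on U m"
    and W: "W \<subseteq> U" "0 \<in> W" "\<And>x y. x \<in> W \<Longrightarrow> y \<in> W \<Longrightarrow> x + y \<in> W"
      "\<And>x t. x \<in> W \<Longrightarrow> t > 0 \<Longrightarrow> complex_of_real t *\<^sub>C x \<in> W"
    and h: "\<And>x y. x \<in> W \<Longrightarrow> y \<in> W \<Longrightarrow> h (x + y) = h x + h y"
      "\<And>x t. x \<in> W \<Longrightarrow> t > 0 \<Longrightarrow> h (complex_of_real t *\<^sub>C x) = t * h x"
      "\<And>x. x \<in> W \<Longrightarrow> h x \<le> (m x :: real)"
  obtains p where "sublinear_on U p" "\<And>x. x \<in> U \<Longrightarrow> p x \<le> m x" "\<And>w. w \<in> W \<Longrightarrow> p (- w) \<le> - h w"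
proof -
  \<comment> \<open>Infimal convolution along \<open>W\<close>: \<open>h \<le> m\<close> keeps the
    infimum finite, \<open>w = 0\<close> gives \<open>p \<le> m\<close>, and at \<open>- w\<close>
    the term of \<open>w\<close> is \<open>m 0 - h w = - h w\<close>.\<close>
  define p where "p x = Inf ((\<lambda>w. m (x + w) - h w) ` W)" for x
  have mem: "x + y \<in> U" "- x \<in> U" "c *\<^sub>C x \<in> U" if "x \<in> U" "y \<in> U" for x y c
    using U that by (auto intro: cvec.subspace_add cvec.subspace_neg cvec.subspace_scale)
  have bdd: "bdd_below ((\<lambda>w. m (x + w) - h w) ` W)" if x: "x \<in> U" for x
  proof (rule bdd_belowI2)
    fix w assume w: "w \<in> W"
    have "m w \<le> m (x + w) + m (- x)"
      using sublinear_onD(1)[OF m, of "x + w" "- x"] mem x w W by (auto simp: algebra_simps)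
    then show "- m (- x) \<le> m (x + w) - h w" using h(3)[OF w] by simp
  qed
  have ple: "p x \<le> m (x + w) - h w" if "x \<in> U" "w \<in> W" for x w
    unfolding p_def by (rule cInf_lower[OF _ bdd]) (use that in auto)
  have h0: "h 0 = 0" using h(1)[OF W(2) W(2)] by simp
  show thesis
  proof (rule that)
    show "sublinear_on U p"
    proof (rule sublinear_onI_le)
      fix x y assume xy: "x \<in> U" "y \<in> U"
      have "p (x + y) \<le> a + b"
        if ab: "a \<in> (\<lambda>w. m (x + w) - h w) ` W" "b \<in> (\<lambda>w. m (y + w) - h w) ` W" for a b
      proof -
        obtain v w where *: "v \<in> W" "w \<in> W" "a = m (x + v) - h v" "b = m (y + w) - h w"
          using ab by blast
        have "p (x + y) \<le> m (x + y + (v + w)) - h (v + w)"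
          using xy * W by (intro ple mem) auto
        also have "m (x + y + (v + w)) \<le> m (x + v) + m (y + w)"
          using sublinear_onD(1)[OF m mem(1)[of x v] mem(1)[of y w]] xy * W(1)
          by (auto simp: algebra_simps)
        finally show ?thesis using * h by simp
      qed
      then show "p (x + y) \<le> p x + p y"
        unfolding p_def[of x] p_def[of y] using W(2) by (intro cInf_add_ge) auto
    next
      fix x and t :: real assume x: "x \<in> U" and t: "0 < t"
      have "p (complex_of_real t *\<^sub>C x) / t \<le> p x"
        unfolding p_def[of x]
      proof (rule cInf_greatest)
        fix a assume "a \<in> (\<lambda>w. m (x + w) - h w) ` W"
        then obtain w where w: "w \<in> W" "a = m (x + w) - h w" by auto
        have "p (complex_of_real t *\<^sub>C x)
            \<le> m (complex_of_real t *\<^sub>C x + complex_of_real t *\<^sub>C w) - h (complex_of_real t *\<^sub>C w)"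
          using x w t W(4) by (intro ple mem(3)) auto
        also have "\<dots> = t * a"
          using w t h(2) sublinear_onD(2)[OF m mem(1)[of x w] t] W(1) x
          by (auto simp: right_diff_distrib scaleC_add_right)
        finally show "p (complex_of_real t *\<^sub>C x) / t \<le> a" using t by (simp add: field_simps)
      qed (use W(2) in auto)
      then show "p (complex_of_real t *\<^sub>C x) \<le> t * p x" using t by (simp add: field_simps)
    qed (rule U)
    show "p x \<le> m x" if "x \<in> U" for x
      using ple[OF that W(2)] h0 by simp
    show "p (- w) \<le> - h w" if "w \<in> W" for w
      using ple[of "- w" w] mem[of w w] that W(1) sublinear_on_0[OF m cvec.subspace_0[OF U]] by auto
  qed
qed

text \<open>A pointwise minimal sublinear functional is linear.\<close>

lemma sublinear_minorant:
  fixes U :: "'v::complex_vector set"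
  assumes U: "cvec.subspace U" and p: "sublinear_on U p"
  obtains g where "sublinear_on U g" "\<And>x. x \<in> U \<Longrightarrow> g x \<le> p x" "\<And>x. x \<in> U \<Longrightarrow> g (- x) = - g x"
proof -
  \<comment> \<open>Functionals are 0 outside \<open>U\<close> so that agreement on \<open>U\<close>
    is equality, as antisymmetry requires. The order \<open>P\<close> is reversed: the maximal
    element given by Zorn is a minimal functional.\<close>
  define A where "A = {q. sublinear_on U q \<and> (\<forall>x\<in>U. q x \<le> p x) \<and> (\<forall>x. x \<notin> U \<longrightarrow> q x = 0)}"
  define P where "P a b \<longleftrightarrow> (\<forall>x::'v. b x \<le> (a x :: real))" for a b
  have mem: "x + y \<in> U" "- x \<in> U" "c *\<^sub>C x \<in> U" if "x \<in> U" "y \<in> U" for x y c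
    using U that by (auto intro: cvec.subspace_add cvec.subspace_neg cvec.subspace_scale)
  have restr: "(\<lambda>x. if x \<in> U then q x else 0) \<in> A" if "sublinear_on U q" "\<forall>x\<in>U. q x \<le> p x" for q
    unfolding A_def sublinear_on_def using that mem by (auto simp: sublinear_on_def)
  have "\<exists>m\<in>A. \<forall>a\<in>A. P m a \<longrightarrow> a = m"
  proof (rule predicate_Zorn)
    show "partial_order_on A (relation_of P A)"
      by (rule partial_order_on_relation_ofI) (auto simp: P_def fun_eq_iff intro: order_trans order_antisym)
  next
    fix C assume C: "C \<in> Chains (relation_of P A)"
    show "\<exists>u\<in>A. \<forall>a\<in>C. P a u"
    proof (cases "C = {}")
      case True
      then show ?thesis using restr[OF p] by auto
    next
      case False
      have CA: "q \<in> A" if "q \<in> C" for q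
        using C that unfolding Chains_def relation_of_def by auto
      have chain: "P a b \<or> P b a" if "a \<in> C" "b \<in> C" for a b
        using C that unfolding Chains_def relation_of_def by auto
      define u where "u x = Inf ((\<lambda>q. q x) ` C)" for x
      have bdd: "bdd_below ((\<lambda>q. q x) ` C)" for x
      proof (cases "x \<in> U")
        case x: True
        show ?thesis
        proof (rule bdd_belowI2)
          fix q assume q: "q \<in> C"
          then have q': "sublinear_on U q" "q (- x) \<le> p (- x)" using CA[OF q] x mem[of x x] by (auto simp: A_def)
          have "0 \<le> q x + q (- x)"
            using sublinear_onD(1)[OF q'(1), of x "- x"] mem[of x x] x
              sublinear_on_0[OF q'(1)] cvec.subspace_0[OF U] by auto
          then show "- p (- x) \<le> q x" using q'(2) by linarith
        qed
      next
        case False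
        then have "q x = 0" if "q \<in> C" for q using CA[OF that] by (simp add: A_def)
        then show ?thesis using order_refl by (metis bdd_belowI2)
      qed
      have ule: "u x \<le> q x" if "q \<in> C" for q x
        unfolding u_def by (rule cInf_lower[OF _ bdd]) (use that in auto)
      have "sublinear_on U u"
      proof (rule sublinear_onI_le)
        fix x y assume xy: "x \<in> U" "y \<in> U"
        have "u (x + y) \<le> a + b" if ab: "a \<in> (\<lambda>q. q x) ` C" "b \<in> (\<lambda>q. q y) ` C" for a b
        proof -
          obtain q r where *: "q \<in> C" "r \<in> C" "a = q x" "b = r y" using ab by blast
          \<comment> \<open>In a chain one member lies below both \<open>q\<close> and
            \<open>r\<close>, which reduces subadditivity of the infimum to that of a single
            functional.\<close>
          have "\<exists>s\<in>C. s x \<le> a \<and> s y \<le> b"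
            using chain[OF *(1,2)] * unfolding P_def by blast
          then obtain s where s: "s \<in> C" "s x \<le> a" "s y \<le> b" by auto
          have "s (x + y) \<le> s x + s y"
            using CA[OF s(1)] xy by (auto simp: A_def sublinear_on_def)
          then show ?thesis using ule[OF s(1), of "x + y"] s by linarith
        qed
        then show "u (x + y) \<le> u x + u y"
          unfolding u_def[of x] u_def[of y] using False by (intro cInf_add_ge) auto
      next
        fix x and t :: real assume x: "x \<in> U" and t: "0 < t"
        have "u (complex_of_real t *\<^sub>C x) / t \<le> u x"
          unfolding u_def[of x]
        proof (rule cInf_greatest)
          fix a assume "a \<in> (\<lambda>q. q x) ` C"
          then obtain q where q: "q \<in> C" "a = q x" by auto
          have "q (complex_of_real t *\<^sub>C x) = t * a"
            using CA[OF q(1)] x t q by (auto simp: A_def sublinear_on_def)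
          then show "u (complex_of_real t *\<^sub>C x) / t \<le> a"
            using ule[OF q(1), of "complex_of_real t *\<^sub>C x"] t by (simp add: field_simps)
        qed (use False in auto)
        then show "u (complex_of_real t *\<^sub>C x) \<le> t * u x" using t by (simp add: field_simps)
      qed (rule U)
      moreover obtain q where q: "q \<in> C" using False by auto
      moreover have "u x = 0" if "x \<notin> U" for x
      proof -
        have "(\<lambda>q. q x) ` C = {0}" using CA that q by (force simp: A_def)
        then show ?thesis by (simp add: u_def)
      qed
      ultimately have "u \<in> A" using CA[OF q] ule[OF q] by (auto simp: A_def intro: order_trans)
      then show ?thesis using ule by (auto simp: P_def)
    qed
  qed
  then obtain g where g: "g \<in> A" and min: "\<And>a. a \<in> A \<Longrightarrow> (\<And>x. a x \<le> g x) \<Longrightarrow> a = g"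
    by (auto simp: P_def)
  have gs: "sublinear_on U g" using g by (simp add: A_def)
  note g0 = sublinear_on_0[OF gs cvec.subspace_0[OF U]]
  have "g (- x) = - g x" if x: "x \<in> U" for x
  proof -
    \<comment> \<open>On the ray through \<open>x\<close> the functional \<open>g\<close> is
      additive, so shifting by it yields a member of \<open>A\<close> below \<open>g\<close>. By
      minimality this is \<open>g\<close> itself, and its value at \<open>- x\<close> gives
      \<open>g (- x) \<le> - g x\<close>.\<close>
    define W where "W = (\<lambda>t. complex_of_real t *\<^sub>C x) ` {0..}"
    have gW: "g (complex_of_real t *\<^sub>C x) = t * g x" if "t \<ge> 0" for t
      using sublinear_onD(2)[OF gs x, of t] that g0 by (cases "t = 0") auto
    obtain r where r: "sublinear_on U r" "\<And>y. y \<in> U \<Longrightarrow> r y \<le> g y" "\<And>w. w \<in> W \<Longrightarrow> r (- w) \<le> - g w"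
    proof (rule sublinear_shift[OF U gs, of W g])
      show "W \<subseteq> U" using x mem by (auto simp: W_def)
      show "0 \<in> W" unfolding W_def by (rule image_eqI[of _ _ 0]) auto
      show "y + z \<in> W" if yz: "y \<in> W" "z \<in> W" for y z
      proof -
        obtain s t where "s \<ge> 0" "t \<ge> 0" "y = complex_of_real s *\<^sub>C x" "z = complex_of_real t *\<^sub>C x"
          using yz by (auto simp: W_def)
        then show ?thesis unfolding W_def
          by (intro image_eqI[of _ _ "s + t"]) (auto simp: scaleC_add_left)
      qed
      show "complex_of_real t *\<^sub>C y \<in> W" if yt: "y \<in> W" "t > 0" for y t
      proof -
        obtain s where "s \<ge> 0" "y = complex_of_real s *\<^sub>C x" using yt by (auto simp: W_def)
        then show ?thesis unfolding W_def using yt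
          by (intro image_eqI[of _ _ "t * s"]) auto
      qed
      show "g (y + z) = g y + g z" if yz: "y \<in> W" "z \<in> W" for y z
      proof -
        obtain s t where "s \<ge> 0" "t \<ge> 0" "y = complex_of_real s *\<^sub>C x" "z = complex_of_real t *\<^sub>C x"
          using yz by (auto simp: W_def)
        then show ?thesis using gW[of "s + t"] gW[of s] gW[of t]
          by (auto simp: scaleC_add_left algebra_simps)
      qed
      show "g (complex_of_real t *\<^sub>C y) = t * g y" if "y \<in> W" "t > 0" for y t
        using sublinear_onD(2)[OF gs, of y t] that \<open>W \<subseteq> U\<close> by auto
    qed auto
    have "(\<lambda>y. if y \<in> U then r y else 0) = g"
    proof (rule min)
      show "(\<lambda>y. if y \<in> U then r y else 0) \<in> A"
        using r(1,2) g by (intro restr) (auto simp: A_def intro: order_trans)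
      show "(if y \<in> U then r y else 0) \<le> g y" for y using r(2) g by (auto simp: A_def)
    qed
    then have "r (- x) = g (- x)" using mem[OF x x] by (metis (mono_tags, lifting))
    moreover have "x \<in> W" unfolding W_def by (rule image_eqI[of _ _ 1]) auto
    ultimately have "g (- x) \<le> - g x" using r(3)[of x] by simp
    moreover have "0 \<le> g x + g (- x)"
      using sublinear_onD(1)[OF gs, of x "- x"] mem[OF x x] x g0 by auto
    ultimately show ?thesis by linarith
  qed
  then show thesis using that[OF gs] g by (auto simp: A_def)
qed

text \<open>The real part of \<open>f\<close> is extended first. Once
  \<open>p (- w) \<le> - Re (f w)\<close> holds on \<open>W\<close>, every linear minorant of
  \<open>p\<close> equals \<open>Re f\<close> there, so a single Zorn argument gives both linearity
  and extension.\<close>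

theorem hahn_banach:
  fixes U W :: "'v::complex_vector set"
  assumes U: "cvec.subspace U" and W: "cvec.subspace W" "W \<subseteq> U"
    and q: "\<And>x y. x \<in> U \<Longrightarrow> y \<in> U \<Longrightarrow> q (x + y) \<le> q x + q y"
      "\<And>c x. x \<in> U \<Longrightarrow> q (c *\<^sub>C x) = cmod c * q x"
    and f: "\<And>x y. x \<in> W \<Longrightarrow> y \<in> W \<Longrightarrow> f (x + y) = f x + f y"
      "\<And>c x. x \<in> W \<Longrightarrow> f (c *\<^sub>C x) = c * f x"
      "\<And>x. x \<in> W \<Longrightarrow> cmod (f x) \<le> q x"
  obtains F where "\<And>x y. x \<in> U \<Longrightarrow> y \<in> U \<Longrightarrow> F (x + y) = F x + F y"
    "\<And>c x. x \<in> U \<Longrightarrow> F (c *\<^sub>C x) = c * F x"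
    "\<And>x. x \<in> U \<Longrightarrow> cmod (F x) \<le> q x" "\<And>x. x \<in> W \<Longrightarrow> F x = f x"
proof -
  have mem: "x + y \<in> U" "- x \<in> U" "c *\<^sub>C x \<in> U" if "x \<in> U" "y \<in> U" for x y c
    using U that by (auto intro: cvec.subspace_add cvec.subspace_neg cvec.subspace_scale)
  have qs: "sublinear_on U q" unfolding sublinear_on_def using q by auto
  obtain p where p: "sublinear_on U p" "\<And>x. x \<in> U \<Longrightarrow> p x \<le> q x" "\<And>w. w \<in> W \<Longrightarrow> p (- w) \<le> - Re (f w)"
  proof (rule sublinear_shift[OF U qs W(2), of "\<lambda>x. Re (f x)"])
    show "Re (f x) \<le> q x" if "x \<in> W" for x
      using f(3)[OF that] complex_Re_le_cmod[of "f x"] by linarith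
  qed (use W f in \<open>auto intro: cvec.subspace_0 cvec.subspace_add cvec.subspace_scale\<close>)
  obtain g where g: "sublinear_on U g" "\<And>x. x \<in> U \<Longrightarrow> g x \<le> p x" "\<And>x. x \<in> U \<Longrightarrow> g (- x) = - g x"
    using sublinear_minorant[OF U p(1)] by blast
  have g_add: "g (x + y) = g x + g y" if xy: "x \<in> U" "y \<in> U" for x y
  proof -
    have "g (- x + - y) \<le> g (- x) + g (- y)"
      using xy mem by (intro sublinear_onD(1)[OF g(1)]) auto
    then have "- g (x + y) \<le> - g x + - g y"
      using g(3)[of "x + y"] g(3) xy mem by (simp add: add.commute)
    then show ?thesis using sublinear_onD(1)[OF g(1) xy] by linarith
  qed
  have g_scale: "g (complex_of_real t *\<^sub>C x) = t * g x" if x: "x \<in> U" for x t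
  proof -
    consider "t > 0" | "t = 0" | "t < 0" by linarith
    then show ?thesis
    proof cases
      case 3
      have "g (complex_of_real (- t) *\<^sub>C (- x)) = - t * g (- x)"
        using 3 x mem by (intro sublinear_onD(2)[OF g(1)]) auto
      then show ?thesis using g(3) x by simp
    qed (use sublinear_onD(2)[OF g(1) x] sublinear_on_0[OF g(1) cvec.subspace_0[OF U]] in auto)
  qed
  have gW: "g w = Re (f w)" if w: "w \<in> W" for w
  proof -
    have *: "Re (f w) \<le> g w" if w: "w \<in> W" for w
      using g(2)[of "- w"] g(3)[of w] p(3)[OF w] mem[of w w] w W(2) by auto
    have "- w \<in> W" using w W by (auto intro: cvec.subspace_neg)
    from *[OF this] *[OF w] show ?thesis
      using g(3)[of w] w W f(2)[OF w, of "-1"] by (auto simp: scaleC_minus_one)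
  qed
  \<comment> \<open>A complex linear functional is recovered from its real part \<open>g\<close> as
    \<open>g x - \<i> * g (\<i> x)\<close>.\<close>
  define F where "F x = Complex (g x) (- g (\<i> *\<^sub>C x))" for x
  have F_add: "F (x + y) = F x + F y" if "x \<in> U" "y \<in> U" for x y
    using that g_add mem by (simp add: F_def scaleC_add_right complex_eq_iff)
  have F_scale: "F (c *\<^sub>C x) = c * F x" if x: "x \<in> U" for c x
  proof -
    have "c *\<^sub>C x = complex_of_real (Re c) *\<^sub>C x + complex_of_real (Im c) *\<^sub>C \<i> *\<^sub>C x"
      by (subst complex_eq[of c], subst scaleC_add_left) (simp add: scaleC_scaleC mult.commute)
    then have 1: "g (c *\<^sub>C x) = Re c * g x + Im c * g (\<i> *\<^sub>C x)"
      using x mem g_add g_scale by (metis (no_types, lifting))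
    have "\<i> *\<^sub>C c *\<^sub>C x = complex_of_real (Re c) *\<^sub>C \<i> *\<^sub>C x + complex_of_real (- Im c) *\<^sub>C x"
      unfolding scaleC_scaleC scaleC_add_left[symmetric] by (auto simp: complex_eq_iff)
    then have 2: "g (\<i> *\<^sub>C c *\<^sub>C x) = Re c * g (\<i> *\<^sub>C x) + - Im c * g x"
      using x mem g_add g_scale by (metis (no_types, lifting))
    show ?thesis unfolding F_def 1 2 by (simp add: complex_eq_iff)
  qed
  show thesis
  proof (rule that[of F])
    show "cmod (F x) \<le> q x" if x: "x \<in> U" for x
    proof -
      obtain c where c: "cmod c = 1" "c * F x = complex_of_real (cmod (F x))"
        by (rule unimodular_rotation)
      have "cmod (F x) = Re (F (c *\<^sub>C x))" using F_scale[OF x, of c] c by simp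
      also have "\<dots> = g (c *\<^sub>C x)" by (simp add: F_def)
      also have "\<dots> \<le> q (c *\<^sub>C x)" using g(2)[of "c *\<^sub>C x"] p(2)[of "c *\<^sub>C x"] mem x by auto
      also have "\<dots> = q x" using q(2)[OF x] c by simp
      finally show ?thesis .
    qed
    show "F w = f w" if w: "w \<in> W" for w
    proof -
      have "\<i> *\<^sub>C w \<in> W" using W w by (auto intro: cvec.subspace_scale)
      then have "g (\<i> *\<^sub>C w) = - Im (f w)" using gW f(2)[OF w] by simp
      then show ?thesis using gW[OF w] by (simp add: F_def complex_eq_iff)
    qed
  qed (use F_add F_scale in auto)
qed

corollary seminorm_functional:
  fixes U :: "'v::complex_vector set"
  assumes U: "cvec.subspace U" and x: "x \<in> U"
    and q: "\<And>x y. x \<in> U \<Longrightarrow> y \<in> U \<Longrightarrow> q (x + y) \<le> q x + q y"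
      "\<And>c x. x \<in> U \<Longrightarrow> q (c *\<^sub>C x) = cmod c * q x" "\<And>x. x \<in> U \<Longrightarrow> 0 \<le> q x"
  obtains F where "\<And>x y. x \<in> U \<Longrightarrow> y \<in> U \<Longrightarrow> F (x + y) = F x + F y"
    "\<And>c x. x \<in> U \<Longrightarrow> F (c *\<^sub>C x) = c * F x"
    "\<And>x. x \<in> U \<Longrightarrow> cmod (F x) \<le> q x" "F x = complex_of_real (q x)"
    "\<And>x. x \<notin> U \<Longrightarrow> F x = 0"
proof (cases "x = 0")
  case True
  have "q x = 0" using q(2)[OF x, of 0] True by simp
  then show ?thesis using that[of "\<lambda>_. 0"] q(3) by auto
next
  case False
  define W where "W = range (\<lambda>c. c *\<^sub>C x)"
  \<comment> \<open>\<open>SOME\<close> picks the coordinate of \<open>w\<close> on the line through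
    \<open>x\<close>, unique because \<open>x \<noteq> 0\<close>.\<close>
  define f where "f w = (SOME c. w = c *\<^sub>C x) * complex_of_real (q x)" for w
  have f: "f (c *\<^sub>C x) = c * complex_of_real (q x)" for c
  proof -
    have "(SOME d. c *\<^sub>C x = d *\<^sub>C x) = c" by (rule some_equality) (use False in auto)
    then show ?thesis by (simp add: f_def)
  qed
  have W: "cvec.subspace W"
  proof (rule cvec.subspaceI)
    show "0 \<in> W" unfolding W_def by (rule range_eqI[of _ _ 0]) simp
    show "y + z \<in> W" if "y \<in> W" "z \<in> W" for y z
      using that unfolding W_def by (auto simp flip: scaleC_add_left)
    show "c *\<^sub>C y \<in> W" if "y \<in> W" for c y
      using that unfolding W_def by (auto simp: scaleC_scaleC)
  qed
  have WU: "W \<subseteq> U" using U x by (auto simp: W_def intro: cvec.subspace_scale)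
  obtain F where F: "\<And>x y. x \<in> U \<Longrightarrow> y \<in> U \<Longrightarrow> F (x + y) = F x + F y"
    "\<And>c x. x \<in> U \<Longrightarrow> F (c *\<^sub>C x) = c * F x"
    "\<And>x. x \<in> U \<Longrightarrow> cmod (F x) \<le> q x" "\<And>x. x \<in> W \<Longrightarrow> F x = f x"
  proof (rule hahn_banach[OF U W WU, of q f])
    show "f (y + z) = f y + f z" if "y \<in> W" "z \<in> W" for y z
      using that by (auto simp: W_def f distrib_right simp flip: scaleC_add_left)
    show "f (c *\<^sub>C y) = c * f y" if "y \<in> W" for c y
      using that by (auto simp: W_def f scaleC_scaleC)
    show "cmod (f y) \<le> q y" if "y \<in> W" for y
      using that q(2)[OF x] q(3)[OF x] by (auto simp: W_def f norm_mult)
  qed (use q in auto)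
  show ?thesis
  proof (rule that[of "\<lambda>y. if y \<in> U then F y else 0"])
    have "x \<in> W" unfolding W_def by (rule range_eqI[of _ _ 1]) simp
    then show "(if x \<in> U then F x else 0) = complex_of_real (q x)"
      using x F(4)[of x] f[of 1] by simp
  qed (use F U in \<open>auto intro: cvec.subspace_add cvec.subspace_scale\<close>)
qed

section \<open>Dual norms as suprema over subsets of the predual\<close>

lemma (in cnormed) norming_functional:
  assumes "x \<in> V"
  obtains f where "f \<in> cdual V N" "dual_norm V N f \<le> 1" "f x = complex_of_real (N x)"
proof -
  obtain f where f: "\<And>x y. x \<in> V \<Longrightarrow> y \<in> V \<Longrightarrow> f (x + y) = f x + f y"
    "\<And>c x. x \<in> V \<Longrightarrow> f (c *\<^sub>C x) = c * f x" "\<And>x. x \<in> V \<Longrightarrow> cmod (f x) \<le> N x"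
    "f x = complex_of_real (N x)" "\<And>x. x \<notin> V \<Longrightarrow> f x = 0"
    by (rule seminorm_functional[OF sub assms, of N]) (use N_triangle in auto)
  show thesis
  proof (rule that)
    show "f \<in> cdual V N" using f by (intro dualI[where C=1]) auto
    show "dual_norm V N f \<le> 1" using f by (intro dual_norm_le) auto
  qed (rule f)
qed

text \<open>Weak* lower semicontinuity in concrete form: \<open>D\<close> is a supremum of moduli of
  evaluations on a bounded set. The two clauses spell out the least upper bound, so that no side
  condition of \<open>Sup\<close> has to be carried.\<close>

definition dual_type :: "'v::complex_vector set \<Rightarrow> ('v \<Rightarrow> real) \<Rightarrow> (('v \<Rightarrow> complex) \<Rightarrow> real) \<Rightarrow> bool" where
  "dual_type V N D \<longleftrightarrow> (\<exists>B\<subseteq>V. \<exists>K. (\<forall>b\<in>B. N b \<le> K) \<and>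
     (\<forall>f\<in>cdual V N. (\<forall>b\<in>B. cmod (f b) \<le> D f) \<and> (\<forall>r<D f. \<exists>b\<in>B. r < cmod (f b))))"

text \<open>The predual norm is the polar of the unit ball of \<open>D\<close>; the Hahn-Banach theorem enters only
  to bound it below.\<close>

theorem (in cnormed) dual_type_equivalent:
  assumes D: "dual_type V N D" and c: "c > 0" "\<And>f. f \<in> cdual V N \<Longrightarrow> c * dual_norm V N f \<le> D f"
  shows "equivalent_dual_norm_on V N D"
proof -
  interpret dual: cnormed "cdual V N" "dual_norm V N" by (rule cnormed_dual)
  obtain B K0 where B: "B \<subseteq> V" "\<And>b. b \<in> B \<Longrightarrow> N b \<le> K0"
    "\<And>f b. f \<in> cdual V N \<Longrightarrow> b \<in> B \<Longrightarrow> cmod (f b) \<le> D f"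
    "\<And>f r. f \<in> cdual V N \<Longrightarrow> r < D f \<Longrightarrow> \<exists>b\<in>B. r < cmod (f b)"
    using D unfolding dual_type_def by metis
  \<comment> \<open>\<open>K0\<close> may be 0, for example if \<open>B\<close> contains only 0; the
    maximum allows division by \<open>K\<close>.\<close>
  define K where "K = max 1 K0"
  have K: "K \<ge> 1" "\<And>b. b \<in> B \<Longrightarrow> N b \<le> K" using B(2) by (auto simp: K_def le_max_iff_disj)
  have D_le: "D f \<le> a" if f: "f \<in> cdual V N" and a: "\<And>b. b \<in> B \<Longrightarrow> cmod (f b) \<le> a" for f a
    using B(4)[OF f, of a] a by (meson not_le)
  have D_upper: "D f \<le> K * dual_norm V N f" if f: "f \<in> cdual V N" for f
  proof (rule D_le[OF f])
    fix b assume b: "b \<in> B"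
    have "cmod (f b) \<le> dual_norm V N f * N b" using dual_norm_bound[OF f] b B(1) by auto
    also have "\<dots> \<le> dual_norm V N f * K" using K(2)[OF b] f by (intro mult_left_mono) auto
    finally show "cmod (f b) \<le> K * dual_norm V N f" by (simp add: mult.commute)
  qed
  have D_nonneg: "0 \<le> D f" if f: "f \<in> cdual V N" for f
    using c(1) c(2)[OF f] dual_norm_nonneg[OF f] by (smt (verit) mult_nonneg_nonneg)
  have D_scale: "D (a *\<^sub>C f) \<le> cmod a * D f" if f: "f \<in> cdual V N" for a f
    using B(3)[OF f] f by (intro D_le) (auto simp: norm_mult mult_left_mono)
  define M where "M v = Sup {cmod (f v) | f. f \<in> cdual V N \<and> D f \<le> 1}" for v
  have D0: "D 0 \<le> 1" using D_upper[of 0] by simp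
  have ne: "{cmod (f v) | f. f \<in> cdual V N \<and> D f \<le> 1} \<noteq> {}" for v using D0 dual.mem(1) by auto
  have bound: "cmod (f v) \<le> N v / c" if "v \<in> V" "f \<in> cdual V N" "D f \<le> 1" for v f
  proof -
    have "c * dual_norm V N f \<le> 1" using c(2)[OF that(2)] that(3) by linarith
    then have "dual_norm V N f \<le> 1 / c" using c(1) by (simp add: field_simps)
    then have "dual_norm V N f * N v \<le> 1 / c * N v" using that by (intro mult_right_mono) auto
    then show ?thesis using dual_norm_bound[OF that(2,1)] by simp
  qed
  have bdd: "bdd_above {cmod (f v) | f. f \<in> cdual V N \<and> D f \<le> 1}" if "v \<in> V" for v
    using bound[OF that] by (intro bdd_aboveI[of _ "N v / c"]) auto
  have M_upper: "cmod (f v) \<le> M v" if "v \<in> V" "f \<in> cdual V N" "D f \<le> 1" for v f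
    unfolding M_def by (rule cSup_upper[OF _ bdd]) (use that in auto)
  have M_least: "M v \<le> a" if "\<And>f. f \<in> cdual V N \<Longrightarrow> D f \<le> 1 \<Longrightarrow> cmod (f v) \<le> a" for v a
    unfolding M_def by (rule cSup_least[OF ne]) (use that in auto)
  have M_N: "M v \<le> N v / c" if "v \<in> V" for v using bound[OF that] by (rule M_least)
  have N_M: "N v / K \<le> M v" if v: "v \<in> V" for v
  proof -
    obtain f where f: "f \<in> cdual V N" "dual_norm V N f \<le> 1" "f v = complex_of_real (N v)"
      using norming_functional[OF v] by blast
    \<comment> \<open>Scaling by \<open>1 / K\<close> moves the norming functional into the unit
      ball of \<open>D\<close>.\<close>
    define a where "a = complex_of_real (1 / K)"
    have "K * dual_norm V N (a *\<^sub>C f) \<le> 1"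
      using f K(1) by (simp add: a_def norm_divide)
    then have "D (a *\<^sub>C f) \<le> 1" using D_upper[of "a *\<^sub>C f"] f by simp
    from M_upper[OF v _ this] show ?thesis
      using f v K(1) by (simp add: a_def norm_mult norm_divide)
  qed
  have M_nonneg: "0 \<le> M v" if "v \<in> V" for v
    using N_M[OF that] that K(1) by (smt (verit) N_nonneg divide_nonneg_pos)
  have M_scale: "M (a *\<^sub>C v) = cmod a * M v" if v: "v \<in> V" for a v
  proof (rule homogeneous_if_le[where q=M, OF sub v M_nonneg[OF mem(1)]])
    show "M (a *\<^sub>C v) \<le> cmod a * M v" if v: "v \<in> V" for a v
      using M_upper[OF v] v by (intro M_least) (auto simp: dual_scale norm_mult intro!: mult_left_mono)
  qed
  have eq: "equivalent_norm_on V N M"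
    unfolding equivalent_norm_on_def cnorm_on_def
  proof (intro conjI ballI allI)
    fix x assume x: "x \<in> V"
    show "0 \<le> M x" by (rule M_nonneg[OF x])
    show "(M x = 0) = (x = 0)"
    proof
      assume "M x = 0"
      then have "N x \<le> 0" using N_M[OF x] K(1) by (simp add: field_simps)
      then show "x = 0" using N_eq_0[OF x] N_nonneg[OF x] by linarith
    next
      assume "x = 0"
      then show "M x = 0" using M_N[of 0] M_nonneg[of 0] by simp
    qed
    show "M (a *\<^sub>C x) = cmod a * M x" for a by (rule M_scale[OF x])
    show "M (x + y) \<le> M x + M y" if y: "y \<in> V" for y
    proof (rule M_least)
      fix f assume f: "f \<in> cdual V N" "D f \<le> 1"
      show "cmod (f (x + y)) \<le> M x + M y"
        using M_upper[OF x f] M_upper[OF y f] norm_triangle_ineq[of "f x" "f y"]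
        by (simp add: dual_add[OF f(1) x y])
    qed
  next
    have "\<forall>x\<in>V. (1 / K) * N x \<le> M x \<and> M x \<le> (1 / c) * N x" using N_M M_N by simp
    then show "\<exists>c>0. \<exists>C>0. \<forall>x\<in>V. c * N x \<le> M x \<and> M x \<le> C * N x"
      using K(1) c(1) by (intro exI[of _ "1 / K"] exI[of _ "1 / c"] conjI) auto
  qed
  interpret M: cnormed V M by (rule cnormed.intro[OF sub]) (use eq in \<open>simp add: equivalent_norm_on_def\<close>)
  have dual_eq: "cdual V M = cdual V N" by (rule cdual_equivalent[OF nrm eq])
  have "D f = dual_norm V M f" if f: "f \<in> cdual V N" for f
  proof (rule antisym)
    \<comment> \<open>\<open>B\<close> lies in the unit ball of \<open>M\<close>, so
      \<open>D\<close> is at most the dual norm; the other inequality is homogeneity of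
      \<open>D\<close>.\<close>
    show "D f \<le> dual_norm V M f"
    proof (rule D_le[OF f])
      fix b assume b: "b \<in> B"
      have "M b \<le> 1" by (rule M_least) (use B(3) b in \<open>auto intro: order_trans\<close>)
      then show "cmod (f b) \<le> dual_norm V M f"
        using b B(1) f by (intro M.dual_unit_le) (auto simp: dual_eq)
    qed
    show "dual_norm V M f \<le> D f"
    proof (rule M.dual_norm_le[OF D_nonneg[OF f]])
      fix v assume v: "v \<in> V"
      show "cmod (f v) \<le> D f * M v"
      proof (cases "D f = 0")
        case True
        then have "dual_norm V N f \<le> 0" using c(1) c(2)[OF f] by (simp add: mult_le_0_iff)
        then have "f = 0" using dual.N_eq_0[OF f] dual_norm_nonneg[OF f] by linarith
        then show ?thesis using D_nonneg[OF f] M_nonneg[OF v] by simp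
      next
        case False
        define a where "a = complex_of_real (1 / D f)"
        have "D (a *\<^sub>C f) \<le> 1" using D_scale[OF f, of a] False D_nonneg[OF f] by (simp add: a_def norm_divide)
        from M_upper[OF v _ this] show ?thesis
          using f False D_nonneg[OF f] by (simp add: a_def norm_mult norm_divide field_simps)
      qed
    qed
  qed
  then show ?thesis using eq unfolding equivalent_dual_norm_on_def by blast
qed

section \<open>Suprema over test sets and their weighted l2 sums\<close>

definition sup_on :: "'v set \<Rightarrow> ('v \<Rightarrow> complex) \<Rightarrow> real" where
  "sup_on A f = Sup ((\<lambda>a. cmod (f a)) ` A)"

text \<open>The weights sum to 2, so the square is at most
  \<open>2 * (dual_norm V N f)\<^sup>2\<close> on test sets; each weight is positive, so a small
  total controls every summand.\<close>

definition l2_sup :: "(nat \<Rightarrow> 'v set) \<Rightarrow> ('v \<Rightarrow> complex) \<Rightarrow> real" where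
  "l2_sup A f = sqrt (\<Sum>i. (1/2)^i * (sup_on (A i) f)\<^sup>2)"

context cnormed
begin

text \<open>The point 0 makes suprema over the set nonnegative, and \<open>N a \<le> 1\<close>
  bounds them by the dual norm uniformly in the set, so that l2 sums converge.\<close>

definition test_set :: "'v set \<Rightarrow> bool" where
  "test_set A \<longleftrightarrow> A \<subseteq> V \<and> 0 \<in> A \<and> (\<forall>a\<in>A. N a \<le> 1)"

lemma test_setD:
  assumes "test_set A"
  shows "A \<subseteq> V" "0 \<in> A" "\<And>a. a \<in> A \<Longrightarrow> N a \<le> 1"
  using assms by (auto simp: test_set_def)

context
  fixes A assumes test: "test_set A"
begin

lemmas A = test_setD[OF test]

lemma sup_on_bdd: "f \<in> cdual V N \<Longrightarrow> bdd_above ((\<lambda>a. cmod (f a)) ` A)"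
  using dual_unit_le A by (intro bdd_aboveI2[of _ _ "dual_norm V N f"]) auto

lemma sup_on_upper: "f \<in> cdual V N \<Longrightarrow> a \<in> A \<Longrightarrow> cmod (f a) \<le> sup_on A f"
  unfolding sup_on_def by (rule cSup_upper[OF _ sup_on_bdd]) auto

lemma sup_on_least: "(\<And>a. a \<in> A \<Longrightarrow> cmod (f a) \<le> b) \<Longrightarrow> sup_on A f \<le> b"
  unfolding sup_on_def by (rule cSup_least) (use A in auto)

lemma sup_on_witness: "r < sup_on A f \<Longrightarrow> \<exists>a\<in>A. r < cmod (f a)"
  using sup_on_least[of f r] not_le by blast

lemma sup_on_nonneg: "f \<in> cdual V N \<Longrightarrow> 0 \<le> sup_on A f"
  by (rule order_trans[OF norm_ge_zero sup_on_upper[OF _ A(2)]])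

lemma sup_on_le: "f \<in> cdual V N \<Longrightarrow> sup_on A f \<le> dual_norm V N f"
  using dual_unit_le A by (intro sup_on_least) auto

lemma sup_on_add: "f \<in> cdual V N \<Longrightarrow> g \<in> cdual V N \<Longrightarrow> sup_on A (f + g) \<le> sup_on A f + sup_on A g"
proof (rule sup_on_least)
  fix a assume fg: "f \<in> cdual V N" "g \<in> cdual V N" and a: "a \<in> A"
  show "cmod ((f + g) a) \<le> sup_on A f + sup_on A g"
    using sup_on_upper[OF fg(1) a] sup_on_upper[OF fg(2) a] norm_triangle_ineq[of "f a" "g a"] by simp
qed

end

end

text \<open>The right side is \<open>(a - b)\<^sup>2 + ((a + b)\<^sup>2 - c\<^sup>2)\<close>. With
  \<open>c\<close> the norm of a sum it is the squared form of the LUR condition, which is additive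
  and hence suited to l2 sums.\<close>

lemma convexity_defect:
  fixes a b c :: real
  assumes "0 \<le> a" "0 \<le> b" "0 \<le> c" "c \<le> a + b"
  shows "(a - b)\<^sup>2 \<le> 2 * a\<^sup>2 + 2 * b\<^sup>2 - c\<^sup>2"
proof -
  have "c\<^sup>2 \<le> (a + b)\<^sup>2" using assms by (intro power_mono) auto
  then show ?thesis by (simp add: power2_eq_square algebra_simps)
qed

text \<open>Here \<open>b k\<close> plays the norm of the sum and \<open>c\<close> the norm of the
  limit: one vanishing squared defect returns both limits of the LUR hypothesis.\<close>

lemma convexity_defect_tendsto:
  fixes a b :: "nat \<Rightarrow> real"
  assumes "\<And>k. 0 \<le> a k" "\<And>k. 0 \<le> b k" "0 \<le> c" "\<And>k. b k \<le> a k + c"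
    and lim: "(\<lambda>k. 2 * (a k)\<^sup>2 + 2 * c\<^sup>2 - (b k)\<^sup>2) \<longlonglongrightarrow> 0"
  shows "a \<longlonglongrightarrow> c" "b \<longlonglongrightarrow> 2 * c"
proof -
  have "(\<lambda>k. (a k - c)\<^sup>2) \<longlonglongrightarrow> 0"
    by (rule tendsto_sandwich[OF _ _ tendsto_const lim])
      (use assms convexity_defect in \<open>auto intro!: always_eventually\<close>)
  then have "(\<lambda>k. sqrt ((a k - c)\<^sup>2)) \<longlonglongrightarrow> sqrt 0" by (rule tendsto_real_sqrt)
  then have "(\<lambda>k. a k - c) \<longlonglongrightarrow> 0" by (simp add: tendsto_rabs_zero_iff)
  then show a: "a \<longlonglongrightarrow> c" by (simp add: LIM_zero_iff)
  have "(\<lambda>k. 2 * (a k)\<^sup>2 + 2 * c\<^sup>2 - (2 * (a k)\<^sup>2 + 2 * c\<^sup>2 - (b k)\<^sup>2)) \<longlonglongrightarrow> 2 * c\<^sup>2 + 2 * c\<^sup>2 - 0"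
    by (intro tendsto_intros a lim)
  then have "(\<lambda>k. (b k)\<^sup>2) \<longlonglongrightarrow> (2 * c)\<^sup>2" by (simp add: power2_eq_square)
  then have "(\<lambda>k. sqrt ((b k)\<^sup>2)) \<longlonglongrightarrow> sqrt ((2 * c)\<^sup>2)" by (rule tendsto_real_sqrt)
  moreover have "sqrt ((2 * c)\<^sup>2) = 2 * c" using assms(3) by (intro real_sqrt_unique) auto
  ultimately show "b \<longlonglongrightarrow> 2 * c" using assms(2) by simp
qed

lemma defect_tendsto_0:
  fixes a b :: "nat \<Rightarrow> real"
  assumes "a \<longlonglongrightarrow> c" "b \<longlonglongrightarrow> 2 * c"
  shows "(\<lambda>k. 2 * (a k)\<^sup>2 + 2 * c\<^sup>2 - (b k)\<^sup>2) \<longlonglongrightarrow> 0"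
proof -
  have "(\<lambda>k. 2 * (a k)\<^sup>2 + 2 * c\<^sup>2 - (b k)\<^sup>2) \<longlonglongrightarrow> 2 * c\<^sup>2 + 2 * c\<^sup>2 - (2 * c)\<^sup>2"
    by (intro tendsto_intros assms)
  then show ?thesis by (simp add: power2_eq_square)
qed

context cnormed
begin

context
  fixes A :: "nat \<Rightarrow> 'v set"
  assumes A: "\<And>i. test_set (A i)"
begin

lemma l2_sup_summable: "f \<in> cdual V N \<Longrightarrow> summable (\<lambda>i. (1/2)^i * (sup_on (A i) f)\<^sup>2)"
proof (rule summable_comparison_test')
  assume f: "f \<in> cdual V N"
  show "summable (\<lambda>i. (1/2)^i * (dual_norm V N f)\<^sup>2)"
    by (intro summable_mult2 summable_geometric) auto
  show "norm ((1/2)^i * (sup_on (A i) f)\<^sup>2) \<le> (1/2)^i * (dual_norm V N f)\<^sup>2" if "i \<ge> 0" for i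
    using sup_on_le[OF A f] sup_on_nonneg[OF A f] by (auto intro!: power_mono)
qed

lemma l2_sup_sq: "f \<in> cdual V N \<Longrightarrow> (l2_sup A f)\<^sup>2 = (\<Sum>i. (1/2)^i * (sup_on (A i) f)\<^sup>2)"
  unfolding l2_sup_def using l2_sup_summable by (intro real_sqrt_pow2 suminf_nonneg) auto

lemma l2_sup_nonneg: "f \<in> cdual V N \<Longrightarrow> 0 \<le> l2_sup A f"
  unfolding l2_sup_def using l2_sup_summable by (intro real_sqrt_ge_zero suminf_nonneg) auto

lemma l2_sup_partial: "f \<in> cdual V N \<Longrightarrow> (\<Sum>i\<in>I. (1/2)^i * (sup_on (A i) f)\<^sup>2) \<le> (l2_sup A f)\<^sup>2" if "finite I"
  unfolding l2_sup_sq using that by (intro sum_le_suminf l2_sup_summable) auto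

lemma sup_on_le_l2_sup: assumes f: "f \<in> cdual V N" shows "sup_on (A 0) f \<le> l2_sup A f"
proof (rule power2_le_imp_le[OF _ l2_sup_nonneg[OF f]])
  show "(sup_on (A 0) f)\<^sup>2 \<le> (l2_sup A f)\<^sup>2" using l2_sup_partial[OF _ f, of "{0}"] by simp
qed

lemma l2_sup_le: assumes f: "f \<in> cdual V N" shows "l2_sup A f \<le> 2 * dual_norm V N f"
proof -
  have s: "(\<lambda>i. (1/2)^i * (dual_norm V N f)\<^sup>2) sums (2 * (dual_norm V N f)\<^sup>2)"
    using sums_mult2[OF geometric_sums[of "1/2::real"], of "(dual_norm V N f)\<^sup>2"] by simp
  have "(l2_sup A f)\<^sup>2 \<le> (\<Sum>i. (1/2)^i * (dual_norm V N f)\<^sup>2)"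
    unfolding l2_sup_sq[OF f]
  proof (rule suminf_le)
    show "(1/2)^i * (sup_on (A i) f)\<^sup>2 \<le> (1/2)^i * (dual_norm V N f)\<^sup>2" for i
      using sup_on_le[OF A f] sup_on_nonneg[OF A f] by (auto intro!: power_mono)
  qed (use l2_sup_summable f s sums_summable in auto)
  also have "\<dots> = 2 * (dual_norm V N f)\<^sup>2" using s by (rule sums_unique[symmetric])
  also have "\<dots> \<le> (2 * dual_norm V N f)\<^sup>2" by (simp add: power2_eq_square)
  finally show ?thesis by (rule power2_le_imp_le) (use f in auto)
qed

lemma l2_sup_tendsto_0:
  assumes s: "\<And>k. s k \<in> cdual V N" and lim: "(\<lambda>k. dual_norm V N (s k)) \<longlonglongrightarrow> 0"
  shows "(\<lambda>k. l2_sup A (s k)) \<longlonglongrightarrow> 0"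
proof (rule tendsto_sandwich[OF _ _ tendsto_const])
  show "(\<lambda>k. 2 * dual_norm V N (s k)) \<longlonglongrightarrow> 0" using tendsto_mult_right_zero[OF lim] by simp
qed (use l2_sup_nonneg l2_sup_le s in auto)

text \<open>Squared defects add up with the weights and each of them is nonnegative. So each is
  dominated by the total defect, which tends to 0.\<close>

theorem l2_sup_LUR_transfer:
  assumes f: "f \<in> cdual V N" and s: "\<And>k. s k \<in> cdual V N"
    and lim: "(\<lambda>k. l2_sup A (s k)) \<longlonglongrightarrow> l2_sup A f" "(\<lambda>k. l2_sup A (s k + f)) \<longlonglongrightarrow> 2 * l2_sup A f"
  shows "(\<lambda>k. sup_on (A i) (s k)) \<longlonglongrightarrow> sup_on (A i) f"
    and "(\<lambda>k. sup_on (A i) (s k + f)) \<longlonglongrightarrow> 2 * sup_on (A i) f"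
proof -
  interpret dual: cnormed "cdual V N" "dual_norm V N" by (rule cnormed_dual)
  define E where "E i k = 2 * (sup_on (A i) (s k))\<^sup>2 + 2 * (sup_on (A i) f)\<^sup>2 - (sup_on (A i) (s k + f))\<^sup>2" for i k
  have sf: "s k + f \<in> cdual V N" for k using s f by auto
  have E_nonneg: "0 \<le> E i k" for i k
    using convexity_defect[OF sup_on_nonneg[OF A s] sup_on_nonneg[OF A f] sup_on_nonneg[OF A sf] sup_on_add[OF A s f]]
    unfolding E_def by (rule order_trans[OF zero_le_power2])
  have sums: "(\<lambda>i. (1/2)^i * E i k) sums
      (2 * (l2_sup A (s k))\<^sup>2 + 2 * (l2_sup A f)\<^sup>2 - (l2_sup A (s k + f))\<^sup>2)" for k
  proof -
    have *: "(\<lambda>i. (1/2)^i * (sup_on (A i) g)\<^sup>2) sums (l2_sup A g)\<^sup>2" if "g \<in> cdual V N" for g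
      using l2_sup_summable[OF that] l2_sup_sq[OF that] by (simp add: summable_sums)
    show ?thesis
      using sums_diff[OF sums_add[OF sums_mult[OF *[OF s[of k]], of 2] sums_mult[OF *[OF f], of 2]] *[OF sf[of k]]]
      by (simp add: E_def algebra_simps)
  qed
  have le: "(1/2)^i * E i k \<le> 2 * (l2_sup A (s k))\<^sup>2 + 2 * (l2_sup A f)\<^sup>2 - (l2_sup A (s k + f))\<^sup>2" for k
    using sum_le_suminf[OF sums_summable[OF sums[of k]], of "{i}"] sums_unique[OF sums[of k]] E_nonneg by simp
  have "(\<lambda>k. (1/2)^i * E i k) \<longlonglongrightarrow> 0"
    by (rule tendsto_sandwich[OF _ _ tendsto_const defect_tendsto_0[OF lim]])
      (use le E_nonneg in auto)
  from tendsto_mult[OF tendsto_const[of "2^i"] this] have "E i \<longlonglongrightarrow> 0"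
    by (simp add: power_one_over)
  then have lim0: "(\<lambda>k. 2 * (sup_on (A i) (s k))\<^sup>2 + 2 * (sup_on (A i) f)\<^sup>2 - (sup_on (A i) (s k + f))\<^sup>2) \<longlonglongrightarrow> 0"
    by (simp add: E_def[abs_def])
  show "(\<lambda>k. sup_on (A i) (s k)) \<longlonglongrightarrow> sup_on (A i) f"
    by (rule convexity_defect_tendsto(1)[OF _ _ _ _ lim0])
      (use sup_on_nonneg[OF A] sup_on_add[OF A] s sf f in auto)
  show "(\<lambda>k. sup_on (A i) (s k + f)) \<longlonglongrightarrow> 2 * sup_on (A i) f"
    by (rule convexity_defect_tendsto(2)[OF _ _ _ _ lim0])
      (use sup_on_nonneg[OF A] sup_on_add[OF A] s sf f in auto)
qed

text \<open>\<open>B\<close> plays the predual ball of the l2 sum: finite combinations with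
  coefficients in a weighted l2 ball. Cauchy-Schwarz gives the upper bound, its equality case the
  near attainment.\<close>

lemma l2_sup_dual_type: "dual_type V N (l2_sup A)"
proof -
  define B where "B = {(\<Sum>i<k. (complex_of_real ((1/2)^i) * c i) *\<^sub>C a i) | k c a.
    (\<forall>i. a i \<in> A i) \<and> (\<Sum>i<k. (1/2)^i * (cmod (c i))\<^sup>2) \<le> (1::real)}"
  have BV: "B \<subseteq> V"
    using test_setD(1)[OF A] sub by (auto simp: B_def subset_iff intro!: cvec.subspace_sum cvec.subspace_scale)
  have le: "cmod (f b) \<le> l2_sup A f" if f: "f \<in> cdual V N" and b: "b \<in> B" for f b
  proof -
    obtain k c a where *: "\<And>i. a i \<in> A i" "(\<Sum>i<k. (1/2)^i * (cmod (c i))\<^sup>2) \<le> (1::real)"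
      "b = (\<Sum>i<k. (complex_of_real ((1/2)^i) * c i) *\<^sub>C a i)"
      using b unfolding B_def by blast
    have aV: "a i \<in> V" for i using *(1) test_setD(1)[OF A] by blast
    \<comment> \<open>Each weight is split into two square roots, one for each factor in
      Cauchy-Schwarz.\<close>
    define u where "u i = sqrt ((1/2)^i) * cmod (c i)" for i
    define v where "v i = sqrt ((1/2)^i) * sup_on (A i) f" for i
    have "f b = (\<Sum>i<k. complex_of_real ((1/2)^i) * c i * f (a i))"
      unfolding *(3) by (subst dual_sum[OF f]) (use aV f in \<open>auto simp: dual_scale\<close>)
    then have "cmod (f b) \<le> (\<Sum>i<k. cmod (complex_of_real ((1/2)^i) * c i * f (a i)))"
      by (simp add: norm_sum)
    also have "\<dots> \<le> (\<Sum>i<k. u i * v i)"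
    proof (rule sum_mono)
      fix i
      have "cmod (complex_of_real ((1/2)^i) * c i * f (a i)) = (1/2)^i * cmod (c i) * cmod (f (a i))"
        by (simp add: norm_mult norm_power norm_divide)
      also have "\<dots> \<le> (1/2)^i * cmod (c i) * sup_on (A i) f"
        using sup_on_upper[OF A f *(1)] by (intro mult_left_mono) auto
      also have "\<dots> = (sqrt ((1/2)^i))\<^sup>2 * cmod (c i) * sup_on (A i) f"
        by (subst real_sqrt_pow2) auto
      also have "\<dots> = u i * v i" by (simp add: u_def v_def power2_eq_square)
      finally show "cmod (complex_of_real ((1/2)^i) * c i * f (a i)) \<le> u i * v i" .
    qed
    finally have 1: "cmod (f b) \<le> (\<Sum>i<k. u i * v i)" .
    have u2: "(u i)\<^sup>2 = (1/2)^i * (cmod (c i))\<^sup>2" and v2: "(v i)\<^sup>2 = (1/2)^i * (sup_on (A i) f)\<^sup>2" for i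
      unfolding u_def v_def power_mult_distrib by (subst real_sqrt_pow2; simp)+
    have "(\<Sum>i<k. u i * v i)\<^sup>2 \<le> (\<Sum>i<k. (u i)\<^sup>2) * (\<Sum>i<k. (v i)\<^sup>2)"
      by (rule Cauchy_Schwarz_ineq_sum)
    also have "\<dots> \<le> 1 * (l2_sup A f)\<^sup>2"
      unfolding u2 v2 using *(2) l2_sup_partial[OF _ f, of "{..<k}"]
      by (intro mult_mono) (auto intro!: sum_nonneg)
    finally have "(\<Sum>i<k. u i * v i) \<le> l2_sup A f"
      by (intro power2_le_imp_le[OF _ l2_sup_nonneg[OF f]]) simp
    then show ?thesis using 1 by simp
  qed
  have ex: "\<exists>b\<in>B. r < cmod (f b)" if f: "f \<in> cdual V N" and r: "r < l2_sup A f" for f r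
  proof (cases "r < 0")
    case True
    have "0 \<in> B" unfolding B_def
      by (rule CollectI, rule exI[of _ 0], rule exI[of _ "\<lambda>_. 0"], rule exI[of _ "\<lambda>_. 0"]) (use test_setD(2)[OF A] in auto)
    then show ?thesis using True by (intro bexI[of _ 0]) (auto intro: less_le_trans)
  next
    case False
    define T where "T k = (\<Sum>i<k. (1/2)^i * (sup_on (A i) f)\<^sup>2)" for k
    have "r\<^sup>2 < (l2_sup A f)\<^sup>2" using False r by (intro power_strict_mono) auto
    moreover have "T \<longlonglongrightarrow> (l2_sup A f)\<^sup>2"
      unfolding T_def[abs_def] l2_sup_sq[OF f] using l2_sup_summable[OF f] by (rule summable_LIMSEQ)
    ultimately have "\<forall>\<^sub>F k in sequentially. r\<^sup>2 < T k" by (rule order_tendstoD(1)[rotated])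
    then obtain k where k: "r\<^sup>2 < T k" by (auto simp: eventually_sequentially)
    \<comment> \<open>A common factor \<rho> of near attainment is fixed before the points
      \<open>a i\<close> are chosen, close enough to 1 to keep the bound above
      \<open>r\<close>.\<close>
    have "((\<lambda>\<rho>. \<rho>\<^sup>2 * T k) \<longlongrightarrow> 1\<^sup>2 * T k) (at_left (1::real))"
      by (intro tendsto_intros)
    then have "\<forall>\<^sub>F \<rho> in at_left 1. r\<^sup>2 < \<rho>\<^sup>2 * T k" using k by (intro order_tendstoD(1)) auto
    moreover have "\<forall>\<^sub>F \<rho> in at_left (1::real). 0 < \<rho> \<and> \<rho> < 1"
      using eventually_at_left_real[of 0 1] by simp
    ultimately have "\<forall>\<^sub>F \<rho> in at_left (1::real). r\<^sup>2 < \<rho>\<^sup>2 * T k \<and> 0 < \<rho> \<and> \<rho> < 1"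
      by eventually_elim auto
    from eventually_happens'[OF trivial_limit_at_left_real this]
    obtain \<rho> :: real where \<rho>: "r\<^sup>2 < \<rho>\<^sup>2 * T k" "0 < \<rho>" "\<rho> < 1" by (elim exE conjE)
    \<comment> \<open>Where the supremum is 0 no point comes strictly closer; there the point 0
      serves.\<close>
    have "\<exists>a. a \<in> A i \<and> \<rho> * sup_on (A i) f \<le> cmod (f a)" for i
    proof (cases "sup_on (A i) f = 0")
      case True
      then show ?thesis using test_setD(2)[OF A] by (intro exI[of _ 0]) auto
    next
      case False
      then have "\<rho> * sup_on (A i) f < sup_on (A i) f"
        using \<rho> sup_on_nonneg[OF A f, of i] by auto
      from sup_on_witness[OF A this] show ?thesis using less_imp_le by blast
    qed
    then have "\<forall>i. \<exists>a. a \<in> A i \<and> \<rho> * sup_on (A i) f \<le> cmod (f a)" by blast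
    from choice[OF this] obtain a where a: "\<And>i. a i \<in> A i" "\<And>i. \<rho> * sup_on (A i) f \<le> cmod (f (a i))"
      by blast
    have aV: "a i \<in> V" for i using a(1) test_setD(1)[OF A] by blast
    define Q where "Q = (\<Sum>i<k. (1/2)^i * (cmod (f (a i)))\<^sup>2)"
    have "\<rho>\<^sup>2 * T k \<le> Q"
      unfolding T_def Q_def sum_distrib_left
    proof (rule sum_mono)
      fix i
      have "(\<rho> * sup_on (A i) f)\<^sup>2 \<le> (cmod (f (a i)))\<^sup>2"
        using a(2) \<rho>(2) sup_on_nonneg[OF A f] by (intro power_mono) auto
      then show "\<rho>\<^sup>2 * ((1/2)^i * (sup_on (A i) f)\<^sup>2) \<le> (1/2)^i * (cmod (f (a i)))\<^sup>2"
        by (simp add: power_mult_distrib field_simps)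
    qed
    then have rQ: "r\<^sup>2 < Q" using \<rho> by linarith
    then have Q0: "0 < Q" by (meson le_less_trans zero_le_power2)
    \<comment> \<open>Coefficients of the equality case of Cauchy-Schwarz, normalized to weighted
      square sum 1.\<close>
    define c where "c i = cnj (f (a i)) / sqrt Q" for i
    define b where "b = (\<Sum>i<k. (complex_of_real ((1/2)^i) * c i) *\<^sub>C a i)"
    have "(\<Sum>i<k. (1/2)^i * (cmod (c i))\<^sup>2) = (\<Sum>i<k. (1/2)^i * (cmod (f (a i)))\<^sup>2 / Q)"
      using Q0 by (intro sum.cong) (auto simp: c_def norm_divide power_divide)
    also have "\<dots> = 1" using Q0 by (simp add: Q_def flip: sum_divide_distrib)
    finally have b: "b \<in> B" unfolding B_def b_def using a(1) by fastforce
    have "f b = (\<Sum>i<k. complex_of_real ((1/2)^i) * c i * f (a i))"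
      unfolding b_def by (subst dual_sum[OF f]) (use aV f in \<open>auto simp: dual_scale\<close>)
    also have "\<dots> = (\<Sum>i<k. complex_of_real ((1/2)^i * (cmod (f (a i)))\<^sup>2 / sqrt Q))"
      by (intro sum.cong) (auto simp: c_def complex_norm_square mult_ac simp del: of_real_power)
    also have "\<dots> = complex_of_real (Q / sqrt Q)"
      by (simp add: Q_def sum_divide_distrib)
    finally have "cmod (f b) = sqrt Q" using Q0 by (simp add: real_div_sqrt)
    moreover have "r < sqrt Q" using rQ by (rule real_less_rsqrt)
    ultimately show ?thesis using b by (intro bexI[of _ b]) simp_all
  qed
  \<comment> \<open>Boundedness of \<open>B\<close> is read off a norming functional, whose value at
    \<open>b\<close> is at most its l2 supremum.\<close>
  have "N b \<le> 2" if b: "b \<in> B" for b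
  proof -
    have bV: "b \<in> V" using b BV by (rule subsetD[rotated])
    obtain f where f: "f \<in> cdual V N" "dual_norm V N f \<le> 1" "f b = complex_of_real (N b)"
      by (rule norming_functional[OF bV])
    have "N b = cmod (f b)" using f(3) N_nonneg[OF bV] by simp
    also have "\<dots> \<le> 2" using le[OF f(1) b] l2_sup_le[OF f(1)] f(2) by linarith
    finally show ?thesis .
  qed
  then show ?thesis unfolding dual_type_def using BV le ex
    by (intro exI[of _ B] conjI exI[of _ 2] ballI allI impI) auto
qed

end

end

section \<open>Locating a functional by its label\<close>

text \<open>The weak topology enters only through its subbasic sets: one functional and one
  neighbourhood of 0 give the scalar limit.\<close>

lemma weakly_LUR_onD:
  assumes W: "weakly_LUR_on V N" and V: "cnormed V N"
    and x: "x \<in> V" and s: "\<And>n. s n \<in> V"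
    and lim: "(\<lambda>n. N (s n)) \<longlonglongrightarrow> N x" "(\<lambda>n. N (s n + x)) \<longlonglongrightarrow> 2 * N x"
    and F: "F \<in> cdual V N"
  shows "(\<lambda>n. F (s n)) \<longlonglongrightarrow> F x"
proof -
  interpret cnormed V N by (rule V)
  have l: "limitin (weak_topology V N) (\<lambda>n. s n - x) 0 sequentially"
    using W x s lim unfolding weakly_LUR_on_def by blast
  have "(\<lambda>n. F (s n - x)) \<longlonglongrightarrow> 0"
  proof (rule topological_tendstoI)
    fix U :: "complex set" assume U: "open U" "0 \<in> U"
    have "openin (weak_topology V N) {x \<in> V. F x \<in> U}"
      unfolding weak_topology_def by (rule topology_generated_by_Basis) (use F U in blast)
    moreover have "0 \<in> {x \<in> V. F x \<in> U}" using U by (simp add: dual_0[OF F])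
    ultimately have "\<forall>\<^sub>F n in sequentially. s n - x \<in> {x \<in> V. F x \<in> U}"
      using l unfolding limitin_def by blast
    then show "\<forall>\<^sub>F n in sequentially. F (s n - x) \<in> U" by (rule eventually_mono) simp
  qed
  then show ?thesis using s x by (simp add: dual_diff[OF F] LIM_zero_iff)
qed

context cnormed
begin

text \<open>The distance to \<open>W\<close> is a seminorm, so Hahn-Banach yields a functional vanishing on \<open>W\<close>.\<close>

lemma dense_if_annihilator_vanishes:
  assumes W: "cvec.subspace W" "W \<subseteq> V" and x: "x \<in> V"
    and ann: "\<And>F. F \<in> cdual V N \<Longrightarrow> (\<And>w. w \<in> W \<Longrightarrow> F w = 0) \<Longrightarrow> F x = 0"
    and e: "0 < e"
  shows "\<exists>w\<in>W. N (x - w) < e"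
proof -
  define q where "q y = Inf ((\<lambda>w. N (y - w)) ` W)" for y
  have WV: "w \<in> V" if "w \<in> W" for w using W that by auto
  have W0: "0 \<in> W" by (rule cvec.subspace_0[OF W(1)])
  have bdd: "bdd_below ((\<lambda>w. N (y - w)) ` W)" if "y \<in> V" for y
    using that WV by (intro bdd_belowI2[of _ 0]) auto
  have qle: "q y \<le> N (y - w)" if "y \<in> V" "w \<in> W" for y w
    unfolding q_def by (rule cInf_lower[OF _ bdd]) (use that in auto)
  have q0: "0 \<le> q y" if "y \<in> V" for y
    unfolding q_def by (rule cInf_greatest) (use that WV W0 in auto)
  have scale_le: "q (c *\<^sub>C y) \<le> cmod c * q y" if y: "y \<in> V" for c y
  proof (cases "c = 0")
    case True
    then show ?thesis using qle[of 0 0] W0 by simp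
  next
    case False
    have "q (c *\<^sub>C y) / cmod c \<le> q y"
      unfolding q_def[of y]
    proof (rule cInf_greatest)
      fix a assume "a \<in> (\<lambda>w. N (y - w)) ` W"
      then obtain w where w: "w \<in> W" "a = N (y - w)" by auto
      have "q (c *\<^sub>C y) \<le> N (c *\<^sub>C y - c *\<^sub>C w)"
        using y w cvec.subspace_scale[OF W(1)] by (intro qle) auto
      also have "\<dots> = cmod c * a"
        using y w WV N_scale[of "y - w" c] by (simp add: cvec.scale_right_diff_distrib)
      finally show "q (c *\<^sub>C y) / cmod c \<le> a" using False by (simp add: field_simps)
    qed (use W0 in auto)
    then show ?thesis using False by (simp add: field_simps)
  qed
  obtain F where F: "\<And>x y. x \<in> V \<Longrightarrow> y \<in> V \<Longrightarrow> F (x + y) = F x + F y"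
    "\<And>c x. x \<in> V \<Longrightarrow> F (c *\<^sub>C x) = c * F x"
    "\<And>x. x \<in> V \<Longrightarrow> cmod (F x) \<le> q x" "F x = complex_of_real (q x)"
    "\<And>x. x \<notin> V \<Longrightarrow> F x = 0"
  proof (rule seminorm_functional[OF sub x, of q])
    fix y z assume yz: "y \<in> V" "z \<in> V"
    show "q (y + z) \<le> q y + q z"
      unfolding q_def[of y] q_def[of z]
    proof (rule cInf_add_ge)
      fix a b assume "a \<in> (\<lambda>w. N (y - w)) ` W" "b \<in> (\<lambda>w. N (z - w)) ` W"
      then obtain v w where vw: "v \<in> W" "w \<in> W" "a = N (y - v)" "b = N (z - w)" by blast
      have "q (y + z) \<le> N (y + z - (v + w))"
        using yz vw cvec.subspace_add[OF W(1)] by (intro qle) auto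
      also have "y + z - (v + w) = (y - v) + (z - w)" by simp
      also have "N \<dots> \<le> a + b" using yz vw WV N_triangle[of "y - v" "z - w"] by auto
      finally show "q (y + z) \<le> a + b" .
    qed (use W0 in auto)
  next
    fix c y assume y: "y \<in> V"
    show "q (c *\<^sub>C y) = cmod c * q y"
      by (rule homogeneous_if_le[where q=q, OF sub y q0[OF mem(1)] scale_le])
  qed (use q0 in auto)
  have Fd: "F \<in> cdual V N"
  proof (rule dualI[where C=1])
    show "cmod (F y) \<le> 1 * N y" if "y \<in> V" for y
      using F(3)[OF that] qle[OF that W0] by simp
  qed (use F in auto)
  have "F w = 0" if w: "w \<in> W" for w
    using F(3)[OF WV[OF w]] qle[OF WV[OF w] w] order_trans by fastforce
  from ann[OF Fd this] have "q x = 0" using F(4) by simp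
  then have "Inf ((\<lambda>w. N (x - w)) ` W) < e" using e by (simp add: q_def)
  from cInf_lessD[OF _ this] W0 show ?thesis by auto
qed

lemma sup_on_scale:
  assumes A: "test_set A" and f: "f \<in> cdual V N"
  shows "sup_on A (c *\<^sub>C f) = cmod c * sup_on A f"
proof -
  interpret dual: cnormed "cdual V N" "dual_norm V N" by (rule cnormed_dual)
  have le: "sup_on A (c *\<^sub>C f) \<le> cmod c * sup_on A f" if f: "f \<in> cdual V N" for c f
    using sup_on_upper[OF A f] by (intro sup_on_least[OF A]) (auto simp: norm_mult mult_left_mono)
  show ?thesis
    by (rule homogeneous_if_le[where q="sup_on A", OF subspace_cdual f sup_on_nonneg[OF A dual.mem(1)] le])
qed

text \<open>\<open>w\<close> is a labelling of \<open>D\<close> that is constant on pairs at small \<open>2 - \<parallel>\<zeta> x + y\<parallel>\<close>. The test set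
  detects the label: only the \<open>u\<close> belonging to the label of \<open>x\<close> nearly norm \<open>x\<close>, so at \<open>x\<close>
  and nearby the \<open>v\<close>-part measures the distance to the line spanned by \<open>w x\<close>.\<close>

definition label_set :: "real \<Rightarrow> ('v \<Rightarrow> complex) set \<Rightarrow> (('v \<Rightarrow> complex) \<Rightarrow> 'v \<Rightarrow> complex) \<Rightarrow> 'v set" where
  "label_set \<delta> D w = insert 0 {(1/2) *\<^sub>C (u + complex_of_real (\<delta>/4) *\<^sub>C v) | u v.
     u \<in> V \<and> N u \<le> 1 \<and> v \<in> V \<and> N v \<le> 1 \<and> (\<exists>y\<in>D. 1 - \<delta>/2 < cmod (y u) \<and> w y v = 0)}"

lemma test_set_label:
  assumes "0 < \<delta>" "\<delta> \<le> 1"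
  shows "test_set (label_set \<delta> D w)"
  unfolding test_set_def
proof (intro conjI ballI subsetI)
  fix a assume "a \<in> label_set \<delta> D w"
  then consider "a = 0" | u v where "u \<in> V" "N u \<le> 1" "v \<in> V" "N v \<le> 1"
      "a = (1/2) *\<^sub>C (u + complex_of_real (\<delta>/4) *\<^sub>C v)"
    unfolding label_set_def by blast
  then have "a \<in> V \<and> N a \<le> 1"
  proof cases
    case 2
    have "N (u + complex_of_real (\<delta>/4) *\<^sub>C v) \<le> N u + \<delta>/4 * N v"
      using 2 assms N_triangle[of u "complex_of_real (\<delta>/4) *\<^sub>C v"] by auto
    also have "\<dots> \<le> 1 + 1 * 1" using 2 assms by (intro add_mono mult_mono) auto
    finally show ?thesis using 2 by (auto simp: norm_divide)
  qed simp
  then show "a \<in> V" "N a \<le> 1" by auto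
qed (simp add: label_set_def)

text \<open>The supremum over the label set is sandwiched: if \<open>u\<close> nearly norms
  \<open>x\<close>, it is at least half of \<open>cmod (z u) + \<eta> * sup_on K z\<close>, and at
  \<open>x\<close> itself it is at most half of \<open>1 + \<eta> * sup_on K x\<close>. So its
  convergence makes \<open>s k\<close> nearly as small as \<open>x\<close> on the unit ball
  \<open>K\<close> of the kernel of \<open>w x\<close>; the one remaining direction is left to
  pointwise convergence.\<close>

lemma label_localization:
  assumes \<delta>: "0 < \<delta>" "\<delta> \<le> 1" and D: "\<And>y. y \<in> D \<Longrightarrow> y \<in> cdual V N"
    and iso: "\<And>x y \<zeta>. x \<in> D \<Longrightarrow> y \<in> D \<Longrightarrow> cmod \<zeta> = 1 \<Longrightarrow>
        2 - \<delta> < dual_norm V N (\<zeta> *\<^sub>C x + y) \<Longrightarrow> w x = w y"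
    and x: "x \<in> D" "dual_norm V N x = 1" and wx: "w x \<in> cdual V N" "w x \<noteq> 0"
    and e: "0 < e" "dual_norm V N (x - w x) < e"
    and s: "\<And>k. s k \<in> cdual V N" and ptw: "\<And>v. v \<in> V \<Longrightarrow> (\<lambda>k. s k v) \<longlonglongrightarrow> x v"
    and lim: "(\<lambda>k. sup_on (label_set \<delta> D w) (s k)) \<longlonglongrightarrow> sup_on (label_set \<delta> D w) x"
  shows "\<forall>\<^sub>F k in sequentially. dual_norm V N (s k - x) \<le> 13 * e"
proof -
  interpret dual: cnormed "cdual V N" "dual_norm V N" by (rule cnormed_dual)
  define A where "A = label_set \<delta> D w"
  define K where "K = {v \<in> V. N v \<le> 1 \<and> w x v = 0}"
  \<comment> \<open>A point \<open>u\<close> that fails to norm \<open>x\<close> loses \<delta>/2,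
    and the \<open>v\<close>-part regains at most \<delta>/4, so such points do not affect the upper
    bound at \<open>x\<close>.\<close>
  define \<eta> where "\<eta> = \<delta> / 4"
  have \<eta>: "0 < \<eta>" using \<delta> by (simp add: \<eta>_def)
  have A: "test_set A" unfolding A_def by (rule test_set_label[OF \<delta>])
  have K: "test_set K" by (auto simp: test_set_def K_def dual_0[OF wx(1)])
  have x': "x \<in> cdual V N" using D x by auto
  have lower: "cmod (z u) + \<eta> * sup_on K z \<le> 2 * sup_on A z"
    if z: "z \<in> cdual V N" and u: "u \<in> V" "N u \<le> 1" "1 - \<delta>/2 < cmod (x u)" for z u
  proof -
    have "sup_on K z \<le> (2 * sup_on A z - cmod (z u)) / \<eta>"
    proof (rule sup_on_least[OF K])
      fix v assume v: "v \<in> K"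
      obtain c where c: "cmod c = 1" "c * z u = complex_of_real (cmod (z u))"
        by (rule unimodular_rotation)
      obtain d where d: "cmod d = 1" "d * z v = complex_of_real (cmod (z v))"
        by (rule unimodular_rotation)
      have cu: "c *\<^sub>C u \<in> V" "N (c *\<^sub>C u) \<le> 1" "1 - \<delta>/2 < cmod (x (c *\<^sub>C u))"
        using u c by (auto simp: dual_scale[OF x'] norm_mult)
      have dv: "d *\<^sub>C v \<in> V" "N (d *\<^sub>C v) \<le> 1" "w x (d *\<^sub>C v) = 0"
        using v d by (auto simp: K_def dual_scale[OF wx(1)])
      define a where "a = (1/2) *\<^sub>C (c *\<^sub>C u + complex_of_real (\<delta>/4) *\<^sub>C d *\<^sub>C v)"
      have aA: "a \<in> A" unfolding A_def label_set_def a_def using cu dv x by blast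
      have "2 * z a = z (c *\<^sub>C u + complex_of_real (\<delta>/4) *\<^sub>C d *\<^sub>C v)"
        unfolding a_def by (subst dual_scale[OF z]) (intro mem cu dv, simp)
      also have "\<dots> = c * z u + complex_of_real \<eta> * (d * z v)"
        using u v by (simp add: dual_add[OF z] dual_scale[OF z] K_def \<eta>_def)
      also have "\<dots> = complex_of_real (cmod (z u) + \<eta> * cmod (z v))"
        unfolding c d by simp
      finally have "cmod (2 * z a) = \<bar>cmod (z u) + \<eta> * cmod (z v)\<bar>"
        by (simp only: norm_of_real)
      then have "2 * cmod (z a) = cmod (z u) + \<eta> * cmod (z v)"
        using \<eta> by (simp add: norm_mult)
      then have "cmod (z u) + \<eta> * cmod (z v) \<le> 2 * sup_on A z"
        using sup_on_upper[OF A z aA] by linarith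
      then show "cmod (z v) \<le> (2 * sup_on A z - cmod (z u)) / \<eta>"
        using \<eta> by (simp add: field_simps)
    qed
    then show ?thesis using \<eta> by (simp add: field_simps)
  qed
  have upper: "2 * sup_on A x \<le> 1 + \<eta> * sup_on K x"
  proof -
    have "sup_on A x \<le> (1 + \<eta> * sup_on K x) / 2"
    proof (rule sup_on_least[OF A])
      fix a assume "a \<in> A"
      then consider "a = 0" | u v y where "u \<in> V" "N u \<le> 1" "v \<in> V" "N v \<le> 1"
          "a = (1/2) *\<^sub>C (u + complex_of_real (\<delta>/4) *\<^sub>C v)" "y \<in> D" "1 - \<delta>/2 < cmod (y u)" "w y v = 0"
        unfolding A_def label_set_def by blast
      then show "cmod (x a) \<le> (1 + \<eta> * sup_on K x) / 2"
      proof cases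
        case 1
        then show ?thesis using \<eta> sup_on_nonneg[OF K x'] by (simp add: dual_0[OF x'])
      next
        case 2
        have "2 * x a = x u + complex_of_real \<eta> * x v"
          unfolding 2(5) using 2(1,3) by (simp add: dual_add[OF x'] dual_scale[OF x'] \<eta>_def)
        then have "2 * cmod (x a) = cmod (x u + complex_of_real \<eta> * x v)"
          by (metis norm_mult norm_numeral)
        also have "\<dots> \<le> cmod (x u) + \<eta> * cmod (x v)"
          using norm_triangle_ineq[of "x u" "complex_of_real \<eta> * x v"] \<eta> by (simp add: norm_mult)
        finally have xa: "2 * cmod (x a) \<le> cmod (x u) + \<eta> * cmod (x v)" .
        have xu: "cmod (x u) \<le> 1" and xv: "cmod (x v) \<le> 1"
          using dual_unit_le[OF x'] 2 x by auto
        show ?thesis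
        proof (cases "1 - \<delta>/2 < cmod (x u)")
          case True
          \<comment> \<open>Rotations align \<open>x u\<close> and \<open>y u\<close>, so the
            rotated sum has norm above \<open>2 - \<delta>\<close>; then the labels agree and
            \<open>v\<close> lies in \<open>K\<close>.\<close>
          obtain c where c: "cmod c = 1" "c * x u = complex_of_real (cmod (x u))"
            by (rule unimodular_rotation)
          obtain d where d: "cmod d = 1" "d * y u = complex_of_real (cmod (y u))"
            by (rule unimodular_rotation)
          have y': "y \<in> cdual V N" using D 2 by auto
          have d0: "d \<noteq> 0" using d(1) by auto
          have "2 - \<delta> < cmod (x u) + cmod (y u)" using True 2 by simp
          also have "\<dots> = cmod ((c *\<^sub>C x + d *\<^sub>C y) u)"
            unfolding fun_eval scaleC_fun_apply scaleC_complex_eq c d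
            by (simp flip: of_real_add)
          also have "\<dots> \<le> dual_norm V N (c *\<^sub>C x + d *\<^sub>C y)"
            by (rule dual_unit_le[OF _ 2(1,2)]) (intro dual.mem x' y')
          also have "c *\<^sub>C x + d *\<^sub>C y = d *\<^sub>C ((c / d) *\<^sub>C x + y)"
            using d0 by (simp add: scaleC_add_right)
          also have "dual_norm V N \<dots> = dual_norm V N ((c / d) *\<^sub>C x + y)"
            by (subst dual.N_scale) (intro dual.mem x' y', simp add: d)
          finally have "w x = w y"
            using c d x 2 by (intro iso[of x y "c / d"]) (auto simp: norm_divide)
          then have "v \<in> K" using 2 by (simp add: K_def)
          then have "\<eta> * cmod (x v) \<le> \<eta> * sup_on K x"
            using sup_on_upper[OF K x'] \<eta> by (intro mult_left_mono) auto
          then show ?thesis using xa xu by simp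
        next
          case False
          have "2 * cmod (x a) \<le> (1 - \<delta>/2) + \<eta> * 1"
            using False xv \<eta> by (intro order_trans[OF xa] add_mono mult_left_mono) auto
          moreover have "\<delta> = 4 * \<eta>" by (simp add: \<eta>_def)
          ultimately have "cmod (x a) \<le> 1 / 2" using \<eta> by linarith
          also have "\<dots> \<le> (1 + \<eta> * sup_on K x) / 2"
            using \<eta> sup_on_nonneg[OF K x'] by (intro divide_right_mono) auto
          finally show ?thesis .
        qed
      qed
    qed
    then show ?thesis by simp
  qed
  have psi_x: "sup_on K x \<le> e"
  proof (rule sup_on_least[OF K])
    fix v assume v: "v \<in> K"
    have "x v = (x - w x) v" using v by (simp add: K_def)
    also have "cmod \<dots> \<le> dual_norm V N (x - w x)"
      using v by (intro dual_unit_le[OF dual.mem(4)[OF x' wx(1)]]) (auto simp: K_def)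
    also have "\<dots> \<le> e" by (rule less_imp_le[OF e(2)])
    finally show "cmod (x v) \<le> e" .
  qed
  \<comment> \<open>Two demands on \<open>u\<close>: it must detect the label of \<open>x\<close>,
    and it may miss the norm 1 only by \<open>\<eta> * e\<close>, which costs \<open>e\<close> after
    division by \<eta>.\<close>
  have "max (1 - \<delta>/2) (1 - \<eta> * e) < dual_norm V N x" using \<delta> \<eta> e x by simp
  from dual_norm_witness[OF x' this] obtain u where
    u: "u \<in> V" "N u \<le> 1" "1 - \<delta>/2 < cmod (x u)" "1 - \<eta> * e < cmod (x u)" by auto
  have "(\<lambda>k. cmod (s k u)) \<longlonglongrightarrow> cmod (x u)" using ptw[OF u(1)] by (rule tendsto_norm)
  then have ev1: "\<forall>\<^sub>F k in sequentially. 1 - \<eta> * e < cmod (s k u)"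
    using u(4) by (rule order_tendstoD(1))
  have "2 * sup_on A x < 1 + \<eta> * sup_on K x + \<eta> * e"
    using upper mult_pos_pos[OF \<eta> e(1)] by linarith
  moreover have "(\<lambda>k. 2 * sup_on A (s k)) \<longlonglongrightarrow> 2 * sup_on A x"
    using lim unfolding A_def by (intro tendsto_mult tendsto_const)
  ultimately have ev2: "\<forall>\<^sub>F k in sequentially. 2 * sup_on A (s k) < 1 + \<eta> * sup_on K x + \<eta> * e"
    by (intro order_tendstoD(2))
  have "0 < dual_norm V N (w x)"
    using dual.N_eq_0[OF wx(1)] dual.N_nonneg[OF wx(1)] wx(2) by linarith
  then have nw: "0 < dual_norm V N (w x)" "dual_norm V N (w x) / 2 < dual_norm V N (w x)" by auto
  obtain u0 where u0: "u0 \<in> V" "N u0 \<le> 1" "dual_norm V N (w x) / 2 < cmod (w x u0)"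
    using dual_norm_witness[OF wx(1) nw(2)] by blast
  \<comment> \<open>A vector dual to \<open>w x\<close>, of norm within a factor 2 of the optimum
    because \<open>u0\<close> norms \<open>w x\<close> up to that factor.\<close>
  define y where "y = (1 / w x u0) *\<^sub>C u0"
  have wu0: "w x u0 \<noteq> 0" using u0 nw by auto
  have y: "y \<in> V" "w x y = 1" using u0 wu0 by (auto simp: y_def dual_scale[OF wx(1)])
  have wu0': "0 < cmod (w x u0)" using wu0 by simp
  have Ny: "dual_norm V N (w x) * N y \<le> 2"
  proof -
    have "N y = N u0 / cmod (w x u0)" using u0 by (simp add: y_def norm_divide)
    also have "\<dots> \<le> 1 / cmod (w x u0)" using u0 wu0' by (intro divide_right_mono) auto
    finally have "dual_norm V N (w x) * N y \<le> dual_norm V N (w x) * (1 / cmod (w x u0))"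
      using nw by (intro mult_left_mono) auto
    also have "\<dots> \<le> 2" using u0(3) wu0' by (simp add: field_simps)
    finally show ?thesis .
  qed
  have "(\<lambda>k. dual_norm V N (w x) * cmod (s k y - x y)) \<longlonglongrightarrow> dual_norm V N (w x) * cmod (x y - x y)"
    by (intro tendsto_intros ptw y)
  then have ev3: "\<forall>\<^sub>F k in sequentially. dual_norm V N (w x) * cmod (s k y - x y) < e"
    using e by (intro order_tendstoD(2)) auto
  show ?thesis
    using ev1 ev2 ev3
  proof eventually_elim
    case (elim k)
    have "cmod (s k u) + \<eta> * sup_on K (s k) \<le> 2 * sup_on A (s k)"
      by (rule lower[OF s u(1-3)])
    then have "\<eta> * sup_on K (s k) < \<eta> * sup_on K x + 2 * (\<eta> * e)"
      using elim by linarith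
    also have "\<dots> = \<eta> * (sup_on K x + 2 * e)" by (simp add: algebra_simps)
    finally have "\<eta> * sup_on K (s k) < \<eta> * (sup_on K x + 2 * e)" .
    then have Ks: "sup_on K (s k) < sup_on K x + 2 * e" using \<eta> by simp
    define z where "z = s k - x"
    have z: "z \<in> cdual V N" unfolding z_def by (intro dual.mem s x')
    have Kz: "cmod (z v) \<le> 4 * e" if "v \<in> K" for v
      using sup_on_upper[OF K s that, of k] sup_on_upper[OF K x' that] Ks psi_x
        norm_triangle_ineq4[of "s k v" "x v"] unfolding z_def fun_eval by linarith
    show "dual_norm V N (s k - x) \<le> 13 * e"
      unfolding z_def[symmetric]
    proof (rule dual_norm_least)
      fix v assume v: "v \<in> V" "N v \<le> 1"
      \<comment> \<open>Projecting along \<open>y\<close> onto the kernel of \<open>w x\<close>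
        gives a vector of norm at most 3, which turns \<open>4 * e\<close> on \<open>K\<close> into
        \<open>12 * e\<close>; the component along \<open>y\<close> adds the last
        \<open>e\<close>.\<close>
      define v' where "v' = v - w x v *\<^sub>C y"
      have v': "v' \<in> V" using v y by (simp add: v'_def)
      have wv: "cmod (w x v) \<le> dual_norm V N (w x)" by (rule dual_unit_le[OF wx(1) v])
      have "N v' \<le> N v + cmod (w x v) * N y"
        using N_diff[of v "w x v *\<^sub>C y"] v y by (simp add: v'_def)
      also have "\<dots> \<le> 1 + dual_norm V N (w x) * N y"
        using v wv y by (intro add_mono mult_right_mono) auto
      finally have Nv': "N v' \<le> 3" using Ny by simp
      have "w x v' = 0" using v y by (simp add: v'_def dual_diff[OF wx(1)] dual_scale[OF wx(1)])
      then have "(1/3) *\<^sub>C v' \<in> K"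
        using v' Nv' by (simp add: K_def dual_scale[OF wx(1)] norm_divide)
      from Kz[OF this] have zv': "cmod (z v') \<le> 12 * e"
        using v' by (simp add: dual_scale[OF z] norm_divide)
      have "z v = z v' + w x v * z y"
        using v y by (simp add: v'_def dual_diff[OF z] dual_scale[OF z])
      then have "cmod (z v) \<le> cmod (z v') + cmod (w x v) * cmod (z y)"
        using norm_triangle_ineq[of "z v'" "w x v * z y"] by (simp add: norm_mult)
      also have "\<dots> \<le> 12 * e + dual_norm V N (w x) * cmod (z y)"
        using zv' wv by (intro add_mono mult_right_mono) auto
      also have "dual_norm V N (w x) * cmod (z y) < e" using elim by (simp add: z_def)
      finally show "cmod (z v) \<le> 13 * e" by simp
    qed
  qed
qed

end

section \<open>Stone's argument for the rotundity gauge\<close>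

lemma complex_dense_sequence:
  obtains q :: "nat \<Rightarrow> complex" where "\<And>a e. 0 < e \<Longrightarrow> \<exists>i. cmod (a - q i) < e"
proof -
  obtain Q :: "complex set" where Q: "countable Q" "\<And>U. open U \<Longrightarrow> U \<noteq> {} \<Longrightarrow> \<exists>d\<in>Q. d \<in> U"
    by (rule countable_dense_setE) blast
  have "Q \<noteq> {}" using Q(2)[of UNIV] by auto
  then have r: "range (from_nat_into Q) = Q" using Q(1) by (rule range_from_nat_into)
  show thesis
  proof (rule that)
    fix a :: complex and e :: real assume "0 < e"
    then obtain d where "d \<in> Q" "d \<in> ball a e" using Q(2)[of "ball a e"] by auto
    then show "\<exists>i. cmod (a - from_nat_into Q i) < e"
      using r by (metis dist_norm mem_ball rangeE)
  qed
qed

context cnormed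
begin

text \<open>The unimodular factor is there because test sets see only the moduli
  \<open>cmod (y u)\<close>, so functionals can be compared only up to rotation. The gap
  \<open>1 / real (Suc n)\<close> later becomes the \<delta> of \<open>label_set\<close>.\<close>

definition close :: "nat \<Rightarrow> 'v \<Rightarrow> 'v \<Rightarrow> bool" where
  "close n x y \<longleftrightarrow> (\<exists>\<zeta>. cmod \<zeta> = 1 \<and> 2 - 1 / real (Suc n) < N (\<zeta> *\<^sub>C x + y))"

lemma close_sym:
  assumes "close n x y" "x \<in> V" "y \<in> V" shows "close n y x"
proof -
  obtain \<zeta> where z: "cmod \<zeta> = 1" "2 - 1 / real (Suc n) < N (\<zeta> *\<^sub>C x + y)"
    using assms unfolding close_def by auto
  have z0: "\<zeta> \<noteq> 0" using z(1) by auto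
  have "\<zeta> *\<^sub>C x + y = \<zeta> *\<^sub>C ((1 / \<zeta>) *\<^sub>C y + x)" using z0 by (simp add: scaleC_add_right add.commute)
  then have "N (\<zeta> *\<^sub>C x + y) = N ((1 / \<zeta>) *\<^sub>C y + x)"
    using assms(2,3) z by (simp del: cvec.scale_scale)
  then show ?thesis unfolding close_def using z
    by (intro exI[of _ "1 / \<zeta>"]) (auto simp: norm_divide)
qed

lemma close_refl: "x \<in> V \<Longrightarrow> N x = 1 \<Longrightarrow> close n x x"
proof -
  assume x: "x \<in> V" "N x = 1"
  have "x + x = 2 *\<^sub>C x" using scaleC_add_left[of 1 1 x] by simp
  then have "N (1 *\<^sub>C x + x) = 2" using x by simp
  then show "close n x x" unfolding close_def by (intro exI[of _ 1]) simp
qed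

lemma close_mono: "close n x y \<Longrightarrow> m \<le> n \<Longrightarrow> close m x y"
proof -
  assume "close n x y" and mn: "m \<le> n"
  moreover have "1 / real (Suc n) \<le> 1 / real (Suc m)" using mn by (intro divide_left_mono) auto
  ultimately show "close m x y" unfolding close_def by force
qed

text \<open>Stone's argument for the relations \<open>close n\<close>: with the well-ordering \<open>r\<close>, \<open>c m x\<close> is the
  first centre whose \<open>m\<close>-neighbourhood contains \<open>x\<close>, and on the set \<open>D m n\<close> of points that lie
  \<open>1/n\<close>-deep in that neighbourhood, \<open>c m\<close> is constant on \<open>n\<close>-close pairs.\<close>

lemma stone_labels:
  assumes deep: "\<And>m x y. x \<in> V \<Longrightarrow> N x = 1 \<Longrightarrow> y \<in> V \<Longrightarrow> N y = 1 \<Longrightarrow> close m y x \<Longrightarrow>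
      \<exists>n. \<forall>z\<in>V. N z = 1 \<longrightarrow> close n x z \<longrightarrow> close m y z"
  obtains c :: "nat \<Rightarrow> 'v \<Rightarrow> 'v" and D :: "nat \<Rightarrow> nat \<Rightarrow> 'v set" where
    "\<And>m x. x \<in> V \<Longrightarrow> N x = 1 \<Longrightarrow> c m x \<in> V \<and> N (c m x) = 1 \<and> close m (c m x) x"
    "\<And>m n. D m n \<subseteq> {x \<in> V. N x = 1}"
    "\<And>m x. x \<in> V \<Longrightarrow> N x = 1 \<Longrightarrow> \<exists>n. x \<in> D m n"
    "\<And>m n n'. n \<le> n' \<Longrightarrow> D m n \<subseteq> D m n'"
    "\<And>m n x y. x \<in> D m n \<Longrightarrow> y \<in> D m n \<Longrightarrow> close n x y \<Longrightarrow> c m x = c m y"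
proof -
  define S where "S = {x \<in> V. N x = 1}"
  obtain r :: "'v rel" where r: "well_order_on UNIV r" using well_order_on by blast
  then have wf: "wf (r - Id)" and lin: "linear_order_on UNIV r" by (auto simp: well_order_on_def)
  have anti: "(a, b) \<in> r \<Longrightarrow> (b, a) \<in> r \<Longrightarrow> a = b" and tot: "(a, b) \<in> r \<or> (b, a) \<in> r" for a b
    using lin unfolding linear_order_on_def partial_order_on_def preorder_on_def
      antisym_def total_on_def refl_on_def by (auto, metis)
  have "\<exists>y. y \<in> S \<and> close m y x \<and> (\<forall>z\<in>S. close m z x \<longrightarrow> (y, z) \<in> r)" if "x \<in> S" for m x
  proof -
    have "x \<in> {y \<in> S. close m y x}" using that close_refl by (auto simp: S_def)
    from wfE_min[OF wf this] obtain y where y: "y \<in> {y \<in> S. close m y x}"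
      "\<And>z. (z, y) \<in> r - Id \<Longrightarrow> z \<notin> {y \<in> S. close m y x}" by blast
    then show ?thesis using tot by blast
  qed
  then have "\<forall>m x. \<exists>y. x \<in> S \<longrightarrow> y \<in> S \<and> close m y x \<and> (\<forall>z\<in>S. close m z x \<longrightarrow> (y, z) \<in> r)"
    by blast
  then obtain c where c: "\<And>m x. x \<in> S \<Longrightarrow> c m x \<in> S" "\<And>m x. x \<in> S \<Longrightarrow> close m (c m x) x"
    "\<And>m x z. x \<in> S \<Longrightarrow> z \<in> S \<Longrightarrow> close m z x \<Longrightarrow> (c m x, z) \<in> r"
    by metis
  define D where "D m n = {x \<in> S. \<forall>z\<in>S. close n x z \<longrightarrow> close m (c m x) z}" for m n
  show thesis
  proof (rule that[of c D])
    show "\<exists>n. x \<in> D m n" if "x \<in> V" "N x = 1" for m x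
      using deep[of x "c m x" m] c(1,2)[of x m] that by (auto simp: D_def S_def)
    show "D m n \<subseteq> D m n'" if "n \<le> n'" for m n n'
      using close_mono[OF _ that] by (auto simp: D_def)
    \<comment> \<open>Each point lies in the neighbourhood of the other's centre, so each centre
      precedes or equals the other in the well-ordering.\<close>
    show "c m x = c m y" if xy: "x \<in> D m n" "y \<in> D m n" "close n x y" for m n x y
    proof (rule anti)
      have S: "x \<in> S" "y \<in> S" using xy by (auto simp: D_def)
      have "close n y x" using close_sym[OF xy(3)] S by (auto simp: S_def)
      then have "close m (c m y) x" using xy(2) S by (auto simp: D_def)
      then show "(c m x, c m y) \<in> r" using c S by blast
      have "close m (c m x) y" using xy(1,3) S by (auto simp: D_def)
      then show "(c m y, c m x) \<in> r" using c S by blast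
    qed
  qed (use c in \<open>auto simp: D_def S_def\<close>)
qed

text \<open>A list of naturals encodes length and coefficients at once. The recipes are thus
  countable, and the same recipe applies to the centres of every functional.\<close>

definition lincomb :: "(nat \<Rightarrow> complex) \<Rightarrow> (nat \<Rightarrow> 'v) \<Rightarrow> nat list \<Rightarrow> 'v" where
  "lincomb q c l = (\<Sum>m<length l. q (l ! m) *\<^sub>C c m)"

text \<open>Hahn-Banach gives an arbitrary combination within \<open>e / 2\<close>; since the
  centres have norm at most 1, rounding the coefficients costs at most another
  \<open>e / 2\<close>.\<close>

lemma lincomb_dense:
  assumes q: "\<And>a e. 0 < e \<Longrightarrow> \<exists>i. cmod (a - q i) < e"
    and c: "\<And>m. c m \<in> V" "\<And>m. N (c m) \<le> 1" and x: "x \<in> V"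
    and ann: "\<And>F. F \<in> cdual V N \<Longrightarrow> (\<And>m. F (c m) = 0) \<Longrightarrow> F x = 0" and e: "0 < e"
  shows "\<exists>l. N (x - lincomb q c l) < e"
proof -
  define W where "W = {(\<Sum>m<k. a m *\<^sub>C c m) | k a. True}"
  have WI: "(\<Sum>m<k. a m *\<^sub>C c m) \<in> W" for k a unfolding W_def by blast
  have W: "cvec.subspace W"
  proof (rule cvec.subspaceI)
    show "0 \<in> W" using WI[of 0] by simp
    show "u *\<^sub>C y \<in> W" if y: "y \<in> W" for u y
    proof -
      obtain k a where "y = (\<Sum>m<k. a m *\<^sub>C c m)" using y unfolding W_def by blast
      then have "u *\<^sub>C y = (\<Sum>m<k. (u * a m) *\<^sub>C c m)" by (simp add: cvec.scale_sum_right)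
      then show ?thesis using WI[where k=k and a="\<lambda>m. u * a m"] by simp
    qed
    show "y + z \<in> W" if yz: "y \<in> W" "z \<in> W" for y z
    proof -
      obtain k a l b where kl: "y = (\<Sum>m<k. a m *\<^sub>C c m)" "z = (\<Sum>m<l. b m *\<^sub>C c m)"
        using yz unfolding W_def by blast
      have ext: "(\<Sum>m<k. a m *\<^sub>C c m) = (\<Sum>m<max k l. (if m < k then a m else 0) *\<^sub>C c m)" for k l a
        by (intro sum.mono_neutral_cong_left) auto
      have "y + z = (\<Sum>m<max k l. ((if m < k then a m else 0) + (if m < l then b m else 0)) *\<^sub>C c m)"
        unfolding kl ext[of a k l] ext[of b l k] max.commute[of l k] scaleC_add_left sum.distrib ..
      also have "\<dots> \<in> W" by (rule WI)
      finally show ?thesis .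
    qed
  qed
  have sumV: "(\<Sum>m<k. a m *\<^sub>C c m) \<in> V" for k a
    by (rule cvec.subspace_sum[OF sub]) (use c in auto)
  then have WV: "W \<subseteq> V" unfolding W_def by blast
  have "\<exists>w\<in>W. N (x - w) < e / 2"
  proof (rule dense_if_annihilator_vanishes[OF W WV x])
    fix F assume F: "F \<in> cdual V N" "\<And>w. w \<in> W \<Longrightarrow> F w = 0"
    have "c m \<in> W" for m
    proof -
      have "(\<Sum>i<Suc m. (if i = m then 1 else 0) *\<^sub>C c i) = c m"
        by simp
      then show ?thesis using WI[where k="Suc m" and a="\<lambda>i. if i = m then 1 else 0"] by metis
    qed
    then show "F x = 0" using F ann by blast
  qed (use e in auto)
  then obtain k a where ka: "N (x - (\<Sum>m<k. a m *\<^sub>C c m)) < e / 2" unfolding W_def by blast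
  \<comment> \<open>\<open>real k + 1\<close> keeps the denominator positive for the empty
    combination, and \<open>k\<close> rounding errors still sum to at most
    \<open>e / 2\<close>.\<close>
  define d where "d = e / (2 * (real k + 1))"
  have d: "0 < d" using e by (simp add: d_def)
  have "\<forall>m. \<exists>i. cmod (a m - q i) < d" using q[OF d] by blast
  then obtain i where i: "\<And>m. cmod (a m - q (i m)) < d" by metis
  define l where "l = map i [0..<k]"
  have l: "lincomb q c l = (\<Sum>m<k. q (i m) *\<^sub>C c m)" by (simp add: lincomb_def l_def)
  have NS: "N (\<Sum>m<k. b m *\<^sub>C c m) \<le> (\<Sum>m<k. cmod (b m))" for b k
  proof (induction k)
    case (Suc k)
    have "N (\<Sum>m<Suc k. b m *\<^sub>C c m) \<le> N (\<Sum>m<k. b m *\<^sub>C c m) + cmod (b k) * N (c k)"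
      using N_triangle[OF sumV[of b k], of "b k *\<^sub>C c k"] c by simp
    also have "cmod (b k) * N (c k) \<le> cmod (b k) * 1" using c by (intro mult_left_mono) auto
    finally show ?case using Suc by simp
  qed simp
  have "N (x - lincomb q c l) \<le> N (x - (\<Sum>m<k. a m *\<^sub>C c m)) + N (\<Sum>m<k. (a m - q (i m)) *\<^sub>C c m)"
  proof -
    have *: "x - lincomb q c l = (x - (\<Sum>m<k. a m *\<^sub>C c m)) + (\<Sum>m<k. (a m - q (i m)) *\<^sub>C c m)"
      unfolding l by (simp add: cvec.scale_left_diff_distrib sum_subtractf)
    show ?thesis unfolding * by (intro N_triangle mem sumV x)
  qed
  also have "N (\<Sum>m<k. (a m - q (i m)) *\<^sub>C c m) \<le> (\<Sum>m<k. d)"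
    using i by (intro order_trans[OF NS] sum_mono less_imp_le) auto
  also have "(\<Sum>m<k. d) = e / 2 * (real k / (real k + 1))" by (simp add: d_def)
  also have "\<dots> \<le> e / 2 * 1" using e by (intro mult_left_mono) auto
  finally have "N (x - lincomb q c l) < e" using ka by simp
  then show ?thesis by blast
qed

end

section \<open>A weakly LUR dual norm yields a LUR dual norm\<close>

lemma LUR_on_cong:
  assumes "cvec.subspace V" "\<And>x. x \<in> V \<Longrightarrow> N x = M x" and M: "LUR_on V M"
  shows "LUR_on V N"
  unfolding LUR_on_def
proof (intro ballI allI impI)
  fix x and s :: "nat \<Rightarrow> 'a"
  assume x: "x \<in> V" and s: "range s \<subseteq> V"
    and lim: "(\<lambda>n. N (s n)) \<longlonglongrightarrow> N x" "(\<lambda>n. N (s n + x)) \<longlonglongrightarrow> 2 * N x"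
  have s': "s n \<in> V" "s n + x \<in> V" "s n - x \<in> V" for n
    using s x assms(1) by (auto intro: cvec.subspace_add cvec.subspace_diff)
  have "(\<lambda>n. M (s n - x)) \<longlonglongrightarrow> 0"
    using M x s lim unfolding LUR_on_def by (simp add: assms(2) s')
  then show "(\<lambda>n. N (s n - x)) \<longlonglongrightarrow> 0" by (simp add: assms(2) s')
qed

lemma tendsto_0_if_eventually_le:
  fixes a :: "nat \<Rightarrow> real"
  assumes "\<And>n. 0 \<le> a n" "\<And>e. 0 < e \<Longrightarrow> \<forall>\<^sub>F n in sequentially. a n \<le> e"
  shows "a \<longlonglongrightarrow> 0"
proof (rule tendstoI)
  fix e :: real assume "0 < e"
  then have "\<forall>\<^sub>F n in sequentially. a n \<le> e / 2" by (intro assms(2)) simp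
  then show "\<forall>\<^sub>F n in sequentially. dist (a n) 0 < e"
    by (rule eventually_mono) (use \<open>0 < e\<close> assms(1) in \<open>simp add: abs_of_nonneg\<close>)
qed

context cnormed
begin

lemma tendsto_2_if_close:
  assumes x: "x \<in> V" "N x = 1" and z: "\<And>n. z n \<in> V" "\<And>n. N (z n) = 1"
    and \<zeta>: "\<And>n. cmod (\<zeta> n) = 1" "\<And>n. 2 - 1 / real (Suc n) < N (\<zeta> n *\<^sub>C z n + x)"
  shows "(\<lambda>n. N (\<zeta> n *\<^sub>C z n + x)) \<longlonglongrightarrow> 2 * N x"
proof (rule tendsto_sandwich[of "\<lambda>n. 2 - 1 / real (Suc n)" _ _ "\<lambda>_. 2"])
  have "N (\<zeta> n *\<^sub>C z n + x) \<le> 2" for n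
    using N_triangle[of "\<zeta> n *\<^sub>C z n" x] x z \<zeta> by simp
  then show "\<forall>\<^sub>F n in sequentially. N (\<zeta> n *\<^sub>C z n + x) \<le> 2" by simp
  show "\<forall>\<^sub>F n in sequentially. 2 - 1 / real (Suc n) \<le> N (\<zeta> n *\<^sub>C z n + x)"
    using \<zeta>(2) by (simp add: less_imp_le)
  have "(\<lambda>n. 2 - 1 / real (Suc n)) \<longlonglongrightarrow> 2 - 0"
    by (intro tendsto_diff tendsto_const LIMSEQ_Suc[OF lim_1_over_n])
  then show "(\<lambda>n. 2 - 1 / real (Suc n)) \<longlonglongrightarrow> 2 * N x" using x by simp
qed (use x in auto)

text \<open>The canonical embedding into the bidual, cut off outside \<open>cdual V N\<close> as
  membership in \<open>cdual\<close> requires.\<close>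

lemma dual_eval: "v \<in> V \<Longrightarrow> (\<lambda>f. if f \<in> cdual V N then f v else 0) \<in> cdual (cdual V N) (dual_norm V N)"
proof -
  assume v: "v \<in> V"
  interpret dual: cnormed "cdual V N" "dual_norm V N" by (rule cnormed_dual)
  show ?thesis
  proof (rule dual.dualI[where C="N v"])
    show "cmod (if f \<in> cdual V N then f v else 0) \<le> N v * dual_norm V N f" if "f \<in> cdual V N" for f
      using dual_norm_bound[OF that v] that by (simp add: mult.commute)
  qed (use dual.mem in auto)
qed

theorem weakly_LUR_dual_renorming:
  assumes W: "weakly_LUR_on (cdual V N) (dual_norm V N)"
  obtains M where "equivalent_norm_on V N M" "LUR_on (cdual V N) (dual_norm V M)"
proof -
  let ?X = "cdual V N" and ?n = "dual_norm V N"
  interpret dual: cnormed ?X ?n by (rule cnormed_dual)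
  note weak = weakly_LUR_onD[OF W cnormed_dual]
  have ptw: "(\<lambda>n. s n v) \<longlonglongrightarrow> x v"
    if "x \<in> ?X" "\<And>n. s n \<in> ?X" "(\<lambda>n. ?n (s n)) \<longlonglongrightarrow> ?n x" "(\<lambda>n. ?n (s n + x)) \<longlonglongrightarrow> 2 * ?n x" "v \<in> V"
    for x v and s :: "nat \<Rightarrow> _"
    using weak[OF that(1-4) dual_eval[OF that(5)]] that(1,2) by simp
  \<comment> \<open>A dual norm is lower semicontinuous under pointwise convergence: the inequality
    for \<open>x\<close> is seen at one point \<open>u\<close> and carries over to the rotated
    \<open>z n\<close>.\<close>
  have deep: "\<exists>n. \<forall>z\<in>?X. ?n z = 1 \<longrightarrow> dual.close n x z \<longrightarrow> dual.close m y z"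
    if x: "x \<in> ?X" "?n x = 1" and y: "y \<in> ?X" "?n y = 1" and yx: "dual.close m y x" for m x y
  proof (rule ccontr)
    assume neg: "\<not> ?thesis"
    then have "\<forall>n. \<exists>z. z \<in> ?X \<and> ?n z = 1 \<and> dual.close n z x \<and> \<not> dual.close m y z"
      using dual.close_sym x(1) by blast
    then obtain z where z: "\<And>n. z n \<in> ?X" "\<And>n. ?n (z n) = 1" "\<And>n. dual.close n (z n) x"
      "\<And>n. \<not> dual.close m y (z n)"
      by metis
    from z(3) obtain \<zeta> where \<zeta>: "\<And>n. cmod (\<zeta> n) = 1"
      "\<And>n. 2 - 1 / real (Suc n) < ?n (\<zeta> n *\<^sub>C z n + x)"
      unfolding dual.close_def by metis
    obtain \<xi> where \<xi>: "cmod \<xi> = 1" "2 - 1 / real (Suc m) < ?n (\<xi> *\<^sub>C y + x)"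
      using yx unfolding dual.close_def by blast
    have "\<xi> *\<^sub>C y + x \<in> ?X" by (intro dual.mem x y)
    from dual_norm_witness[OF this \<xi>(2)] obtain u where
      u: "u \<in> V" "N u \<le> 1" "2 - 1 / real (Suc m) < cmod ((\<xi> *\<^sub>C y + x) u)" by blast
    have "(\<lambda>n. (\<zeta> n *\<^sub>C z n) u) \<longlonglongrightarrow> x u"
    proof (rule ptw[OF x(1) _ _ _ u(1)])
      show "\<zeta> n *\<^sub>C z n \<in> ?X" for n by (intro dual.mem z)
      show "(\<lambda>n. ?n (\<zeta> n *\<^sub>C z n)) \<longlonglongrightarrow> ?n x" using z \<zeta> x by simp
      show "(\<lambda>n. ?n (\<zeta> n *\<^sub>C z n + x)) \<longlonglongrightarrow> 2 * ?n x"
        by (rule dual.tendsto_2_if_close[OF x z(1,2) \<zeta>])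
    qed
    then have "(\<lambda>n. cmod (\<xi> * y u + (\<zeta> n *\<^sub>C z n) u)) \<longlonglongrightarrow> cmod (\<xi> * y u + x u)"
      by (intro tendsto_intros)
    then have "\<forall>\<^sub>F n in sequentially. 2 - 1 / real (Suc m) < cmod (\<xi> * y u + (\<zeta> n *\<^sub>C z n) u)"
      using u(3) by (intro order_tendstoD(1)) auto
    then obtain n where n: "2 - 1 / real (Suc m) < cmod (\<xi> * y u + (\<zeta> n *\<^sub>C z n) u)"
      by (auto simp: eventually_sequentially)
    have \<zeta>0: "\<zeta> n \<noteq> 0" using \<zeta>(1)[of n] by auto
    have "cmod (\<xi> * y u + (\<zeta> n *\<^sub>C z n) u) = cmod (\<zeta> n * (((\<xi> / \<zeta> n) *\<^sub>C y + z n) u))"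
      using \<zeta>0 by (simp add: distrib_left)
    also have "\<dots> = cmod (((\<xi> / \<zeta> n) *\<^sub>C y + z n) u)" by (simp only: norm_mult \<zeta> mult_1)
    also have "\<dots> \<le> ?n ((\<xi> / \<zeta> n) *\<^sub>C y + z n)"
      by (rule dual_unit_le[OF _ u(1,2)]) (intro dual.mem y z)
    finally have "dual.close m y (z n)"
      unfolding dual.close_def using n \<xi>(1) \<zeta>(1)[of n]
      by (intro exI[of _ "\<xi> / \<zeta> n"]) (auto simp: norm_divide)
    then show False using z(4) by simp
  qed
  obtain c D where c: "\<And>m x. x \<in> ?X \<Longrightarrow> ?n x = 1 \<Longrightarrow> c m x \<in> ?X \<and> ?n (c m x) = 1 \<and> dual.close m (c m x) x"
    and D: "\<And>m n. D m n \<subseteq> {x \<in> ?X. ?n x = 1}"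
      "\<And>m x. x \<in> ?X \<Longrightarrow> ?n x = 1 \<Longrightarrow> \<exists>n. x \<in> D m n"
      "\<And>m n n'. n \<le> n' \<Longrightarrow> D m n \<subseteq> D m n'"
      "\<And>m n x y. x \<in> D m n \<Longrightarrow> y \<in> D m n \<Longrightarrow> dual.close n x y \<Longrightarrow> c m x = c m y"
  proof (rule dual.stone_labels, goal_cases)
    case (1 m x y)
    show ?case by (rule deep[OF 1(2-6)])
  next
    case (2 c D)
    show ?case by (rule 2(1)[OF 2(2-6)])
  qed
  obtain q :: "nat \<Rightarrow> complex" where q: "\<And>a e. 0 < e \<Longrightarrow> \<exists>i. cmod (a - q i) < e"
  proof (rule complex_dense_sequence, goal_cases)
    case (1 q)
    show ?case by (rule 1(1)[OF 1(2)])
  qed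
  define w where "w l x = dual.lincomb q (\<lambda>m. c m x) l" for l x
  \<comment> \<open>One depth \<open>n\<close> for all centres used by \<open>l\<close>, so that a
    single closeness relation fixes the whole combination.\<close>
  define E where "E n l = {x \<in> ?X. ?n x = 1 \<and> (\<forall>m<length l. x \<in> D m n)}" for n :: nat and l :: "nat list"
  have iso: "w l x = w l y" if "x \<in> E n l" "y \<in> E n l" "dual.close n x y" for n l x y
    unfolding w_def dual.lincomb_def using that D(4) by (intro sum.cong) (auto simp: E_def)
  have wX: "w l x \<in> ?X" if "x \<in> ?X" "?n x = 1" for l x
    unfolding w_def dual.lincomb_def using c[OF that]
    by (intro cvec.subspace_sum[OF subspace_cdual] dual.mem) auto
  define L where "L i = (let (n, l) = from_nat i in label_set (1 / real (Suc n)) (E n l) (w l))" for i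
  \<comment> \<open>Index 0 is reserved for the unit ball, whose supremum is the original dual norm:
    it gives the lower equivalence bound and the limits to which the weak LUR hypothesis
    applies.\<close>
  define A where "A i = (case i of 0 \<Rightarrow> {v \<in> V. N v \<le> 1} | Suc i \<Rightarrow> L i)" for i
  have A: "test_set (A i)" for i
  proof (cases i)
    case (Suc j)
    have "test_set (label_set (1 / real (Suc n)) (E n l) (w l))" for n l
      by (rule test_set_label) auto
    then show ?thesis by (simp add: A_def L_def Suc case_prod_beta Let_def)
  qed (simp add: A_def test_set_def)
  have A0: "sup_on (A 0) f = ?n f" for f
    by (auto simp: A_def sup_on_def dual_norm_def intro!: arg_cong[of _ _ Sup])
  obtain M where M: "equivalent_norm_on V N M" "\<And>f. f \<in> ?X \<Longrightarrow> l2_sup A f = dual_norm V M f"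
  proof -
    have "equivalent_dual_norm_on V N (l2_sup A)"
    proof (rule dual_type_equivalent[OF l2_sup_dual_type[where A=A, OF A]])
      show "1 * ?n f \<le> l2_sup A f" if "f \<in> ?X" for f
        using sup_on_le_l2_sup[where A=A, OF A that] A0 by simp
    qed auto
    then show thesis using that unfolding equivalent_dual_norm_on_def by blast
  qed
  have "LUR_on ?X (l2_sup A)"
    unfolding LUR_on_def
  proof (intro ballI allI impI)
    fix f and s :: "nat \<Rightarrow> _"
    assume f: "f \<in> ?X" and "range s \<subseteq> ?X"
      and "(\<lambda>n. l2_sup A (s n)) \<longlonglongrightarrow> l2_sup A f" "(\<lambda>n. l2_sup A (s n + f)) \<longlonglongrightarrow> 2 * l2_sup A f"
    then have s: "s k \<in> ?X" for k by auto
    note lims = l2_sup_LUR_transfer[where A=A, OF A f s \<open>(\<lambda>n. l2_sup A (s n)) \<longlonglongrightarrow> _\<close> \<open>(\<lambda>n. l2_sup A (s n + f)) \<longlonglongrightarrow> _\<close>]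
    have n1: "(\<lambda>k. ?n (s k)) \<longlonglongrightarrow> ?n f" and n2: "(\<lambda>k. ?n (s k + f)) \<longlonglongrightarrow> 2 * ?n f"
      using lims[of 0] by (simp_all only: A0)
    have "(\<lambda>k. ?n (s k - f)) \<longlonglongrightarrow> 0"
    proof (cases "f = 0")
      case True
      then show ?thesis using n1 by simp
    next
      case False
      \<comment> \<open>Labels belong to the unit sphere, so \<open>f\<close> is normalized and the
        sequence scaled along with it; the \<open>t k\<close> need not have norm 1.\<close>
      define r where "r = ?n f"
      have r: "0 < r" using dual.N_eq_0[OF f] dual.N_nonneg[OF f] False by (simp add: r_def)
      define a where "a = complex_of_real (1 / r)"
      have a: "cmod a = 1 / r" using r by (simp add: a_def norm_divide)
      define x where "x = a *\<^sub>C f"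
      define t where "t k = a *\<^sub>C s k" for k
      have x: "x \<in> ?X" unfolding x_def by (intro dual.mem f)
      have t: "t k \<in> ?X" for k unfolding t_def by (intro dual.mem s)
      have nx: "?n x = 1" unfolding x_def dual.N_scale[OF f] a using r by (simp add: r_def)
      have t_ptw: "(\<lambda>k. t k v) \<longlonglongrightarrow> x v" if v: "v \<in> V" for v
        using ptw[OF f s n1 n2 v] unfolding t_def x_def scaleC_fun_apply scaleC_complex_eq
        by (intro tendsto_mult tendsto_const)
      have t_sup: "(\<lambda>k. sup_on (A i) (t k)) \<longlonglongrightarrow> sup_on (A i) x" for i
        using lims(1)[of i] unfolding t_def x_def sup_on_scale[OF A s] sup_on_scale[OF A f]
        by (intro tendsto_mult tendsto_const)
      \<comment> \<open>Here the weak limit is tested against an arbitrary functional on the dual.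
        The rotations \<zeta> vary with \<open>m\<close>, but a functional that kills every centre
        also kills its multiples.\<close>
      have ann: "F x = 0" if F: "F \<in> cdual ?X ?n" and Fc: "\<And>m. F (c m x) = 0" for F
      proof -
        have "\<exists>\<zeta>. cmod \<zeta> = 1 \<and> 2 - 1 / real (Suc m) < ?n (\<zeta> *\<^sub>C c m x + x)" for m
          using c[OF x nx, of m] unfolding dual.close_def by blast
        then obtain \<zeta> where \<zeta>: "\<And>m. cmod (\<zeta> m) = 1"
          "\<And>m. 2 - 1 / real (Suc m) < ?n (\<zeta> m *\<^sub>C c m x + x)"
          by metis
        have cx: "c m x \<in> ?X" "?n (c m x) = 1" for m using c[OF x nx] by auto
        have "(\<lambda>m. F (\<zeta> m *\<^sub>C c m x)) \<longlonglongrightarrow> F x"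
        proof (rule weak[OF x _ _ _ F])
          show "\<zeta> m *\<^sub>C c m x \<in> ?X" for m by (intro dual.mem cx)
          show "(\<lambda>m. ?n (\<zeta> m *\<^sub>C c m x)) \<longlonglongrightarrow> ?n x" using cx \<zeta> nx by simp
          show "(\<lambda>m. ?n (\<zeta> m *\<^sub>C c m x + x)) \<longlonglongrightarrow> 2 * ?n x"
            by (rule dual.tendsto_2_if_close[OF x nx cx \<zeta>])
        qed
        moreover have "F (\<zeta> m *\<^sub>C c m x) = 0" for m
          by (subst dual.dual_scale[OF F cx(1)]) (simp only: Fc mult_zero_right)
        ultimately have "(\<lambda>m. 0) \<longlonglongrightarrow> F x" by (simp only:)
        then show ?thesis by (simp only: LIMSEQ_const_iff)
      qed
      have loc: "\<forall>\<^sub>F k in sequentially. ?n (t k - x) \<le> 13 * e" if e: "0 < e" "e < 1" for e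
      proof -
        have cx: "c m x \<in> ?X" "?n (c m x) \<le> 1" for m using c[OF x nx, of m] by auto
        obtain l where l: "?n (x - w l x) < e"
          using dual.lincomb_dense[OF q, of "\<lambda>m. c m x" x e] cx x ann e(1) unfolding w_def by blast
        have "\<forall>m. \<exists>n. x \<in> D m n" using D(2)[OF x nx] by blast
        then obtain \<nu> where \<nu>: "\<And>m. x \<in> D m (\<nu> m)" by metis
        \<comment> \<open>The sum is an upper bound of the finitely many depths, and the sets
          \<open>D m n\<close> grow with \<open>n\<close>.\<close>
        define n where "n = (\<Sum>m<length l. \<nu> m)"
        have "x \<in> D m n" if "m < length l" for m
        proof -
          have "\<nu> m \<le> n" unfolding n_def using that by (intro member_le_sum) auto
          then show ?thesis using D(3) \<nu> by blast
        qed
        then have xE: "x \<in> E n l" using x nx by (simp add: E_def)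
        obtain i where i: "from_nat i = (n, l)" by (metis from_nat_to_nat)
        have Ai: "A (Suc i) = label_set (1 / real (Suc n)) (E n l) (w l)"
          by (simp add: A_def L_def i)
        \<comment> \<open>\<open>e < 1\<close> excludes the label 0, since \<open>x\<close> has norm
          1.\<close>
        have w0: "w l x \<noteq> 0" using l nx e(2) by auto
        show ?thesis
        proof (rule label_localization[of "1 / real (Suc n)" "E n l" "w l" x e t])
          show "w l y = w l z" if "y \<in> E n l" "z \<in> E n l" "cmod \<zeta> = 1"
            "2 - 1 / real (Suc n) < ?n (\<zeta> *\<^sub>C y + z)" for y z \<zeta>
            using that by (intro iso[of y n l z]) (auto simp: dual.close_def)
          show "(\<lambda>k. sup_on (label_set (1 / real (Suc n)) (E n l) (w l)) (t k))
              \<longlonglongrightarrow> sup_on (label_set (1 / real (Suc n)) (E n l) (w l)) x"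
            using t_sup[of "Suc i"] unfolding Ai .
        qed (use xE nx wX[OF x nx] w0 e l t t_ptw in \<open>auto simp: E_def\<close>)
      qed
      have "(\<lambda>k. ?n (t k - x)) \<longlonglongrightarrow> 0"
      proof (rule tendsto_0_if_eventually_le)
        show "0 \<le> ?n (t k - x)" for k by (intro dual.N_nonneg dual.mem t x)
        fix e :: real assume e: "0 < e"
        have "\<forall>\<^sub>F k in sequentially. ?n (t k - x) \<le> 13 * min (1/2) (e/13)"
          using e by (intro loc) auto
        then show "\<forall>\<^sub>F k in sequentially. ?n (t k - x) \<le> e" by (rule eventually_mono) auto
      qed
      then have "(\<lambda>k. r * ?n (t k - x)) \<longlonglongrightarrow> r * 0" by (intro tendsto_mult tendsto_const)
      moreover have "r * ?n (t k - x) = ?n (s k - f)" for k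
      proof -
        have "t k - x = a *\<^sub>C (s k - f)" unfolding t_def x_def by (rule cvec.scale_right_diff_distrib[symmetric])
        then show ?thesis using dual.N_scale[OF dual.mem(4)[OF s f], of a k] r a by (simp only:) simp
      qed
      ultimately show ?thesis by simp
    qed
    then show "(\<lambda>k. l2_sup A (s k - f)) \<longlonglongrightarrow> 0"
      by (intro l2_sup_tendsto_0[where A=A, OF A] dual.mem s f)
  qed
  with M(2)[symmetric] have "LUR_on ?X (dual_norm V M)"
    by (rule LUR_on_cong[OF subspace_cdual])
  with M(1) show thesis by (rule that)
qed

end

section \<open>The real interpolation space\<close>

lemma powr_convex_nonneg:
  fixes x y t p :: real
  assumes "0 \<le> x" "0 \<le> y" "0 \<le> t" "t \<le> 1" "1 \<le> p"
  shows "((1 - t) * x + t * y) powr p \<le> (1 - t) * x powr p + t * y powr p"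
proof -
  \<comment> \<open>Covers a zero argument: for \<open>s\<close> in the unit interval and exponent
    at least 1, \<open>s powr p \<le> s\<close>.\<close>
  have sub: "(s * z) powr p \<le> s * z powr p" if "0 \<le> s" "s \<le> 1" "0 \<le> z" for s z
  proof -
    have "s powr p \<le> s"
      using that assms(5) powr_mono'[of 1 p s] by (cases "s = 0") auto
    then show ?thesis using that by (simp add: powr_mult mult_right_mono)
  qed
  show ?thesis
  proof (cases "x = 0 \<or> y = 0")
    case True
    then show ?thesis using sub[of t y] sub[of "1 - t" x] assms by auto
  next
    case False
    then show ?thesis
      using convex_onD[OF powr_convex[OF assms(5)], of t x y] assms by simp
  qed
qed

text \<open>For nonnegative \<open>f\<close> and \<open>a\<close> this says that the p-norm of
  \<open>f\<close> is at most \<open>a\<close>. As an inequality between extended reals it includes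
  finiteness and takes no root.\<close>

definition Lp_le :: "'x measure \<Rightarrow> real \<Rightarrow> ('x \<Rightarrow> real) \<Rightarrow> real \<Rightarrow> bool" where
  "Lp_le M p f a \<longleftrightarrow> (\<integral>\<^sup>+x. ennreal (f x powr p) \<partial>M) \<le> ennreal (a powr p)"

lemma Lp_le_mono:
  assumes "Lp_le M p g a" "0 < p" "\<And>x. x \<in> space M \<Longrightarrow> 0 \<le> f x" "\<And>x. x \<in> space M \<Longrightarrow> f x \<le> g x"
  shows "Lp_le M p f a"
proof -
  have "(\<integral>\<^sup>+x. ennreal (f x powr p) \<partial>M) \<le> (\<integral>\<^sup>+x. ennreal (g x powr p) \<partial>M)"
    using assms(2-4) by (intro nn_integral_mono ennreal_leI powr_mono2) auto
  then show ?thesis using assms(1) unfolding Lp_le_def by (rule order_trans)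
qed

lemma Lp_le_mono2: "Lp_le M p f a \<Longrightarrow> 0 \<le> a \<Longrightarrow> a \<le> b \<Longrightarrow> 0 < p \<Longrightarrow> Lp_le M p f b"
  unfolding Lp_le_def by (erule order_trans) (intro ennreal_leI powr_mono2, auto)

lemma Lp_le_scale:
  assumes "Lp_le M p f a" "0 \<le> c" "0 \<le> a" "\<And>x. 0 \<le> f x" "f \<in> borel_measurable M"
  shows "Lp_le M p (\<lambda>x. c * f x) (c * a)"
proof -
  have "(\<integral>\<^sup>+x. ennreal ((c * f x) powr p) \<partial>M) = (\<integral>\<^sup>+x. ennreal (c powr p) * ennreal (f x powr p) \<partial>M)"
    using assms by (intro nn_integral_cong) (simp add: powr_mult ennreal_mult)
  also have "\<dots> = ennreal (c powr p) * (\<integral>\<^sup>+x. ennreal (f x powr p) \<partial>M)"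
    using assms(5) by (intro nn_integral_cmult) measurable
  also have "\<dots> \<le> ennreal (c powr p) * ennreal (a powr p)"
    using assms(1) unfolding Lp_le_def by (intro mult_left_mono) auto
  also have "\<dots> = ennreal ((c * a) powr p)"
    using assms by (simp add: powr_mult ennreal_mult)
  finally show ?thesis unfolding Lp_le_def .
qed

text \<open>Minkowski's inequality: \<open>(f + g) / (a + b)\<close> is a convex combination of \<open>f / a\<close> and \<open>g / b\<close>.\<close>

lemma Lp_le_add:
  assumes f: "Lp_le M p f a" and g: "Lp_le M p g b" and ab: "0 < a" "0 < b" and p: "1 \<le> p"
    and nn: "\<And>x. 0 \<le> f x" "\<And>x. 0 \<le> g x"
    and [measurable]: "f \<in> borel_measurable M" "g \<in> borel_measurable M"
  shows "Lp_le M p (\<lambda>x. f x + g x) (a + b)"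
proof -
  define t where "t = b / (a + b)"
  have t: "0 \<le> t" "t \<le> 1" "1 - t = a / (a + b)" using ab by (auto simp: t_def field_simps)
  have f1: "(\<integral>\<^sup>+x. ennreal ((1/a * f x) powr p) \<partial>M) \<le> 1"
    using Lp_le_scale[OF f, of "1/a"] ab nn by (simp add: Lp_le_def)
  have g1: "(\<integral>\<^sup>+x. ennreal ((1/b * g x) powr p) \<partial>M) \<le> 1"
    using Lp_le_scale[OF g, of "1/b"] ab nn by (simp add: Lp_le_def)
  have "(\<integral>\<^sup>+x. ennreal ((1/(a+b) * (f x + g x)) powr p) \<partial>M)
      \<le> (\<integral>\<^sup>+x. ennreal (1 - t) * ennreal ((1/a * f x) powr p) + ennreal t * ennreal ((1/b * g x) powr p) \<partial>M)"
  proof (rule nn_integral_mono)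
    fix x
    have "(1 - t) * (1/a * f x) = f x / (a+b)" "t * (1/b * g x) = g x / (a+b)"
      unfolding t(3) unfolding t_def using ab by simp_all
    then have "1/(a+b) * (f x + g x) = (1 - t) * (1/a * f x) + t * (1/b * g x)"
      by (simp add: add_divide_distrib)
    then have "(1/(a+b) * (f x + g x)) powr p \<le> (1 - t) * (1/a * f x) powr p + t * (1/b * g x) powr p"
      using powr_convex_nonneg[of "1/a * f x" "1/b * g x" t p] ab nn t p by simp
    then have "ennreal ((1/(a+b) * (f x + g x)) powr p)
        \<le> ennreal ((1 - t) * (1/a * f x) powr p + t * (1/b * g x) powr p)" by (rule ennreal_leI)
    also have "\<dots> = ennreal (1 - t) * ennreal ((1/a * f x) powr p) + ennreal t * ennreal ((1/b * g x) powr p)"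
      using t(1,2) by (simp add: ennreal_mult)
    finally show "ennreal ((1/(a+b) * (f x + g x)) powr p) \<le> \<dots>" .
  qed
  also have "\<dots> = ennreal (1 - t) * (\<integral>\<^sup>+x. ennreal ((1/a * f x) powr p) \<partial>M)
      + ennreal t * (\<integral>\<^sup>+x. ennreal ((1/b * g x) powr p) \<partial>M)"
    by (subst nn_integral_add, measurable) (simp add: nn_integral_cmult)
  also have "\<dots> \<le> ennreal (1 - t) * 1 + ennreal t * 1"
    using f1 g1 by (intro add_mono mult_left_mono) auto
  also have "\<dots> = 1" using t by (simp flip: ennreal_plus)
  finally have "Lp_le M p (\<lambda>x. 1/(a+b) * (f x + g x)) 1" by (simp add: Lp_le_def)
  from Lp_le_scale[OF this, of "a + b"] show ?thesis using ab nn by simp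
qed

text \<open>At each point only one of the functions is present, so p-th powers add; this improves on
  the bound \<open>a + b\<close> of the triangle inequality.\<close>

lemma Lp_le_disjoint:
  assumes f: "Lp_le M p f a" and g: "Lp_le M p g b" and ab: "0 \<le> a" "0 \<le> b" and p: "0 < p"
    and [measurable]: "f \<in> borel_measurable M" "g \<in> borel_measurable M" "A \<in> sets M"
  shows "Lp_le M p (\<lambda>x. if x \<in> A then f x else g x) ((a powr p + b powr p) powr (1 / p))"
proof -
  have "(\<integral>\<^sup>+x. ennreal ((if x \<in> A then f x else g x) powr p) \<partial>M)
      \<le> (\<integral>\<^sup>+x. ennreal (f x powr p) + ennreal (g x powr p) \<partial>M)"
    by (intro nn_integral_mono) auto
  also have "\<dots> = (\<integral>\<^sup>+x. ennreal (f x powr p) \<partial>M) + (\<integral>\<^sup>+x. ennreal (g x powr p) \<partial>M)"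
    by (subst nn_integral_add) auto
  also have "\<dots> \<le> ennreal (a powr p) + ennreal (b powr p)"
    using f g unfolding Lp_le_def by (rule add_mono)
  also have "\<dots> = ennreal (((a powr p + b powr p) powr (1 / p)) powr p)"
    using ab p by (simp add: powr_powr flip: ennreal_plus)
  finally show ?thesis unfolding Lp_le_def .
qed

text \<open>The measure dt/t on the positive half-line, extended by 0 so that functions on all reals
  can be used.\<close>

definition haar :: "real measure" where
  "haar = density lborel (\<lambda>t. ennreal (indicator {0<..} t / t))"

lemma space_haar [simp]: "space haar = UNIV" and sets_haar [measurable_cong, simp]: "sets haar = sets borel"
  by (simp_all add: haar_def)

lemma nn_integral_haar:
  assumes [measurable]: "f \<in> borel_measurable borel" and "\<And>t. 0 \<le> f t"
  shows "(\<integral>\<^sup>+t. ennreal (f t) \<partial>haar) = (\<integral>\<^sup>+t\<in>{0<..}. ennreal (f t / t) \<partial>lborel)"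
  unfolding haar_def
proof (subst nn_integral_density)
  show "(\<integral>\<^sup>+t. ennreal (indicator {0<..} t / t) * ennreal (f t) \<partial>lborel)
      = (\<integral>\<^sup>+t\<in>{0<..}. ennreal (f t / t) \<partial>lborel)"
    by (intro nn_integral_cong) (use assms(2) in \<open>auto simp: indicator_def simp flip: ennreal_mult\<close>)
qed auto

lemma emeasure_haar_le:
  assumes "0 < a" "a \<le> b"
  shows "emeasure haar {a..b} \<le> ennreal ((b - a) / a)" "ennreal ((b - a) / b) \<le> emeasure haar {a..b}"
proof -
  have eq: "emeasure haar {a..b} = (\<integral>\<^sup>+t. ennreal (1 / t) * indicator {a..b} t \<partial>lborel)"
    unfolding haar_def
    by (subst emeasure_density) (use assms in \<open>auto intro!: nn_integral_cong simp: indicator_def\<close>)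
  have c: "(\<integral>\<^sup>+t. ennreal (1 / c) * indicator {a..b} t \<partial>lborel) = ennreal ((b - a) / c)" if "0 < c" for c
    using assms that by (simp add: nn_integral_cmult_indicator flip: ennreal_mult)
  show "emeasure haar {a..b} \<le> ennreal ((b - a) / a)"
    unfolding eq c[OF assms(1), symmetric]
    by (intro nn_integral_mono) (use assms in \<open>auto simp: indicator_def frac_le intro!: ennreal_leI\<close>)
  show "ennreal ((b - a) / b) \<le> emeasure haar {a..b}"
    unfolding eq c[OF less_le_trans[OF assms], symmetric]
    by (intro nn_integral_mono) (use assms in \<open>auto simp: indicator_def frac_le intro!: ennreal_leI\<close>)
qed

section \<open>The K-functional and the norm of the interpolation space\<close>

locale interpolation =
  fixes j0 :: "'a::complex_banach \<Rightarrow> 'e::{complex_tvs,t2_space}"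
    and j1 :: "'b::complex_banach \<Rightarrow> 'e"
    and \<theta> p :: real
  assumes couple: "interpolation_couple j0 j1"
    and \<theta>: "0 < \<theta>" "\<theta> < 1" and p: "1 < p"
begin

sublocale j0: Vector_Spaces.linear scaleC scaleC j0
  using couple by (simp add: interpolation_couple_def)

sublocale j1: Vector_Spaces.linear scaleC scaleC j1
  using couple by (simp add: interpolation_couple_def)

abbreviation K :: "real \<Rightarrow> 'e \<Rightarrow> real" where "K \<equiv> K_functional j0 j1"
abbreviation X :: "'e set" where "X \<equiv> interp_space j0 j1 \<theta> p"
abbreviation N :: "'e \<Rightarrow> real" where "N \<equiv> interp_norm j0 j1 \<theta> p"

definition S :: "'e set" where "S = {v. \<exists>a b. v = j0 a + j1 b}"

lemma S_I [simp]: "j0 a + j1 b \<in> S" by (auto simp: S_def)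

lemma subspace_S: "cvec.subspace S"
proof (rule cvec.subspaceI)
  show "0 \<in> S" using S_I[of 0 0] by simp
next
  fix x y assume "x \<in> S" "y \<in> S"
  then obtain a b c d where "x = j0 a + j1 b" "y = j0 c + j1 d" unfolding S_def by blast
  then have "x + y = j0 (a + c) + j1 (b + d)" by (simp add: j0.add j1.add)
  then show "x + y \<in> S" by simp
next
  fix c x assume "x \<in> S"
  then obtain a b where "x = j0 a + j1 b" unfolding S_def by blast
  then have "c *\<^sub>C x = j0 (c *\<^sub>C a) + j1 (c *\<^sub>C b)"
    by (simp add: j0.scale j1.scale scaleC_add_right)
  then show "c *\<^sub>C x \<in> S" by simp
qed

lemma K_le: "0 \<le> t \<Longrightarrow> K t (j0 a + j1 b) \<le> norm a + t * norm b"
  unfolding K_functional_def by (rule cInf_lower) (auto intro!: bdd_belowI[of _ 0])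

lemma K_greatest:
  assumes "v \<in> S" "\<And>a b. v = j0 a + j1 b \<Longrightarrow> r \<le> norm a + t * norm b"
  shows "r \<le> K t v"
  unfolding K_functional_def by (rule cInf_greatest) (use assms in \<open>auto simp: S_def\<close>)

lemma K_nonneg: "v \<in> S \<Longrightarrow> 0 \<le> t \<Longrightarrow> 0 \<le> K t v"
  by (rule K_greatest) auto

lemma K_witness:
  assumes "v \<in> S" "K t v < r"
  obtains a b where "v = j0 a + j1 b" "norm a + t * norm b < r"
proof -
  have "\<not> (\<forall>a b. v = j0 a + j1 b \<longrightarrow> r \<le> norm a + t * norm b)"
    using K_greatest[OF assms(1), of r t] assms(2) by auto
  then show ?thesis using that by (auto simp: not_le)
qed

lemma K_mono:
  assumes "v \<in> S" "0 \<le> s" "s \<le> t" shows "K s v \<le> K t v"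
proof (rule K_greatest[OF assms(1)])
  fix a b assume v: "v = j0 a + j1 b"
  have "K s v \<le> norm a + s * norm b" unfolding v using assms by (intro K_le)
  also have "\<dots> \<le> norm a + t * norm b" using assms by (intro add_left_mono mult_right_mono) auto
  finally show "K s v \<le> norm a + t * norm b" .
qed

text \<open>Used to spread smallness of \<open>K 1 v\<close>, the norm of the sum space, to all
  \<open>t\<close> in a bounded interval.\<close>

lemma K_le_K1:
  assumes "v \<in> S" "0 \<le> t" shows "K t v \<le> max 1 t * K 1 v"
proof -
  have m: "0 < max 1 t" by simp
  have "K t v / max 1 t \<le> K 1 v"
  proof (rule K_greatest[OF assms(1)])
    fix a b assume v: "v = j0 a + j1 b"
    have "K t v \<le> norm a + t * norm b" unfolding v using assms by (intro K_le)
    also have "\<dots> \<le> max 1 t * norm a + max 1 t * norm b"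
      using mult_right_mono[of 1 "max 1 t" "norm a"] by (intro add_mono mult_right_mono) auto
    finally show "K t v / max 1 t \<le> norm a + 1 * norm b" using m by (simp add: field_simps)
  qed
  then show ?thesis using m by (simp add: field_simps)
qed

lemma K_add:
  assumes "v \<in> S" "w \<in> S" "0 \<le> t" shows "K t (v + w) \<le> K t v + K t w"
proof (rule field_le_epsilon)
  fix e :: real assume e: "0 < e"
  obtain a b where v: "v = j0 a + j1 b" "norm a + t * norm b < K t v + e/2"
    by (rule K_witness[OF assms(1), of t "K t v + e/2"]) (use e in auto)
  obtain c d where w: "w = j0 c + j1 d" "norm c + t * norm d < K t w + e/2"
    by (rule K_witness[OF assms(2), of t "K t w + e/2"]) (use e in auto)
  have vw: "v + w = j0 (a + c) + j1 (b + d)" unfolding v w by (simp add: j0.add j1.add)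
  have "K t (v + w) \<le> norm (a + c) + t * norm (b + d)" unfolding vw by (rule K_le[OF assms(3)])
  also have "\<dots> \<le> (norm a + norm c) + t * (norm b + norm d)"
    using assms(3) by (intro add_mono mult_left_mono norm_triangle_ineq) auto
  also have "\<dots> \<le> K t v + K t w + e" using v w by (simp add: algebra_simps)
  finally show "K t (v + w) \<le> K t v + K t w + e" .
qed

lemma K_scale:
  assumes v: "v \<in> S" and t: "0 \<le> t" shows "K t (c *\<^sub>C v) = cmod c * K t v"
proof -
  have K0: "K t 0 = 0" using K_le[OF t, of 0 0] K_nonneg[OF S_I[of 0 0] t] by simp
  show ?thesis
  proof (rule homogeneous_if_le[where q="K t", OF subspace_S v])
    fix c v assume v: "v \<in> S"
    show "K t (c *\<^sub>C v) \<le> cmod c * K t v"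
    proof (cases "c = 0")
      case False
      have "K t (c *\<^sub>C v) / cmod c \<le> K t v"
      proof (rule K_greatest[OF v])
        fix a b assume v: "v = j0 a + j1 b"
        have cv: "c *\<^sub>C v = j0 (c *\<^sub>C a) + j1 (c *\<^sub>C b)"
          unfolding v by (simp add: j0.scale j1.scale scaleC_add_right)
        have "K t (c *\<^sub>C v) \<le> norm (c *\<^sub>C a) + t * norm (c *\<^sub>C b)" unfolding cv by (rule K_le[OF t])
        then show "K t (c *\<^sub>C v) / cmod c \<le> norm a + t * norm b"
          using False by (simp add: norm_scaleC field_simps)
      qed
      then show ?thesis using False by (simp add: field_simps)
    qed (simp add: K0)
  qed (simp add: K0)
qed

text \<open>The only place where the topology of the ambient space matters: limits in it are unique.\<close>

lemma K_eq_0: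
  assumes v: "v \<in> S" and "K 1 v \<le> 0" shows "v = 0"
proof -
  have "\<exists>a b. v = j0 a + j1 b \<and> norm a + 1 * norm b < inverse (real (Suc n))" for n
  proof -
    have "K 1 v < inverse (real (Suc n))" using assms(2) by (rule le_less_trans) simp
    from K_witness[OF v this] show ?thesis by blast
  qed
  then obtain a b where ab: "\<And>n. v = j0 (a n) + j1 (b n)"
    "\<And>n. norm (a n) + 1 * norm (b n) < inverse (real (Suc n))" by metis
  have "norm (a n) \<le> inverse (real (Suc n))" "norm (b n) \<le> inverse (real (Suc n))" for n
    using ab(2)[of n] norm_ge_zero[of "a n"] norm_ge_zero[of "b n"] by linarith+
  then have "a \<longlonglongrightarrow> 0" "b \<longlonglongrightarrow> 0"
    by (auto intro!: Lim_null_comparison[OF _ LIMSEQ_inverse_real_of_nat] always_eventually)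
  moreover have "continuous_on UNIV j0" "continuous_on UNIV j1"
    using couple by (auto simp: interpolation_couple_def)
  ultimately have "(\<lambda>n. j0 (a n)) \<longlonglongrightarrow> j0 0" "(\<lambda>n. j1 (b n)) \<longlonglongrightarrow> j1 0"
    using continuous_on_tendsto_compose[of UNIV j0 a 0 sequentially]
      continuous_on_tendsto_compose[of UNIV j1 b 0 sequentially] by simp_all
  then have "(\<lambda>n. j0 (a n) + j1 (b n)) \<longlonglongrightarrow> j0 0 + j1 0" by (rule tendsto_add)
  then have "(\<lambda>n. v) \<longlonglongrightarrow> 0" unfolding ab(1)[symmetric] by simp
  then show ?thesis by (simp only: LIMSEQ_const_iff)
qed

definition G :: "'e \<Rightarrow> real \<Rightarrow> real" where
  "G v t = (if 0 < t then t powr (- \<theta>) * K t v else 0)"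

text \<open>\<open>K t v\<close> is monotone in \<open>t\<close>, monotone functions are Borel, and
  the value 0 for \<open>t \<le> 0\<close> keeps the extension monotone.\<close>

lemma G_measurable [measurable]: assumes "v \<in> S" shows "G v \<in> borel_measurable borel"
proof -
  have "mono (\<lambda>t. if 0 < t then K t v else 0)"
    using K_mono[OF assms] K_nonneg[OF assms] by (auto simp: mono_def)
  then have [measurable]: "(\<lambda>t. if 0 < t then K t v else 0) \<in> borel_measurable borel"
    by (rule borel_measurable_mono)
  have "G v = (\<lambda>t. t powr (- \<theta>) * (if 0 < t then K t v else 0))" by (auto simp: G_def)
  then show ?thesis by simp
qed

lemma G_measurable_haar [measurable]: "v \<in> S \<Longrightarrow> G v \<in> borel_measurable haar"
  unfolding measurable_cong_sets[OF sets_haar refl] by (rule G_measurable)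

lemma G_nonneg: "v \<in> S \<Longrightarrow> 0 \<le> G v t"
  by (simp add: G_def K_nonneg)

lemma G_add: "v \<in> S \<Longrightarrow> w \<in> S \<Longrightarrow> G (v + w) t \<le> G v t + G w t"
  using K_add[of v w t] by (auto simp: G_def distrib_left[symmetric] intro!: mult_left_mono)

lemma G_scale: "v \<in> S \<Longrightarrow> G (c *\<^sub>C v) t = cmod c * G v t"
  by (simp add: G_def K_scale)

lemma interp_integral_eq:
  assumes "v \<in> S"
  shows "interp_integral j0 j1 \<theta> p v = (\<integral>\<^sup>+t. ennreal (G v t powr p) \<partial>haar)"
proof -
  note [measurable] = G_measurable[OF assms]
  have "(\<integral>\<^sup>+t. ennreal (G v t powr p) \<partial>haar) = (\<integral>\<^sup>+t\<in>{0<..}. ennreal (G v t powr p / t) \<partial>lborel)"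
    by (rule nn_integral_haar) auto
  then show ?thesis
    unfolding interp_integral_def by (auto intro!: nn_integral_cong simp: G_def indicator_def)
qed

lemma X_S: "v \<in> X \<Longrightarrow> v \<in> S"
  by (auto simp: interp_space_def)

lemma N_nonneg: "0 \<le> N v" by (simp add: interp_norm_def)

lemma Lp_le_N:
  assumes "v \<in> X" shows "Lp_le haar p (G v) (N v)"
proof -
  have "interp_integral j0 j1 \<theta> p v < \<infinity>" using assms by (simp add: interp_space_def)
  then show ?thesis
    unfolding Lp_le_def interp_norm_def interp_integral_eq[OF X_S[OF assms], symmetric]
    using p by (simp add: powr_powr)
qed

lemma N_le_if_Lp_le:
  assumes v: "v \<in> S" and L: "Lp_le haar p (G v) a" and a: "0 \<le> a"
  shows "v \<in> X" "N v \<le> a"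
proof -
  have I: "interp_integral j0 j1 \<theta> p v \<le> ennreal (a powr p)"
    using L v by (simp add: interp_integral_eq Lp_le_def)
  then show "v \<in> X" using v by (auto simp: interp_space_def S_def intro: le_less_trans)
  have "enn2real (interp_integral j0 j1 \<theta> p v) \<le> a powr p"
    using enn2real_mono[OF I] by simp
  then have "N v \<le> (a powr p) powr (1 / p)"
    unfolding interp_norm_def using p by (intro powr_mono2) auto
  then show "N v \<le> a" using p a by (simp add: powr_powr)
qed

text \<open>\<open>K\<close> increases, so \<open>G v\<close> is at least \<open>c\<close> on
  \<open>{t..2 * t}\<close>, an interval of Haar measure at least 1/2. One factor 2 of the constant
  comes from this measure, the other from \<open>2 powr \<theta> \<le> 2\<close>.\<close>

lemma K_le_N:
  assumes v: "v \<in> X" and t: "0 < t"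
  shows "K t v \<le> 4 * t powr \<theta> * N v"
proof -
  note vS = X_S[OF v]
  define c where "c = (2 * t) powr (- \<theta>) * K t v"
  have c0: "0 \<le> c" using K_nonneg[OF vS] t by (simp add: c_def)
  have Gc: "c \<le> G v s" if "s \<in> {t..2 * t}" for s
    unfolding c_def G_def using that t \<theta> K_mono[OF vS, of t s] K_nonneg[OF vS, of t]
    by (auto intro!: mult_mono powr_mono2')
  have "(2 * t - t) / (2 * t) = 1/2" using t by simp
  then have "ennreal (c powr p * (1/2)) = ennreal (c powr p) * ennreal ((2 * t - t) / (2 * t))"
    by (simp only: ennreal_mult powr_ge_zero zero_le_divide_1_iff zero_le_numeral)
  also have "\<dots> \<le> ennreal (c powr p) * emeasure haar {t..2 * t}"
    using t by (intro mult_left_mono emeasure_haar_le) auto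
  also have "\<dots> = (\<integral>\<^sup>+s. ennreal (c powr p) * indicator {t..2 * t} s \<partial>haar)"
    by (subst nn_integral_cmult_indicator) auto
  also have "\<dots> \<le> (\<integral>\<^sup>+s. ennreal (G v s powr p) \<partial>haar)"
    using Gc c0 p by (intro nn_integral_mono) (auto simp: indicator_def intro!: ennreal_leI powr_mono2)
  also have "\<dots> \<le> ennreal (N v powr p)" using Lp_le_N[OF v] by (simp add: Lp_le_def)
  finally have "c powr p * (1/2) \<le> N v powr p" by (simp only: ennreal_le_iff powr_ge_zero)
  moreover have "(1/2) powr p \<le> (1/2::real)" using powr_mono'[of 1 p "1/2"] p by simp
  moreover have "(c * (1/2)) powr p = c powr p * (1/2) powr p" by (rule powr_mult)
  ultimately have "(c * (1/2)) powr p \<le> N v powr p"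
    using mult_left_mono[of "(1/2) powr p" "1/2" "c powr p"] by (metis order_trans powr_ge_zero)
  then have "c * (1/2) \<le> N v" using p c0 N_nonneg powr_less_mono2[of p "N v" "c * (1/2)"] by force
  then have "(2 * t) powr \<theta> * c \<le> (2 * t) powr \<theta> * (2 * N v)" by (intro mult_left_mono) auto
  moreover have "(2 * t) powr \<theta> * c = K t v" using t by (simp add: c_def powr_minus)
  moreover have "(2 * t) powr \<theta> * (2 * N v) \<le> 4 * t powr \<theta> * N v"
  proof -
    have "(2::real) powr \<theta> \<le> 2" using powr_mono[of \<theta> 1 "2::real"] \<theta> by simp
    then have "2 powr \<theta> * (t powr \<theta> * (2 * N v)) \<le> 2 * (t powr \<theta> * (2 * N v))"
      using N_nonneg by (intro mult_right_mono) auto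
    then show ?thesis using t by (simp add: powr_mult mult.assoc)
  qed
  ultimately show ?thesis by linarith
qed

lemma N_add: "v \<in> X \<Longrightarrow> w \<in> X \<Longrightarrow> v + w \<in> X \<and> N (v + w) \<le> N v + N w"
proof -
  assume v: "v \<in> X" and w: "w \<in> X"
  note S = X_S[OF v] X_S[OF w]
  have vwS: "v + w \<in> S" using subspace_S S by (rule cvec.subspace_add)
  \<comment> \<open>The slack \<open>e\<close> keeps both bounds positive, as
    \<open>Lp_le_add\<close> demands.\<close>
  have *: "v + w \<in> X \<and> N (v + w) \<le> N v + N w + e" if e: "0 < e" for e
  proof -
    have "Lp_le haar p (\<lambda>t. G v t + G w t) ((N v + e/2) + (N w + e/2))"
      by (rule Lp_le_add) (use S e N_nonneg p G_nonneg in
          \<open>auto intro!: Lp_le_mono2[OF Lp_le_N] v w add_nonneg_pos\<close>)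
    then have L: "Lp_le haar p (G (v + w)) ((N v + e/2) + (N w + e/2))"
      by (rule Lp_le_mono) (use p G_nonneg[OF vwS] G_add[OF S] in auto)
    have "0 \<le> (N v + e/2) + (N w + e/2)" using e N_nonneg[of v] N_nonneg[of w] by linarith
    from N_le_if_Lp_le[OF vwS L this] show ?thesis by (simp add: algebra_simps)
  qed
  have "N (v + w) \<le> N v + N w" by (rule field_le_epsilon) (use * in auto)
  then show ?thesis using *[of 1] by simp
qed

lemma N_scale_le:
  assumes v: "v \<in> X" shows "c *\<^sub>C v \<in> X" "N (c *\<^sub>C v) \<le> cmod c * N v"
proof -
  note S = X_S[OF v]
  have cS: "c *\<^sub>C v \<in> S" using subspace_S S by (rule cvec.subspace_scale)
  have "Lp_le haar p (\<lambda>t. cmod c * G v t) (cmod c * N v)"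
    by (rule Lp_le_scale[OF Lp_le_N[OF v]]) (use N_nonneg G_nonneg[OF S] S in auto)
  moreover have "G (c *\<^sub>C v) = (\<lambda>t. cmod c * G v t)" by (rule ext) (rule G_scale[OF S])
  ultimately have L: "Lp_le haar p (G (c *\<^sub>C v)) (cmod c * N v)" by (simp only:)
  show "c *\<^sub>C v \<in> X" "N (c *\<^sub>C v) \<le> cmod c * N v"
    by (rule N_le_if_Lp_le[OF cS L]; simp add: N_nonneg)+
qed

sublocale cnormed X N
proof
  have zero: "0 \<in> X" "N 0 \<le> 0"
  proof -
    have "G 0 = (\<lambda>t. 0)"
      using K_scale[of 0 _ 0] cvec.subspace_0[OF subspace_S] by (intro ext) (simp add: G_def)
    then have "Lp_le haar p (G 0) 0" by (simp add: Lp_le_def)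
    then show "0 \<in> X" "N 0 \<le> 0"
      using N_le_if_Lp_le[OF cvec.subspace_0[OF subspace_S]] by auto
  qed
  show subX: "cvec.subspace X"
    by (rule cvec.subspaceI) (use zero N_add N_scale_le in auto)
  show "cnorm_on X N"
    unfolding cnorm_on_def
  proof (intro conjI ballI allI)
    fix v assume v: "v \<in> X"
    show "(N v = 0) = (v = 0)"
    proof
      assume "N v = 0"
      then have "K 1 v \<le> 0" using K_le_N[OF v, of 1] by simp
      then show "v = 0" by (rule K_eq_0[OF X_S[OF v]])
    next
      assume "v = 0"
      then show "N v = 0" using zero(2) N_nonneg[of 0] by simp
    qed
    show "N (c *\<^sub>C v) = cmod c * N v" for c
      by (rule homogeneous_if_le[where q=N, OF subX v N_nonneg N_scale_le(2)])
  qed (use N_add N_nonneg in auto)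
qed

end

section \<open>Weakly null sequences in the interpolation space\<close>

text \<open>Triples of vectors will be the carrier on which Hahn-Banach splits a functional.\<close>

instantiation prod :: (complex_vector, complex_vector) complex_vector
begin

definition scaleC_prod :: "complex \<Rightarrow> 'a \<times> 'b \<Rightarrow> 'a \<times> 'b"
  where "scaleC_prod c x = (c *\<^sub>C fst x, c *\<^sub>C snd x)"

instance
  by standard (simp_all add: scaleC_prod_def prod_eq_iff scaleC_add_right scaleC_add_left
      scaleC_scaleC scaleC_one)

end

lemma scaleC_Pair: "c *\<^sub>C (x, y) = (c *\<^sub>C x, c *\<^sub>C y)"
  by (simp add: scaleC_prod_def)

lemma norm_triple_mono:
  fixes a b c a' b' c' :: real
  assumes "0 \<le> a" "a \<le> a'" "0 \<le> b" "b \<le> b'" "0 \<le> c" "c \<le> c'"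
  shows "norm (a, b, c) \<le> norm (a', b', c')"
  using assms by (auto simp: norm_Pair intro!: real_sqrt_le_mono add_mono power_mono)

lemma norm_triple_sq: "(norm (a, b, c))\<^sup>2 = a\<^sup>2 + b\<^sup>2 + (c::real)\<^sup>2" for a b :: real
  by (simp add: norm_Pair)

lemma norm_triple_ge:
  fixes a b c :: real
  shows "\<bar>a\<bar> \<le> norm (a, b, c)" "\<bar>b\<bar> \<le> norm (a, b, c)" "\<bar>c\<bar> \<le> norm (a, b, c)"
  using norm_fst_le[of a "(b, c)"] norm_snd_le[of "(b, c)" a] norm_fst_le[of b c] norm_snd_le[of c b]
  by auto

text \<open>Serves to pass to dual norms one variable at a time while the others stay fixed; the
  factor \<open>x\<close> may be 0.\<close>

lemma (in cnormed) dual_norm_mult_le: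
  assumes "0 \<le> x" "\<And>v. v \<in> V \<Longrightarrow> N v \<le> 1 \<Longrightarrow> x * cmod (f v) \<le> B"
  shows "x * dual_norm V N f \<le> B"
proof (cases "x = 0")
  case True
  then show ?thesis using assms(2)[of 0] by simp
next
  case False
  then have x: "0 < x" using assms(1) by simp
  have "dual_norm V N f \<le> B / x"
    by (rule dual_norm_least) (use assms(2) x in \<open>simp add: field_simps\<close>)
  then show ?thesis using x by (simp add: field_simps)
qed

context interpolation
begin

text \<open>If \<open>K 1 v\<close> is small then \<open>G v\<close> lives where \<open>G u\<close> is negligible, so the two behave like
  disjointly supported elements of \<open>L\<^sup>p\<close>.\<close>

lemma almost_disjoint:
  assumes u: "u \<in> X" "N u \<le> 1" and s: "0 < s" and e: "0 < e"
  obtains \<kappa> where "0 < \<kappa>" "\<And>v. v \<in> X \<Longrightarrow> N v \<le> 1 \<Longrightarrow> K 1 v \<le> \<kappa> \<Longrightarrow>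
    N (u + complex_of_real s *\<^sub>C v) \<le> (1 + s powr p) powr (1 / p) + e"
proof -
  note uS = X_S[OF u(1)]
  note [measurable] = G_measurable_haar[OF uS]
  have p0: "0 < p" "1 \<le> p" using p by auto
  \<comment> \<open>These sets exhaust the positive half-line, so by dominated convergence the part
    of \<open>G u\<close> outside some \<open>A n\<close> is small in Lp.\<close>
  define A where "A n = {1 / real (Suc n)..real (Suc n)}" for n
  have [measurable]: "A n \<in> sets haar" for n by (simp add: A_def)
  have Gu: "Lp_le haar p (G u) 1" using Lp_le_mono2[OF Lp_le_N[OF u(1)]] u N_nonneg p0 by auto
  have "(\<lambda>n. \<integral>\<^sup>+t. ennreal ((if t \<in> A n then 0 else G u t) powr p) \<partial>haar) \<longlonglongrightarrow> (\<integral>\<^sup>+t. 0 \<partial>haar)"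
  proof (rule nn_integral_dominated_convergence[where w = "\<lambda>t. ennreal (G u t powr p)"])
    show "AE t in haar. ennreal ((if t \<in> A j then 0 else G u t) powr p) \<le> ennreal (G u t powr p)" for j
      by (rule AE_I2) auto
    show "(\<integral>\<^sup>+t. ennreal (G u t powr p) \<partial>haar) < \<infinity>"
      using Gu unfolding Lp_le_def by (rule le_less_trans) simp
    show "AE t in haar. (\<lambda>n. ennreal ((if t \<in> A n then 0 else G u t) powr p)) \<longlonglongrightarrow> 0"
    proof (rule AE_I2)
      fix t
      have "\<forall>\<^sub>F n in sequentially. (if t \<in> A n then 0 else G u t) = 0"
      proof (cases "0 < t")
        case True
        obtain m where m: "max t (1 / t) < real m" using reals_Archimedean2 by blast
        have "t \<in> A n" if "m \<le> n" for n
        proof -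
          have "max t (1 / t) < real (Suc n)" using m that by linarith
          then show ?thesis using True by (simp add: A_def field_simps)
        qed
        then show ?thesis by (auto simp: eventually_sequentially)
      qed (simp add: G_def)
      then have "\<forall>\<^sub>F n in sequentially. ennreal ((if t \<in> A n then 0 else G u t) powr p) = 0"
        by (rule eventually_mono) simp
      then show "(\<lambda>n. ennreal ((if t \<in> A n then 0 else G u t) powr p)) \<longlonglongrightarrow> 0"
        by (rule tendsto_eventually)
    qed
  qed measurable
  then have "\<forall>\<^sub>F n in sequentially. (\<integral>\<^sup>+t. ennreal ((if t \<in> A n then 0 else G u t) powr p) \<partial>haar)
      < ennreal ((e/2) powr p)"
    using e by (intro order_tendstoD(2)) auto
  then obtain n where n: "(\<integral>\<^sup>+t. ennreal ((if t \<in> A n then 0 else G u t) powr p) \<partial>haar)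
      < ennreal ((e/2) powr p)" by (auto simp: eventually_sequentially)
  have outer: "Lp_le haar p (\<lambda>t. if t \<in> A n then 0 else G u t) (e/2)"
    unfolding Lp_le_def using n by (rule less_imp_le)
  define m where "m = real (Suc n)"
  have m: "1 \<le> m" by (simp add: m_def)
  have m0: "0 < m" using m by linarith
  \<comment> \<open>On \<open>A n\<close> one factor \<open>m\<close> bounds
    \<open>t powr (- \<theta>)\<close> and another bounds \<open>max 1 t\<close>; the measure of
    \<open>A n\<close> is at most \<open>m\<^sup>2\<close>. Dividing by \<open>m ^ 4\<close> and by
    \<open>max 1 s\<close> for the scaling leaves \<open>e / 2\<close>.\<close>
  define \<kappa> where "\<kappa> = e / (2 * m ^ 4 * max 1 s)"
  show thesis
  proof (rule that)
    show "0 < \<kappa>" using e m0 by (simp add: \<kappa>_def)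
    fix v assume v: "v \<in> X" "N v \<le> 1" "K 1 v \<le> \<kappa>"
    note vS = X_S[OF v(1)]
    note [measurable] = G_measurable_haar[OF vS]
    have Gv: "Lp_le haar p (G v) 1" using Lp_le_mono2[OF Lp_le_N[OF v(1)]] v N_nonneg p0 by auto
    have sGv: "Lp_le haar p (\<lambda>t. s * G v t) (s * 1)"
      using s G_nonneg[OF vS] by (intro Lp_le_scale[OF Gv]) auto
    have K1: "0 \<le> K 1 v" using K_nonneg[OF vS] by simp
    have bound: "s * G v t \<le> m\<^sup>2 * (max 1 s * \<kappa>)" if t: "t \<in> A n" for t
    proof -
      have t': "1 / m \<le> t" "t \<le> m" "0 < t"
        using t m0 by (auto simp: A_def m_def intro: less_le_trans[of 0 "1 / m"])
      have "t powr (- \<theta>) \<le> (1 / m) powr (- \<theta>)"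
        using t' m0 \<theta> by (intro powr_mono2') auto
      also have "\<dots> = m powr \<theta>" using m0 by (simp add: powr_divide powr_minus)
      also have "\<dots> \<le> m powr 1" using m \<theta> by (intro powr_mono) auto
      finally have 1: "t powr (- \<theta>) \<le> m" using m0 by simp
      have "K t v \<le> max 1 t * K 1 v" using t' by (intro K_le_K1[OF vS]) auto
      also have "\<dots> \<le> m * \<kappa>" using t' m v(3) K1 by (intro mult_mono) auto
      finally have "t powr (- \<theta>) * K t v \<le> m * (m * \<kappa>)"
        using 1 m0 K_nonneg[OF vS, of t] t' by (intro mult_mono) auto
      then have "s * (t powr (- \<theta>) * K t v) \<le> max 1 s * (m * (m * \<kappa>))"
        by (rule mult_mono[rotated]) (use s K_nonneg[OF vS, of t] t' in auto)
      then show ?thesis using t' by (simp add: G_def power2_eq_square mult_ac)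
    qed
    have inner: "Lp_le haar p (\<lambda>t. if t \<in> A n then s * G v t else 0) (e/2)"
      unfolding Lp_le_def
    proof -
      define b where "b = m\<^sup>2 * (max 1 s * \<kappa>)"
      have b0: "0 \<le> b" using \<open>0 < \<kappa>\<close> by (simp add: b_def)
      have "(\<integral>\<^sup>+t. ennreal ((if t \<in> A n then s * G v t else 0) powr p) \<partial>haar)
          \<le> (\<integral>\<^sup>+t. ennreal (b powr p) * indicator (A n) t \<partial>haar)"
      proof (rule nn_integral_mono)
        fix t
        show "ennreal ((if t \<in> A n then s * G v t else 0) powr p) \<le> ennreal (b powr p) * indicator (A n) t"
          using bound[of t] G_nonneg[OF vS, of t] s p0
          by (auto simp: b_def intro!: ennreal_leI powr_mono2)
      qed
      also have "\<dots> = ennreal (b powr p) * emeasure haar (A n)"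
        by (rule nn_integral_cmult_indicator) (simp add: A_def)
      also have "\<dots> \<le> ennreal (b powr p) * ennreal ((m - 1 / m) / (1 / m))"
      proof (intro mult_left_mono)
        have "1 / m \<le> 1" using m by simp
        then have "1 / m \<le> m" using m by linarith
        then show "emeasure haar (A n) \<le> ennreal ((m - 1 / m) / (1 / m))"
          unfolding A_def m_def[symmetric] using m0 by (intro emeasure_haar_le) auto
      qed simp
      also have "\<dots> \<le> ennreal (b powr p) * ennreal ((m\<^sup>2) powr p)"
      proof (intro mult_left_mono ennreal_leI)
        have "(m - 1 / m) / (1 / m) \<le> m\<^sup>2" using m0 by (simp add: field_simps power2_eq_square)
        also have "m\<^sup>2 = (m\<^sup>2) powr 1" using m0 by simp
        also have "\<dots> \<le> (m\<^sup>2) powr p" using m p0 by (intro powr_mono) (auto simp: one_le_power)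
        finally show "(m - 1 / m) / (1 / m) \<le> (m\<^sup>2) powr p" .
      qed simp
      also have "\<dots> = ennreal ((b * m\<^sup>2) powr p)"
        by (subst ennreal_mult[symmetric]) (auto simp: powr_mult)
      also have "b * m\<^sup>2 = e/2" using m0 by (simp add: b_def \<kappa>_def field_simps power2_eq_square power4_eq_xxxx)
      finally show "(\<integral>\<^sup>+t. ennreal ((if t \<in> A n then s * G v t else 0) powr p) \<partial>haar) \<le> ennreal ((e/2) powr p)" .
    qed
    define r where "r = (1 powr p + (s * 1) powr p) powr (1 / p)"
    have "0 < 1 + s powr p" by (rule add_pos_nonneg) auto
    then have r0: "0 < r" by (simp add: r_def)
    \<comment> \<open>\<open>G u\<close> inside \<open>A n\<close> and \<open>s * G v\<close>
      outside are disjointly supported; the two leftovers are the small \<open>outer\<close> and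
      \<open>inner\<close>.\<close>
    have main: "Lp_le haar p (\<lambda>t. if t \<in> A n then G u t else s * G v t) r"
      unfolding r_def using s p0 by (intro Lp_le_disjoint[OF Gu sGv]) (auto simp: A_def)
    have meas: "(\<lambda>t. if t \<in> A n then 0 else G u t) \<in> borel_measurable haar"
      "(\<lambda>t. if t \<in> A n then s * G v t else 0) \<in> borel_measurable haar"
      "(\<lambda>t. if t \<in> A n then G u t else s * G v t) \<in> borel_measurable haar"
      by measurable
    have small: "Lp_le haar p (\<lambda>t. (if t \<in> A n then 0 else G u t) + (if t \<in> A n then s * G v t else 0)) (e/2 + e/2)"
      using outer inner by (rule Lp_le_add) (use e p0 s G_nonneg uS vS meas in \<open>auto intro!: borel_measurable_add\<close>)
    have sum: "Lp_le haar p (\<lambda>t. (if t \<in> A n then G u t else s * G v t)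
        + ((if t \<in> A n then 0 else G u t) + (if t \<in> A n then s * G v t else 0))) (r + (e/2 + e/2))"
      using main small by (rule Lp_le_add) (use r0 e p0 s G_nonneg uS vS meas in \<open>auto intro!: borel_measurable_add\<close>)
    define w where "w = complex_of_real s *\<^sub>C v"
    have wS: "w \<in> S" unfolding w_def using subspace_S vS by (rule cvec.subspace_scale)
    have uwS: "u + w \<in> S" using subspace_S uS wS by (rule cvec.subspace_add)
    have "Lp_le haar p (G (u + w)) (r + (e/2 + e/2))"
    proof (rule Lp_le_mono[OF sum])
      fix t
      have "G (u + w) t \<le> G u t + s * G v t"
        using G_add[OF uS wS, of t] s by (simp add: w_def G_scale[OF vS])
      then show "G (u + w) t \<le> (if t \<in> A n then G u t else s * G v t)
        + ((if t \<in> A n then 0 else G u t) + (if t \<in> A n then s * G v t else 0))" by simp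
    qed (use p0 G_nonneg[OF uwS] in auto)
    from N_le_if_Lp_le(2)[OF uwS this] r0 e
    show "N (u + complex_of_real s *\<^sub>C v) \<le> (1 + s powr p) powr (1 / p) + e"
      by (simp add: w_def r_def)
  qed
qed

text \<open>Adding a rotated \<open>s\<close>-multiple of \<open>v\<close> to a nearly norming
  \<open>u\<close> raises the value of \<open>f\<close> by \<open>s * cmod (f v)\<close>, but the
  norm by at most about \<open>s powr p\<close>. That is of smaller order in \<open>s\<close>
  because \<open>1 < p\<close>, so \<open>f v\<close> must be small.\<close>

lemma weakly_null:
  assumes f: "f \<in> cdual X N" and \<delta>: "0 < \<delta>"
  obtains \<kappa> where "0 < \<kappa>" "\<And>v. v \<in> X \<Longrightarrow> N v \<le> 1 \<Longrightarrow> K 1 v \<le> \<kappa> \<Longrightarrow> cmod (f v) \<le> \<delta>"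
proof (cases "dual_norm X N f = 0")
  case True
  have "cmod (f v) \<le> \<delta>" if "v \<in> X" for v
    using dual_norm_bound[OF f that] True \<delta> by simp
  then show ?thesis using that[of 1] by auto
next
  case False
  define F where "F = dual_norm X N f"
  have F: "0 < F" using False dual_norm_nonneg[OF f] by (simp add: F_def)
  \<comment> \<open>Chosen to make \<open>s powr (p - 1) \<le> \<delta> / (2 * F)\<close>, so that
    the norm growth \<open>F * s powr p\<close> uses at most half of
    \<open>s * \<delta>\<close>.\<close>
  define s where "s = min 1 ((\<delta> / (2 * F)) powr (1 / (p - 1)))"
  have s: "0 < s" using F \<delta> by (simp add: s_def)
  have "s powr (p - 1) \<le> ((\<delta> / (2 * F)) powr (1 / (p - 1))) powr (p - 1)"
    using s p by (intro powr_mono2) (auto simp: s_def)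
  also have "\<dots> = \<delta> / (2 * F)" using p F \<delta> by (simp add: powr_powr)
  finally have "s * s powr (p - 1) \<le> s * (\<delta> / (2 * F))" using s by (intro mult_left_mono) auto
  moreover have "s * s powr (p - 1) = s powr p" using s powr_add[of s 1 "p - 1"] by simp
  ultimately have sp: "F * s powr p \<le> s * \<delta> / 2"
    using F mult_left_mono[of "s powr p" "s * (\<delta> / (2 * F))" F] by (simp add: field_simps)
  \<comment> \<open>Error budget: \<gamma> for the norm growth and a third of it each for near
    norming and for \<open>almost_disjoint\<close>; the total stays below
    \<open>2 * \<gamma> = s * \<delta>\<close>.\<close>
  define \<gamma> where "\<gamma> = s * \<delta> / 2"
  have \<gamma>: "0 < \<gamma>" using s \<delta> by (simp add: \<gamma>_def)
  have "F - \<gamma> / 3 < dual_norm X N f" using \<gamma> by (simp add: F_def)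
  from dual_norm_witness[OF f this] obtain u0 where u0: "u0 \<in> X" "N u0 \<le> 1" "F - \<gamma> / 3 < cmod (f u0)" by blast
  obtain d where d: "cmod d = 1" "d * f u0 = complex_of_real (cmod (f u0))" by (rule unimodular_rotation)
  define u where "u = d *\<^sub>C u0"
  have u: "u \<in> X" "N u \<le> 1" "f u = complex_of_real (cmod (f u0))"
    using u0 d by (auto simp: u_def dual_scale[OF f])
  have e: "0 < \<gamma> / (3 * F)" using \<gamma> F by simp
  obtain \<kappa> where \<kappa>: "0 < \<kappa>" "\<And>v. v \<in> X \<Longrightarrow> N v \<le> 1 \<Longrightarrow> K 1 v \<le> \<kappa> \<Longrightarrow>
    N (u + complex_of_real s *\<^sub>C v) \<le> (1 + s powr p) powr (1 / p) + \<gamma> / (3 * F)"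
    using almost_disjoint[OF u(1,2) s e] by blast
  have "(1 + s powr p) powr (1 / p) \<le> (1 + s powr p) powr 1" using p by (intro powr_mono) auto
  then have root: "(1 + s powr p) powr (1 / p) \<le> 1 + s powr p" by (simp add: add_nonneg_nonneg)
  show ?thesis
  proof (rule that[OF \<kappa>(1)])
    fix v assume v: "v \<in> X" "N v \<le> 1" "K 1 v \<le> \<kappa>"
    obtain c where c: "cmod c = 1" "c * f v = complex_of_real (cmod (f v))" by (rule unimodular_rotation)
    have cv: "c *\<^sub>C v \<in> X" "N (c *\<^sub>C v) \<le> 1" "K 1 (c *\<^sub>C v) \<le> \<kappa>"
      using v c K_scale[OF X_S[OF v(1)], of 1 c] by auto
    define z where "z = u + complex_of_real s *\<^sub>C c *\<^sub>C v"
    have z: "z \<in> X" unfolding z_def by (intro mem u cv)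
    have "f z = f u + complex_of_real s * (c * f v)"
      unfolding z_def dual_add[OF f u(1) mem(3)[OF cv(1)]] dual_scale[OF f cv(1)] dual_scale[OF f v(1)] ..
    also have "\<dots> = complex_of_real (cmod (f u0) + s * cmod (f v))"
      unfolding c u by simp
    finally have "cmod (f z) = cmod (f u0) + s * cmod (f v)"
      using s by (simp only: norm_of_real) simp
    moreover have "cmod (f z) \<le> F * N z" unfolding F_def by (rule dual_norm_bound[OF f z])
    moreover have "F * N z \<le> F * (1 + s powr p + \<gamma> / (3 * F))"
      using \<kappa>(2)[OF cv] root F unfolding z_def by (intro mult_left_mono) auto
    moreover have "F * (1 + s powr p + \<gamma> / (3 * F)) = F + F * s powr p + \<gamma> / 3"
      using F by (simp add: field_simps)
    ultimately have "s * cmod (f v) \<le> \<gamma> + \<gamma> / 3 + \<gamma> / 3" using u0(3) sp \<gamma>_def by linarith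
    also have "\<dots> \<le> 2 * \<gamma>" using \<gamma> by simp
    also have "2 * \<gamma> = s * \<delta>" by (simp add: \<gamma>_def)
    finally show "cmod (f v) \<le> \<delta>" using s by simp
  qed
qed

end

section \<open>Decomposition of functionals\<close>

context interpolation
begin

context
  fixes M0 :: "'a \<Rightarrow> real"
  assumes M0: "equivalent_norm_on (UNIV :: 'a set) norm M0"
begin

interpretation m: cnormed "UNIV :: 'a set" M0
  by (rule cnormed.intro) (use M0 in \<open>simp_all add: equivalent_norm_on_def cvec.subspace_UNIV\<close>)

interpretation b: cnormed "UNIV :: 'b set" norm
  by (rule cnormed_UNIV)

text \<open>Asking for one splitting in the Euclidean unit ball, rather than for an infimum at most
  1, does not change suprema of bounded functionals. The entry \<open>N v\<close> makes this a test
  set.\<close>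

definition ball_set :: "real \<Rightarrow> 'e set" where
  "ball_set \<kappa> = {v \<in> X. \<exists>a b. v = j0 a + j1 b \<and> norm (N v, \<kappa> * M0 a, \<kappa> * norm b) \<le> 1}"

lemma test_set_ball_set: "test_set (ball_set \<kappa>)"
proof -
  have "0 \<in> ball_set \<kappa>" unfolding ball_set_def
    by (intro CollectI conjI exI[of _ 0]) auto
  moreover have "N v \<le> 1" if "v \<in> ball_set \<kappa>" for v
    using that norm_triple_ge(1)[of "N v"] N_nonneg[of v] unfolding ball_set_def
    by (auto simp: abs_of_nonneg intro: order_trans)
  ultimately show ?thesis by (auto simp: test_set_def ball_set_def)
qed

lemma ball_set_bound:
  assumes f: "f \<in> cdual X N" and \<kappa>: "0 < \<kappa>" and v: "v \<in> X" "v = j0 a + j1 b"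
  shows "cmod (f v) \<le> sup_on (ball_set \<kappa>) f * norm (N v, \<kappa> * M0 a, \<kappa> * norm b)"
proof -
  define T where "T = norm (N v, \<kappa> * M0 a, \<kappa> * norm b)"
  show ?thesis
  proof (cases "T = 0")
    case True
    then have "N v = 0" by (simp add: T_def zero_prod_def)
    then have "v = 0" using N_eq_0[OF v(1)] by simp
    then show ?thesis unfolding T_def[symmetric] using True by (simp add: dual_0[OF f])
  next
    case False
    then have T: "0 < T" by (simp add: T_def)
    define c where "c = complex_of_real (1 / T)"
    have c: "cmod c = 1 / T" using T by (simp add: c_def norm_divide)
    have "c *\<^sub>C v \<in> ball_set \<kappa>"
      unfolding ball_set_def
    proof (intro CollectI conjI exI)
      show "c *\<^sub>C v \<in> X" using v by simp
      show "c *\<^sub>C v = j0 (c *\<^sub>C a) + j1 (c *\<^sub>C b)"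
        unfolding v(2) by (simp add: j0.scale j1.scale scaleC_add_right)
      have eq: "(N (c *\<^sub>C v), \<kappa> * M0 (c *\<^sub>C a), \<kappa> * norm (c *\<^sub>C b))
          = (1 / T) *\<^sub>R (N v, \<kappa> * M0 a, \<kappa> * norm b)"
        using v(1) c by (simp add: norm_scaleC)
      show "norm (N (c *\<^sub>C v), \<kappa> * M0 (c *\<^sub>C a), \<kappa> * norm (c *\<^sub>C b)) \<le> 1"
        unfolding eq norm_scaleR T_def[symmetric] using T by simp
    qed
    from sup_on_upper[OF test_set_ball_set f this] have "cmod (f v) / T \<le> sup_on (ball_set \<kappa>) f"
      by (simp add: dual_scale[OF f v(1)] norm_mult c)
    then show ?thesis using T by (simp add: T_def[symmetric] field_simps)
  qed
qed

text \<open>Hahn-Banach on \<open>X \<times> B\<^sub>0 \<times> B\<^sub>1\<close>: the dual ball of an intersection of norms is a sum of dual balls.\<close>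

lemma decomposition:
  assumes f: "f \<in> cdual X N" and \<kappa>: "0 < \<kappa>"
  obtains f1 h0 h1 where "f1 \<in> cdual X N" "h0 \<in> cdual UNIV M0" "h1 \<in> cdual UNIV norm"
    "\<And>v a b. v \<in> X \<Longrightarrow> v = j0 a + j1 b \<Longrightarrow> f v = f1 v + h0 a + h1 b"
    "norm (dual_norm X N f1, dual_norm UNIV M0 h0 / \<kappa>, dual_norm UNIV norm h1 / \<kappa>)
      \<le> sup_on (ball_set \<kappa>) f"
proof -
  define c where "c = sup_on (ball_set \<kappa>) f"
  have c: "0 \<le> c" unfolding c_def by (rule sup_on_nonneg[OF test_set_ball_set f])
  define U :: "('e \<times> 'a \<times> 'b) set" where "U = X \<times> UNIV"
  \<comment> \<open>The graph of the sum map, on which the functional of three variables has to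
    coincide with \<open>f\<close>.\<close>
  define W :: "('e \<times> 'a \<times> 'b) set" where "W = {z \<in> U. fst z = j0 (fst (snd z)) + j1 (snd (snd z))}"
  define T :: "('e \<times> 'a \<times> 'b) \<Rightarrow> real \<times> real \<times> real" where
    "T z = (N (fst z), \<kappa> * M0 (fst (snd z)), \<kappa> * norm (snd (snd z)))" for z
  have U: "cvec.subspace U"
    by (rule cvec.subspaceI) (auto simp: U_def zero_prod_def scaleC_prod_def)
  have W: "cvec.subspace W"
  proof (rule cvec.subspaceI)
    show "0 \<in> W" by (auto simp: W_def U_def zero_prod_def)
    show "y + z \<in> W" if "y \<in> W" "z \<in> W" for y z
      using that by (auto simp: W_def U_def j0.add j1.add)
    show "d *\<^sub>C z \<in> W" if "z \<in> W" for d z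
      using that mem(3)[of "fst z" d]
      by (auto simp: W_def U_def scaleC_prod_def j0.scale j1.scale scaleC_add_right)
  qed
  have "\<exists>F. (\<forall>y\<in>U. \<forall>z\<in>U. F (y + z) = F y + F z) \<and> (\<forall>d. \<forall>z\<in>U. F (d *\<^sub>C z) = d * F z) \<and>
    (\<forall>z\<in>U. cmod (F z) \<le> c * norm (T z)) \<and> (\<forall>z\<in>W. F z = f (fst z))"
  proof (rule hahn_banach[OF U W, of "\<lambda>z. c * norm (T z)" "\<lambda>z. f (fst z)"])
    show "W \<subseteq> U" by (auto simp: W_def)
    fix y z assume yz: "y \<in> U" "z \<in> U"
    have "norm (T (y + z)) \<le> norm (N (fst y) + N (fst z), \<kappa> * M0 (fst (snd y)) + \<kappa> * M0 (fst (snd z)),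
        \<kappa> * norm (snd (snd y)) + \<kappa> * norm (snd (snd z)))"
      unfolding T_def distrib_left[symmetric]
      by (rule norm_triple_mono)
        (use yz \<kappa> in \<open>auto simp: U_def intro!: mult_left_mono N_triangle m.N_triangle norm_triangle_ineq\<close>)
    also have "\<dots> = norm (T y + T z)" by (simp add: T_def)
    also have "\<dots> \<le> norm (T y) + norm (T z)" by (rule norm_triangle_ineq)
    finally show "c * norm (T (y + z)) \<le> c * norm (T y) + c * norm (T z)"
      using c by (simp add: mult_left_mono flip: distrib_left)
  next
    fix d z assume z: "z \<in> U"
    have "T (d *\<^sub>C z) = cmod d *\<^sub>R T z"
      using z by (auto simp: T_def U_def scaleC_prod_def norm_scaleC)
    then show "c * norm (T (d *\<^sub>C z)) = cmod d * (c * norm (T z))" by simp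
  next
    fix y z assume "y \<in> W" "z \<in> W"
    then show "f (fst (y + z)) = f (fst y) + f (fst z)"
      by (auto simp: W_def U_def dual_add[OF f])
  next
    fix d z assume "z \<in> W"
    then show "f (fst (d *\<^sub>C z)) = d * f (fst z)"
      by (auto simp: W_def U_def scaleC_prod_def dual_scale[OF f])
  next
    fix z assume "z \<in> W"
    then show "cmod (f (fst z)) \<le> c * norm (T z)"
      unfolding c_def T_def by (intro ball_set_bound[OF f \<kappa>]) (auto simp: W_def U_def)
  next
    fix F assume "\<And>y z. y \<in> U \<Longrightarrow> z \<in> U \<Longrightarrow> F (y + z) = F y + F z"
      "\<And>d z. z \<in> U \<Longrightarrow> F (d *\<^sub>C z) = d * F z" "\<And>z. z \<in> U \<Longrightarrow> cmod (F z) \<le> c * norm (T z)"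
      "\<And>z. z \<in> W \<Longrightarrow> F z = f (fst z)"
    then show ?thesis by blast
  qed
  then obtain F where F_add: "\<And>y z. y \<in> U \<Longrightarrow> z \<in> U \<Longrightarrow> F (y + z) = F y + F z"
    and F_scale: "\<And>d z. z \<in> U \<Longrightarrow> F (d *\<^sub>C z) = d * F z"
    and F_le: "\<And>z. z \<in> U \<Longrightarrow> cmod (F z) \<le> c * norm (T z)"
    and F_f: "\<And>z. z \<in> W \<Longrightarrow> F z = f (fst z)"
    by blast
  define f1 where "f1 v = (if v \<in> X then F (v, 0, 0) else 0)" for v
  define h0 where "h0 a = F (0, a, 0)" for a
  define h1 where "h1 b = F (0, 0, b)" for b
  have F_split: "F (v, a, b) = f1 v + h0 a + h1 b" if "v \<in> X" for v a b
  proof -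
    have "F (v, a, b) = F (v, 0, 0) + F (0, a, b)"
      using F_add[of "(v, 0, 0)" "(0, a, b)"] that by (simp add: U_def)
    also have "F (0, a, b) = F (0, a, 0) + F (0, 0, b)"
      using F_add[of "(0, a, 0)" "(0, 0, b)"] by (simp add: U_def)
    finally show ?thesis using that by (simp add: f1_def h0_def h1_def)
  qed
  have f1: "f1 \<in> cdual X N"
  proof (rule dualI[where C=c])
    show "f1 (x + y) = f1 x + f1 y" if "x \<in> X" "y \<in> X" for x y
      using F_add[of "(x, 0, 0)" "(y, 0, 0)"] that by (simp add: U_def f1_def)
    show "f1 (d *\<^sub>C x) = d * f1 x" if "x \<in> X" for d x
      using F_scale[of "(x, 0, 0)" d] that by (simp add: U_def f1_def scaleC_Pair)
    show "cmod (f1 x) \<le> c * N x" if "x \<in> X" for x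
      using F_le[of "(x, 0, 0)"] that N_nonneg[of x] by (simp add: U_def f1_def T_def norm_Pair)
  qed (simp add: f1_def)
  have h0: "h0 \<in> cdual UNIV M0"
  proof (rule m.dualI[where C="c * \<kappa>"])
    show "h0 (x + y) = h0 x + h0 y" for x y
      using F_add[of "(0, x, 0)" "(0, y, 0)"] by (simp add: U_def h0_def)
    show "h0 (d *\<^sub>C x) = d * h0 x" for d x
      using F_scale[of "(0, x, 0)" d] by (simp add: U_def h0_def scaleC_Pair)
    show "cmod (h0 x) \<le> c * \<kappa> * M0 x" for x
      using F_le[of "(0, x, 0)"] \<kappa> by (simp add: U_def h0_def T_def norm_Pair)
  qed simp
  have h1: "h1 \<in> cdual UNIV norm"
  proof (rule b.dualI[where C="c * \<kappa>"])
    show "h1 (x + y) = h1 x + h1 y" for x y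
      using F_add[of "(0, 0, x)" "(0, 0, y)"] by (simp add: U_def h1_def)
    show "h1 (d *\<^sub>C x) = d * h1 x" for d x
      using F_scale[of "(0, 0, x)" d] by (simp add: U_def h1_def scaleC_Pair)
    show "cmod (h1 x) \<le> c * \<kappa> * norm x" for x
      using F_le[of "(0, 0, x)"] \<kappa> by (simp add: U_def h1_def T_def norm_Pair)
  qed simp
  define \<alpha> where "\<alpha> = dual_norm X N f1"
  define \<beta> where "\<beta> = dual_norm UNIV M0 h0"
  define \<gamma> where "\<gamma> = dual_norm UNIV norm h1"
  have nonneg: "0 \<le> \<alpha>" "0 \<le> \<beta>" "0 \<le> \<gamma>"
    using f1 h0 h1 by (auto simp: \<alpha>_def \<beta>_def \<gamma>_def)
  \<comment> \<open>Rotating the three entries separately makes the moduli add; afterwards the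
    suprema are taken one variable at a time.\<close>
  have sup: "x * \<alpha> + y * \<beta> + z * \<gamma> \<le> c * norm (x, \<kappa> * y, \<kappa> * z)"
    if xyz: "0 \<le> x" "0 \<le> y" "0 \<le> z" for x y z
  proof -
    define B where "B = c * norm (x, \<kappa> * y, \<kappa> * z)"
    have pt: "x * cmod (f1 v) + y * cmod (h0 a) + z * cmod (h1 b) \<le> B"
      if v: "v \<in> X" "N v \<le> 1" "M0 a \<le> 1" "norm b \<le> 1" for v a b
    proof -
      obtain c1 where c1: "cmod c1 = 1" "c1 * f1 v = complex_of_real (cmod (f1 v))" by (rule unimodular_rotation)
      obtain c2 where c2: "cmod c2 = 1" "c2 * h0 a = complex_of_real (cmod (h0 a))" by (rule unimodular_rotation)
      obtain c3 where c3: "cmod c3 = 1" "c3 * h1 b = complex_of_real (cmod (h1 b))" by (rule unimodular_rotation)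
      define Z where "Z = ((complex_of_real x * c1) *\<^sub>C v, (complex_of_real y * c2) *\<^sub>C a, (complex_of_real z * c3) *\<^sub>C b)"
      have ZU: "Z \<in> U" using v by (simp add: Z_def U_def)
      have "F Z = complex_of_real x * (c1 * f1 v) + complex_of_real y * (c2 * h0 a) + complex_of_real z * (c3 * h1 b)"
        unfolding Z_def using v
        by (simp add: F_split dual_scale[OF f1] m.dual_scale[OF h0] b.dual_scale[OF h1] mult.assoc)
      also have "\<dots> = complex_of_real (x * cmod (f1 v) + y * cmod (h0 a) + z * cmod (h1 b))"
        unfolding c1 c2 c3 by simp
      finally have "x * cmod (f1 v) + y * cmod (h0 a) + z * cmod (h1 b) \<le> cmod (F Z)"
        by (simp only: norm_of_real abs_ge_self)
      also have "\<dots> \<le> c * norm (T Z)" by (rule F_le[OF ZU])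
      also have "\<dots> \<le> B"
        unfolding B_def T_def Z_def using v xyz \<kappa> c1 c2 c3 c
        by (intro mult_left_mono norm_triple_mono)
          (auto simp: norm_mult norm_scaleC mult_left_le N_nonneg)
      finally show ?thesis .
    qed
    have "x * \<alpha> \<le> B - y * cmod (h0 a) - z * cmod (h1 b)" if "M0 a \<le> 1" "norm b \<le> 1" for a b
      unfolding \<alpha>_def by (rule dual_norm_mult_le[OF xyz(1)]) (use pt that in \<open>simp add: algebra_simps\<close>)
    then have "y * \<beta> \<le> B - x * \<alpha> - z * cmod (h1 b)" if "norm b \<le> 1" for b
      unfolding \<beta>_def by (intro m.dual_norm_mult_le[OF xyz(2)]) (use that in \<open>force simp: algebra_simps\<close>)
    then have "z * \<gamma> \<le> B - x * \<alpha> - y * \<beta>"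
      unfolding \<gamma>_def by (intro b.dual_norm_mult_le[OF xyz(3)]) (force simp: algebra_simps)
    then show ?thesis by (simp add: B_def)
  qed
  define R where "R = norm (\<alpha>, \<beta> / \<kappa>, \<gamma> / \<kappa>)"
  \<comment> \<open>Testing with the dual norms themselves, divided by
    \<open>\<kappa>\<^sup>2\<close> where \<kappa> enters, is the equality case of Cauchy-Schwarz
    and yields \<open>R * R \<le> c * R\<close>.\<close>
  have "R\<^sup>2 = \<alpha>\<^sup>2 + (\<beta> / \<kappa>)\<^sup>2 + (\<gamma> / \<kappa>)\<^sup>2" unfolding R_def by (rule norm_triple_sq)
  also have "\<dots> = \<alpha> * \<alpha> + \<beta> / \<kappa>\<^sup>2 * \<beta> + \<gamma> / \<kappa>\<^sup>2 * \<gamma>"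
    by (simp add: power2_eq_square)
  also have "\<dots> \<le> c * norm (\<alpha>, \<kappa> * (\<beta> / \<kappa>\<^sup>2), \<kappa> * (\<gamma> / \<kappa>\<^sup>2))"
    using nonneg \<kappa> by (intro sup) auto
  also have "\<dots> = c * R" using \<kappa> by (simp add: R_def power2_eq_square)
  finally have "R * R \<le> c * R" by (simp add: power2_eq_square)
  then have "R \<le> c" using c by (cases "R = 0") (auto simp: R_def)
  then have R: "norm (dual_norm X N f1, dual_norm UNIV M0 h0 / \<kappa>, dual_norm UNIV norm h1 / \<kappa>)
      \<le> sup_on (ball_set \<kappa>) f" by (simp add: R_def \<alpha>_def \<beta>_def \<gamma>_def c_def)
  show thesis
  proof (rule that[OF f1 h0 h1 _ R])
    fix v a b assume v: "v \<in> X" "v = j0 a + j1 b"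
    have "f v = F (v, a, b)" using F_f[of "(v, a, b)"] v by (simp add: W_def U_def)
    then show "f v = f1 v + h0 a + h1 b" using F_split[OF v(1)] by simp
  qed
qed

text \<open>Any splitting, optimal or not, bounds the norm from above. This is applied to the sum of
  the splittings of \<open>s k\<close> and \<open>f\<close>, a splitting of
  \<open>s k + f\<close>.\<close>

lemma decomposition_converse:
  assumes f1: "f1 \<in> cdual X N" and h0: "h0 \<in> cdual UNIV M0" and h1: "h1 \<in> cdual UNIV norm" and \<kappa>: "0 < \<kappa>"
    and f: "\<And>v a b. v \<in> X \<Longrightarrow> v = j0 a + j1 b \<Longrightarrow> f v = f1 v + h0 a + h1 b"
  shows "sup_on (ball_set \<kappa>) f \<le> norm (dual_norm X N f1, dual_norm UNIV M0 h0 / \<kappa>, dual_norm UNIV norm h1 / \<kappa>)"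
    (is "_ \<le> norm ?D")
proof (rule sup_on_least[OF test_set_ball_set])
  fix v assume "v \<in> ball_set \<kappa>"
  then obtain a b where v: "v \<in> X" "v = j0 a + j1 b" "norm (N v, \<kappa> * M0 a, \<kappa> * norm b) \<le> 1"
    unfolding ball_set_def by blast
  have "cmod (f v) \<le> cmod (f1 v) + cmod (h0 a) + cmod (h1 b)"
    unfolding f[OF v(1,2)] by (intro order_trans[OF norm_triangle_ineq] add_right_mono norm_triangle_ineq)
  also have "\<dots> \<le> dual_norm X N f1 * N v + dual_norm UNIV M0 h0 * M0 a + dual_norm UNIV norm h1 * norm b"
    using v by (intro add_mono dual_norm_bound[OF f1] m.dual_norm_bound[OF h0] b.dual_norm_bound[OF h1]) auto
  also have "\<dots> = inner ?D (N v, \<kappa> * M0 a, \<kappa> * norm b)" using \<kappa> by simp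
  also have "\<dots> \<le> norm ?D * norm (N v, \<kappa> * M0 a, \<kappa> * norm b)" by (rule norm_cauchy_schwarz)
  also have "\<dots> \<le> norm ?D * 1" using v(3) by (intro mult_left_mono) auto
  finally show "cmod (f v) \<le> norm ?D" by simp
qed

end

end

section \<open>Transfer to the interpolation space\<close>

context interpolation
begin

context
  fixes M0 :: "'a \<Rightarrow> real"
  assumes M0: "equivalent_norm_on (UNIV :: 'a set) norm M0"
    and LUR: "LUR_on (cdual (UNIV :: 'a set) norm) (dual_norm UNIV M0)"
begin

interpretation m: cnormed "UNIV :: 'a set" M0
  by (rule cnormed.intro) (use M0 in \<open>simp_all add: equivalent_norm_on_def cvec.subspace_UNIV\<close>)

interpretation b: cnormed "UNIV :: 'b set" norm
  by (rule cnormed_UNIV)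

interpretation md: cnormed "cdual (UNIV :: 'a set) M0" "dual_norm UNIV M0"
  by (rule m.cnormed_dual)

interpretation bd: cnormed "cdual (UNIV :: 'b set) norm" "dual_norm UNIV norm"
  by (rule b.cnormed_dual)

interpretation dual: cnormed "cdual X N" "dual_norm X N"
  by (rule cnormed_dual)

text \<open>Members of the set with parameter \<open>n\<close> have a splitting of size at most
  \<open>(1 / c + 1) / n\<close>, hence small \<open>K 1\<close>, and \<open>weakly_null\<close>
  applies.\<close>

lemma sup_on_ball_set_small:
  assumes f: "f \<in> cdual X N" and e: "0 < e"
  obtains i :: nat where "sup_on (ball_set M0 (real (Suc i))) f \<le> e"
proof -
  obtain c where c: "0 < c" "\<And>a. c * norm a \<le> M0 a"
    using M0 unfolding equivalent_norm_on_def by auto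
  obtain \<kappa> where \<kappa>: "0 < \<kappa>" "\<And>v. v \<in> X \<Longrightarrow> N v \<le> 1 \<Longrightarrow> K 1 v \<le> \<kappa> \<Longrightarrow> cmod (f v) \<le> e"
    using weakly_null[OF f e] by blast
  obtain i :: nat where i: "(1 / c + 1) / \<kappa> < real i" using reals_Archimedean2 by blast
  define n where "n = real (Suc i)"
  have n: "0 < n" "(1 / c + 1) / \<kappa> < n" using i by (auto simp: n_def)
  have "sup_on (ball_set M0 n) f \<le> e"
  proof (rule sup_on_least[OF test_set_ball_set[OF M0]])
    fix v assume "v \<in> ball_set M0 n"
    then obtain a b where v: "v \<in> X" "v = j0 a + j1 b" "norm (N v, n * M0 a, n * norm b) \<le> 1"
      unfolding ball_set_def[OF M0] by blast
    have le: "\<bar>N v\<bar> \<le> 1" "\<bar>n * M0 a\<bar> \<le> 1" "\<bar>n * norm b\<bar> \<le> 1"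
      by (rule order_trans[OF norm_triple_ge(1) v(3)] order_trans[OF norm_triple_ge(2) v(3)]
          order_trans[OF norm_triple_ge(3) v(3)])+
    have "n * (c * norm a) \<le> n * M0 a" using n c by (intro mult_left_mono) auto
    then have "n * (c * norm a) \<le> 1" using le(2) abs_ge_self[of "n * M0 a"] by (meson order_trans)
    then have "norm a \<le> 1 / c / n" using n c by (simp add: field_simps)
    moreover have "norm b \<le> 1 / n" using le(3) n by (simp add: field_simps abs_mult)
    moreover have "K 1 v \<le> norm a + 1 * norm b" unfolding v(2) by (rule K_le) simp
    ultimately have "K 1 v \<le> (1 / c + 1) / n" by (simp add: add_divide_distrib)
    also have "\<dots> \<le> \<kappa>" using n \<kappa>(1) by (simp add: field_simps)
    finally show "cmod (f v) \<le> e" using le(1) by (intro \<kappa>(2) v(1)) auto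
  qed
  then show thesis using that by (simp add: n_def)
qed

text \<open>Bundled as a predicate so that splittings can be chosen for a whole sequence.\<close>

definition decomposes :: "real \<Rightarrow> ('e \<Rightarrow> complex) \<Rightarrow> ('e \<Rightarrow> complex) \<Rightarrow> ('a \<Rightarrow> complex) \<Rightarrow> ('b \<Rightarrow> complex) \<Rightarrow> bool" where
  "decomposes \<kappa> f f1 h0 h1 \<longleftrightarrow> f1 \<in> cdual X N \<and> h0 \<in> cdual UNIV M0 \<and> h1 \<in> cdual UNIV norm \<and>
    (\<forall>v a b. v \<in> X \<longrightarrow> v = j0 a + j1 b \<longrightarrow> f v = f1 v + h0 a + h1 b) \<and>
    norm (dual_norm X N f1, dual_norm UNIV M0 h0 / \<kappa>, dual_norm UNIV norm h1 / \<kappa>) \<le> sup_on (ball_set M0 \<kappa>) f"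

lemma decomposesD:
  assumes "decomposes \<kappa> f f1 h0 h1"
  shows "f1 \<in> cdual X N" "h0 \<in> cdual UNIV M0" "h1 \<in> cdual UNIV norm"
    "\<And>v a b. v \<in> X \<Longrightarrow> v = j0 a + j1 b \<Longrightarrow> f v = f1 v + h0 a + h1 b"
    "norm (dual_norm X N f1, dual_norm UNIV M0 h0 / \<kappa>, dual_norm UNIV norm h1 / \<kappa>) \<le> sup_on (ball_set M0 \<kappa>) f"
  using assms unfolding decomposes_def by auto

lemma decomposes_exists:
  assumes "f \<in> cdual X N" "0 < \<kappa>" shows "\<exists>f1 h0 h1. decomposes \<kappa> f f1 h0 h1"
proof (rule decomposition[OF M0 assms])
  fix f1 h0 h1
  assume "f1 \<in> cdual X N" "h0 \<in> cdual UNIV M0" "h1 \<in> cdual UNIV norm"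
    "\<And>v a b. v \<in> X \<Longrightarrow> v = j0 a + j1 b \<Longrightarrow> f v = f1 v + h0 a + h1 b"
    "norm (dual_norm X N f1, dual_norm UNIV M0 h0 / \<kappa>, dual_norm UNIV norm h1 / \<kappa>) \<le> sup_on (ball_set M0 \<kappa>) f"
  then have "decomposes \<kappa> f f1 h0 h1" unfolding decomposes_def by blast
  then show ?thesis by blast
qed

text \<open>Attained splittings turn the norm into a Euclidean norm of three entries, so each
  entry's squared defect is dominated by the total one. Only the \<open>h0\<close> entry carries an
  LUR norm; for the others just the norms converge. The \<open>f1\<close> entry costs
  \<open>2 * sup_on (ball_set M0 \<kappa>) f\<close>; the \<open>h1\<close> entry is beaten by
  splitting \<open>v\<close> at large \<open>t\<close>, where the second part has norm of order
  \<open>t powr (\<theta> - 1)\<close>.\<close>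

lemma ball_set_localization:
  assumes f: "f \<in> cdual X N" and s: "\<And>k. s k \<in> cdual X N" and \<kappa>: "0 < \<kappa>" and e: "0 < e"
    and lim: "(\<lambda>k. sup_on (ball_set M0 \<kappa>) (s k)) \<longlonglongrightarrow> sup_on (ball_set M0 \<kappa>) f"
      "(\<lambda>k. sup_on (ball_set M0 \<kappa>) (s k + f)) \<longlonglongrightarrow> 2 * sup_on (ball_set M0 \<kappa>) f"
  shows "\<forall>\<^sub>F k in sequentially. dual_norm X N (s k - f) \<le> 2 * sup_on (ball_set M0 \<kappa>) f + e"
proof -
  define D where "D g = sup_on (ball_set M0 \<kappa>) g" for g
  obtain C where C: "0 < C" "\<And>a. M0 a \<le> C * norm a"
    using M0 unfolding equivalent_norm_on_def by auto
  obtain f1 h0 h1 where dec: "decomposes \<kappa> f f1 h0 h1" using decomposes_exists[OF f \<kappa>] by blast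
  have "\<forall>k. \<exists>a b c. decomposes \<kappa> (s k) a b c" using decomposes_exists[OF s \<kappa>] by blast
  then obtain F1 H0 H1 where decs: "\<And>k. decomposes \<kappa> (s k) (F1 k) (H0 k) (H1 k)" by metis
  note d = decomposesD[OF dec] and ds = decomposesD[OF decs]
  define x1 x2 x3 where "x1 k = dual_norm X N (F1 k)" and "x2 k = dual_norm UNIV M0 (H0 k) / \<kappa>"
    and "x3 k = dual_norm UNIV norm (H1 k) / \<kappa>" for k
  define y1 y2 y3 where "y1 = dual_norm X N f1" and "y2 = dual_norm UNIV M0 h0 / \<kappa>"
    and "y3 = dual_norm UNIV norm h1 / \<kappa>"
  define z1 z2 z3 where "z1 k = dual_norm X N (F1 k + f1)" and "z2 k = dual_norm UNIV M0 (H0 k + h0) / \<kappa>"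
    and "z3 k = dual_norm UNIV norm (H1 k + h1) / \<kappa>" for k
  note defs = x1_def x2_def x3_def y1_def y2_def y3_def z1_def z2_def z3_def
  have sums: "F1 k + f1 \<in> cdual X N" "H0 k + h0 \<in> cdual UNIV M0" "H1 k + h1 \<in> cdual UNIV norm" for k
    by (intro dual.mem md.mem bd.mem d ds)+
  have nonneg: "0 \<le> x1 k" "0 \<le> x2 k" "0 \<le> x3 k" "0 \<le> y1" "0 \<le> y2" "0 \<le> y3" "0 \<le> z1 k" "0 \<le> z2 k" "0 \<le> z3 k" for k
    using d ds sums \<kappa> unfolding defs
    by (auto intro!: divide_nonneg_pos dual_norm_nonneg m.dual_norm_nonneg b.dual_norm_nonneg)
  have tri: "z1 k \<le> x1 k + y1" "z2 k \<le> x2 k + y2" "z3 k \<le> x3 k + y3" for k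
    unfolding defs add_divide_distrib[symmetric] using \<kappa>
    by (auto intro!: divide_right_mono dual.N_triangle md.N_triangle bd.N_triangle d ds)
  have nx: "(x1 k)\<^sup>2 + (x2 k)\<^sup>2 + (x3 k)\<^sup>2 \<le> (D (s k))\<^sup>2" for k
    using power_mono[OF ds(5)[of k] norm_ge_zero, of 2] unfolding norm_triple_sq defs D_def .
  have ny: "y1\<^sup>2 + y2\<^sup>2 + y3\<^sup>2 \<le> (D f)\<^sup>2"
    using power_mono[OF d(5) norm_ge_zero, of 2] unfolding norm_triple_sq defs D_def .
  have nz: "(D (s k + f))\<^sup>2 \<le> (z1 k)\<^sup>2 + (z2 k)\<^sup>2 + (z3 k)\<^sup>2" for k
  proof -
    have "D (s k + f) \<le> norm (z1 k, z2 k, z3 k)"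
      unfolding D_def defs
    proof (rule decomposition_converse[OF M0 sums \<kappa>])
      fix v a b assume v: "v \<in> X" "v = j0 a + j1 b"
      show "(s k + f) v = (F1 k + f1) v + (H0 k + h0) a + (H1 k + h1) b"
        by (simp add: d(4)[OF v] ds(4)[OF v, of k])
    qed
    moreover have "0 \<le> D (s k + f)" unfolding D_def
      by (intro sup_on_nonneg[OF test_set_ball_set[OF M0]] dual.mem s f)
    ultimately have "(D (s k + f))\<^sup>2 \<le> (norm (z1 k, z2 k, z3 k))\<^sup>2" by (intro power_mono)
    then show ?thesis unfolding norm_triple_sq .
  qed
  have lim0: "(\<lambda>k. 2 * (D (s k))\<^sup>2 + 2 * (D f)\<^sup>2 - (D (s k + f))\<^sup>2) \<longlonglongrightarrow> 0"
    unfolding D_def using lim by (rule defect_tendsto_0)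
  define E1 E2 E3 where "E1 k = 2 * (x1 k)\<^sup>2 + 2 * y1\<^sup>2 - (z1 k)\<^sup>2"
    and "E2 k = 2 * (x2 k)\<^sup>2 + 2 * y2\<^sup>2 - (z2 k)\<^sup>2" and "E3 k = 2 * (x3 k)\<^sup>2 + 2 * y3\<^sup>2 - (z3 k)\<^sup>2" for k
  have E_nonneg: "0 \<le> E1 k" "0 \<le> E2 k" "0 \<le> E3 k" for k
    unfolding E1_def E2_def E3_def
    by (rule order_trans[OF zero_le_power2 convexity_defect]; intro nonneg tri)+
  have E_sum: "E1 k + E2 k + E3 k \<le> 2 * (D (s k))\<^sup>2 + 2 * (D f)\<^sup>2 - (D (s k + f))\<^sup>2" for k
    using nx[of k] ny nz[of k] unfolding E1_def E2_def E3_def by linarith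
  have E_le: "E1 k \<le> 2 * (D (s k))\<^sup>2 + 2 * (D f)\<^sup>2 - (D (s k + f))\<^sup>2"
    "E2 k \<le> 2 * (D (s k))\<^sup>2 + 2 * (D f)\<^sup>2 - (D (s k + f))\<^sup>2"
    "E3 k \<le> 2 * (D (s k))\<^sup>2 + 2 * (D f)\<^sup>2 - (D (s k + f))\<^sup>2" for k
    using E_sum[of k] E_nonneg[of k] by linarith+
  have E_lim: "E1 \<longlonglongrightarrow> 0" "E2 \<longlonglongrightarrow> 0" "E3 \<longlonglongrightarrow> 0"
    by (rule tendsto_sandwich[OF always_eventually always_eventually tendsto_const lim0];
        intro allI E_nonneg E_le)+
  have x1: "x1 \<longlonglongrightarrow> y1"
    by (rule convexity_defect_tendsto(1)[OF _ _ _ _ E_lim(1)[unfolded E1_def[abs_def]]]) (intro nonneg tri)+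
  have x2: "x2 \<longlonglongrightarrow> y2" "z2 \<longlonglongrightarrow> 2 * y2"
    by (rule convexity_defect_tendsto[OF _ _ _ _ E_lim(2)[unfolded E2_def[abs_def]]]; intro nonneg tri)+
  have x3: "x3 \<longlonglongrightarrow> y3"
    by (rule convexity_defect_tendsto(1)[OF _ _ _ _ E_lim(3)[unfolded E3_def[abs_def]]]) (intro nonneg tri)+
  have dual_eq: "cdual (UNIV :: 'a set) norm = cdual UNIV M0"
    using cdual_equivalent[OF _ M0] cnormed.nrm[OF cnormed_UNIV] by blast
  have "(\<lambda>k. dual_norm UNIV M0 (H0 k - h0)) \<longlonglongrightarrow> 0"
  proof -
    have "(\<lambda>k. \<kappa> * x2 k) \<longlonglongrightarrow> \<kappa> * y2" "(\<lambda>k. \<kappa> * z2 k) \<longlonglongrightarrow> \<kappa> * (2 * y2)"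
      by (intro tendsto_mult tendsto_const x2)+
    then have "(\<lambda>k. dual_norm UNIV M0 (H0 k)) \<longlonglongrightarrow> dual_norm UNIV M0 h0"
      "(\<lambda>k. dual_norm UNIV M0 (H0 k + h0)) \<longlonglongrightarrow> 2 * dual_norm UNIV M0 h0"
      using \<kappa> by (simp_all add: x2_def y2_def z2_def)
    moreover have "range H0 \<subseteq> cdual UNIV norm" "h0 \<in> cdual UNIV norm" using d ds by (auto simp: dual_eq)
    ultimately show ?thesis using LUR unfolding LUR_on_def by blast
  qed
  note d0 = this
  \<comment> \<open>A bound for the norm of \<open>H1 k - h1\<close> valid for all late
    \<open>k\<close>.\<close>
  define B where "B = \<kappa> * (y3 + 1) + dual_norm UNIV norm h1"
  have B: "0 \<le> B" using \<kappa> nonneg(6) b.dual_norm_nonneg[OF d(3)] by (simp add: B_def)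
  \<comment> \<open>15 is 5 from the size of the splitting times 3 from the share
    \<open>e / 3\<close>; \<open>B + 1\<close> avoids division by 0.\<close>
  define \<eta> where "\<eta> = e / (15 * (B + 1))"
  have \<eta>: "0 < \<eta>" using e B by (simp add: \<eta>_def)
  have "((\<lambda>t. t powr (\<theta> - 1)) \<longlongrightarrow> 0) at_top"
    using \<theta> by (intro tendsto_neg_powr filterlim_ident) auto
  then have "\<forall>\<^sub>F t in at_top. t powr (\<theta> - 1) < \<eta>" using \<eta> by (rule order_tendstoD(2))
  then have "\<forall>\<^sub>F t in at_top. t powr (\<theta> - 1) < \<eta> \<and> 0 < t"
    using eventually_gt_at_top[of "0::real"] by (rule eventually_conj)
  \<comment> \<open>\<open>t\<close> is fixed before \<open>k\<close>, so the convergence of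
    \<open>H0 k\<close> can absorb the factor \<open>t powr \<theta>\<close>.\<close>
  then obtain t :: real where t: "t powr (\<theta> - 1) < \<eta>" "0 < t"
    by (auto simp: eventually_at_top_linorder)
  have Bt: "5 * t powr \<theta> * (B / t) \<le> e / 3"
  proof -
    have "5 * t powr \<theta> * (B / t) = 5 * B * t powr (\<theta> - 1)" using t by (simp add: powr_diff)
    also have "\<dots> \<le> 5 * (B + 1) * \<eta>" using t \<eta> B by (intro mult_mono) auto
    also have "\<dots> = e / 3" using B by (simp add: \<eta>_def field_simps)
    finally show ?thesis .
  qed
  have "(\<lambda>k. 5 * t powr \<theta> * (dual_norm UNIV M0 (H0 k - h0) * C)) \<longlonglongrightarrow> 5 * t powr \<theta> * (0 * C)"
    by (intro tendsto_mult tendsto_const d0)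
  then have ev1: "\<forall>\<^sub>F k in sequentially. 5 * t powr \<theta> * (dual_norm UNIV M0 (H0 k - h0) * C) < e / 3"
    using e by (intro order_tendstoD(2)) auto
  have ev2: "\<forall>\<^sub>F k in sequentially. x1 k < y1 + e / 3" using x1 e by (intro order_tendstoD(2)) auto
  have ev3: "\<forall>\<^sub>F k in sequentially. x3 k < y3 + 1" using x3 by (intro order_tendstoD(2)) auto
  have y1_le: "y1 \<le> D f"
    using norm_triple_ge(1)[of y1 y2 y3] d(5) unfolding D_def defs by linarith
  show ?thesis
    using ev1 ev2 ev3
  proof eventually_elim
    case (elim k)
    define q where "q = dual_norm UNIV M0 (H0 k - h0)"
    have hk: "H0 k - h0 \<in> cdual UNIV M0" "H1 k - h1 \<in> cdual UNIV norm" "F1 k - f1 \<in> cdual X N"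
      by (intro md.mem bd.mem dual.mem d ds)+
    have q: "0 \<le> q" unfolding q_def by (rule m.dual_norm_nonneg[OF hk(1)])
    have "dual_norm UNIV norm (H1 k) < \<kappa> * (y3 + 1)"
      using elim(3) \<kappa> by (simp add: x3_def field_simps)
    then have H1B: "dual_norm UNIV norm (H1 k - h1) \<le> B"
      using bd.N_diff[OF ds(3)[of k] d(3)] unfolding B_def by linarith
    have F1k: "dual_norm X N (F1 k - f1) \<le> x1 k + y1"
      unfolding x1_def y1_def by (rule dual.N_diff[OF ds(1) d(1)])
    show "dual_norm X N (s k - f) \<le> 2 * sup_on (ball_set M0 \<kappa>) f + e"
    proof (rule dual_norm_least)
      fix v assume v: "v \<in> X" "N v \<le> 1"
      have "K t v \<le> 4 * t powr \<theta> * N v" by (rule K_le_N[OF v(1) t(2)])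
      also have "\<dots> \<le> 4 * t powr \<theta> * 1" using v by (intro mult_left_mono) auto
      \<comment> \<open>5 instead of 4 gives the strict inequality with which a splitting is
        extracted from the infimum.\<close>
      also have "\<dots> < 5 * t powr \<theta>" using t by simp
      finally obtain a b where ab: "v = j0 a + j1 b" "norm a + t * norm b < 5 * t powr \<theta>"
        using K_witness[OF X_S[OF v(1)]] by blast
      have "(s k - f) v = (F1 k - f1) v + (H0 k - h0) a + (H1 k - h1) b"
        by (simp add: d(4)[OF v(1) ab(1)] ds(4)[OF v(1) ab(1), of k])
      then have "cmod ((s k - f) v) \<le> cmod ((F1 k - f1) v) + cmod ((H0 k - h0) a) + cmod ((H1 k - h1) b)"
        by (simp only:) (intro order_trans[OF norm_triangle_ineq] add_right_mono norm_triangle_ineq)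
      moreover have "cmod ((F1 k - f1) v) \<le> x1 k + y1"
        using dual_unit_le[OF hk(3) v] F1k by linarith
      moreover have "cmod ((H0 k - h0) a) \<le> q * C * norm a"
      proof -
        have "cmod ((H0 k - h0) a) \<le> q * M0 a" unfolding q_def by (rule m.dual_norm_bound[OF hk(1)]) simp
        also have "\<dots> \<le> q * (C * norm a)" using C(2) q by (intro mult_left_mono) auto
        finally show ?thesis by (simp add: mult.assoc)
      qed
      moreover have "cmod ((H1 k - h1) b) \<le> B / t * (t * norm b)"
      proof -
        have "cmod ((H1 k - h1) b) \<le> dual_norm UNIV norm (H1 k - h1) * norm b"
          by (rule b.dual_norm_bound[OF hk(2)]) simp
        also have "\<dots> \<le> B * norm b" using H1B by (intro mult_right_mono) auto
        finally show ?thesis using t by simp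
      qed
      moreover have "q * C * norm a \<le> q * C * (5 * t powr \<theta>)"
      proof -
        have "norm a \<le> 5 * t powr \<theta>" using ab(2) t mult_nonneg_nonneg[of t "norm b"] norm_ge_zero[of b] by linarith
        then show ?thesis using q C by (intro mult_left_mono) auto
      qed
      moreover have "B / t * (t * norm b) \<le> B / t * (5 * t powr \<theta>)"
      proof -
        have "t * norm b \<le> 5 * t powr \<theta>" using ab(2) norm_ge_zero[of a] by linarith
        then show ?thesis using B t by (intro mult_left_mono) auto
      qed
      moreover have "q * C * (5 * t powr \<theta>) < e / 3"
        using elim(1) by (simp add: q_def mult_ac)
      moreover have "B / t * (5 * t powr \<theta>) \<le> e / 3" using Bt by (simp add: mult_ac)
      ultimately have "cmod ((s k - f) v) \<le> 2 * y1 + e" using elim(2) by linarith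
      then show "cmod ((s k - f) v) \<le> 2 * sup_on (ball_set M0 \<kappa>) f + e"
        using y1_le unfolding D_def by linarith
    qed
  qed
qed

definition ball_sets :: "nat \<Rightarrow> 'e set" where
  "ball_sets i = ball_set M0 (real (Suc i))"

lemma test_set_ball_sets: "test_set (ball_sets i)"
  unfolding ball_sets_def by (rule test_set_ball_set[OF M0])

lemma ball_sets_equivalent: "equivalent_dual_norm_on X N (l2_sup ball_sets)"
proof -
  obtain C where C: "0 < C" "\<And>a. M0 a \<le> C * norm a"
    using M0 unfolding equivalent_norm_on_def by auto
  \<comment> \<open>Index 0 means \<kappa> = 1: a vector of norm at most 1 has a splitting with both
    parts of norm at most 5, so its triple has norm at most \<open>R\<close>.\<close>
  define R where "R = 1 + (C * 5 + 5)"
  have R: "0 < R" using C by (simp add: R_def)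
  show ?thesis
  proof (rule dual_type_equivalent[OF l2_sup_dual_type[where A=ball_sets, OF test_set_ball_sets]])
    show "0 < 1 / R" using R by simp
    fix f assume f: "f \<in> cdual X N"
    have "dual_norm X N f \<le> R * sup_on (ball_sets 0) f"
    proof (rule dual_norm_least)
      fix v assume v: "v \<in> X" "N v \<le> 1"
      have "K 1 v < 5" using K_le_N[OF v(1), of 1] v(2) by simp
      then obtain a b where ab: "v = j0 a + j1 b" "norm a + 1 * norm b < 5"
        using K_witness[OF X_S[OF v(1)]] by blast
      have "norm (N v, 1 * M0 a, 1 * norm b) \<le> norm (N v) + (norm (1 * M0 a) + norm (1 * norm b))"
        by (intro order_trans[OF norm_Pair_le] add_left_mono norm_Pair_le)
      also have "\<dots> \<le> 1 + (C * 5 + 5)"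
      proof (intro add_mono)
        have "norm a \<le> 5" "norm b \<le> 5" using ab(2) norm_ge_zero[of a] norm_ge_zero[of b] by linarith+
        then have "C * norm a \<le> C * 5" "norm (1 * norm b) \<le> 5" using C by auto
        then show "norm (1 * M0 a) \<le> C * 5" "norm (1 * norm b) \<le> 5" using C(2)[of a] by auto
      qed (use v N_nonneg[of v] in auto)
      finally have "norm (N v, 1 * M0 a, 1 * norm b) \<le> R" by (simp only: R_def)
      then have "sup_on (ball_set M0 1) f * norm (N v, 1 * M0 a, 1 * norm b) \<le> sup_on (ball_set M0 1) f * R"
        by (intro mult_left_mono sup_on_nonneg[OF test_set_ball_set[OF M0] f])
      then show "cmod (f v) \<le> R * sup_on (ball_sets 0) f"
        using ball_set_bound[OF M0 f zero_less_one v(1) ab(1)] by (simp add: ball_sets_def mult.commute)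
    qed
    also have "\<dots> \<le> R * l2_sup ball_sets f"
      using R sup_on_le_l2_sup[where A=ball_sets, OF test_set_ball_sets f] by (intro mult_left_mono) auto
    finally show "1 / R * dual_norm X N f \<le> l2_sup ball_sets f" using R by (simp add: field_simps)
  qed
qed

lemma ball_sets_LUR: "LUR_on (cdual X N) (l2_sup ball_sets)"
  unfolding LUR_on_def
proof (intro ballI allI impI)
  fix f and s :: "nat \<Rightarrow> _"
  assume f: "f \<in> cdual X N" and "range s \<subseteq> cdual X N"
    and lim: "(\<lambda>n. l2_sup ball_sets (s n)) \<longlonglongrightarrow> l2_sup ball_sets f"
      "(\<lambda>n. l2_sup ball_sets (s n + f)) \<longlonglongrightarrow> 2 * l2_sup ball_sets f"
  then have s: "s k \<in> cdual X N" for k by auto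
  have sf: "s k - f \<in> cdual X N" for k by (intro dual.mem s f)
  note lims = l2_sup_LUR_transfer[where A=ball_sets, OF test_set_ball_sets f s lim]
  have "(\<lambda>k. dual_norm X N (s k - f)) \<longlonglongrightarrow> 0"
  proof (rule tendsto_0_if_eventually_le)
    show "0 \<le> dual_norm X N (s k - f)" for k by (rule dual_norm_nonneg[OF sf])
    fix e :: real assume e: "0 < e"
    \<comment> \<open>The localization doubles this supremum, so \<open>e / 4\<close> leaves
      \<open>e / 2\<close> for its error term. The index depends on \<open>e\<close>, which is why
      infinitely many \<kappa> enter the l2 sum.\<close>
    obtain i where i: "sup_on (ball_set M0 (real (Suc i))) f \<le> e / 4"
      by (rule sup_on_ball_set_small[OF f, of "e / 4"]) (use e in auto)
    have "\<forall>\<^sub>F k in sequentially. dual_norm X N (s k - f) \<le> 2 * sup_on (ball_set M0 (real (Suc i))) f + e / 2"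
      using lims[of i] e unfolding ball_sets_def by (intro ball_set_localization[OF f s]) auto
    then show "\<forall>\<^sub>F k in sequentially. dual_norm X N (s k - f) \<le> e"
      by (rule eventually_mono) (use i in linarith)
  qed
  then show "(\<lambda>k. l2_sup ball_sets (s k - f)) \<longlonglongrightarrow> 0"
    by (rule l2_sup_tendsto_0[where A=ball_sets, OF test_set_ball_sets sf])
qed

end

end

theorem theorem9p4:
  fixes j0 :: "'a::complex_banach \<Rightarrow> 'e::{complex_tvs,t2_space}"
    and j1 :: "'b::complex_banach \<Rightarrow> 'e"
    and \<theta> p :: real
  assumes "interpolation_couple j0 j1"
    and "0 < \<theta>" and "\<theta> < 1"
    and "1 < p"
    and "weakly_LUR_on (cdual (UNIV :: 'a set) norm) (dual_norm (UNIV :: 'a set) norm)"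
  shows "\<exists>D. equivalent_dual_norm_on (interp_space j0 j1 \<theta> p) (interp_norm j0 j1 \<theta> p) D \<and>
             LUR_on (cdual (interp_space j0 j1 \<theta> p) (interp_norm j0 j1 \<theta> p)) D"
proof -
  interpret interpolation j0 j1 \<theta> p by unfold_locales (rule assms)+
  obtain M0 where "equivalent_norm_on (UNIV :: 'a set) norm M0"
    "LUR_on (cdual (UNIV :: 'a set) norm) (dual_norm UNIV M0)"
    using cnormed.weakly_LUR_dual_renorming[OF cnormed_UNIV assms(5)] by blast
  from ball_sets_equivalent[OF this] ball_sets_LUR[OF this] show ?thesis by blast
qed

end
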